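(* Let $0\le\epsilon\leq \frac12$, let $n\ge 3$, and let $\rho$ be an $\epsilon$-approximate Markovian MPDO over $n$ qudits with qudit dimension $d$. Then $$\Big|S(\rho) - \sum_{i=2}^{n} S(\{i-1,i\})_{\rho} + \sum_{i=2}^{n-1} S(\{i\})_{\rho}\Big| \leq (n-2)\big(4\epsilon \log d + 2H_b(2\epsilon)\big).$$
   Context: Sites are labelled $1,\dots,n$; site $i$ has Hilbert space $\mathcal{H}_i$ with $\dim \mathcal{H}_i=d<\infty$. For a set $X$ of sites, $\mathcal{H}_X=\bigotimes_{i\in X}\mathcal{H}_i$, $\mathcal{B}(\mathcal{H}_X)$ is the space of operators on it, $\mathcal{I}_X$ is the identity superoperator on $\mathcal{B}(\mathcal{H}_X)$, $\mathrm{tr}_X$ is the partial trace over $X$, $\rho^X$ is the reduced density matrix of $\rho$ on $X$, $S(\rho)=-\mathrm{tr}(\rho\log\rho)$ and $S(X)_\rho=S(\rho^X)$. $\|\cdot\|_1$ is the trace norm. $H_b(p)=-p\log p-(1-p)\log(1-p)$ (with $0\log 0=0$), same logarithm throughout. Definition ($\epsilon$-approximate Markovian MPDO over $n\ge 2$ qudits of dimension $d$). A density matrix $\rho$ on $\mathcal{H}_{\{1,\dots,n\}}$ is an $\epsilon$-approximate Markovian MPDO (matrix product density operator) if there are completely positive trace preserving (CPTP) maps $\Phi_{\{i\}}^{\{i,i+1\}}:\mathcal{B}(\mathcal{H}_i)\to\mathcal{B}(\mathcal{H}_i\otimes\mathcal{H}_{i+1})$, $1\le i\le n-1$, and a density matrix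 $\tilde\rho^{\{1\}}$ on $\mathcal{H}_1$ such that $$\rho = (\mathcal{I}_{\{1,\ldots,n-2\}}\otimes \Phi_{\{n-1\}}^{\{n-1,n\}})\circ \cdots \circ (\mathcal{I}_{\{1\}} \otimes \Phi_{\{2\}}^{\{2,3\}}) \circ \Phi_{\{1\}}^{\{1,2\}}(\tilde{\rho}^{\{1\}})$$ and, for each $i=2,\dots,n-1$, $$\big\|\Phi_{\{i-1\}}^{\{i-1,i\}}(\tilde{\rho}^{\{i-1\}}) - \mathrm{tr}_{i+1}\big[(\mathcal{I}_{\{i-1\}} \otimes \Phi_{\{i\}}^{\{i,i+1\}})\circ \Phi_{\{i-1\}}^{\{i-1,i\}}(\tilde{\rho}^{\{i-1\}})\big]\big\|_1 \leq \epsilon,$$ where $\tilde{\rho}^{\{i\}} := \mathrm{tr}_{1,\ldots,i-1}\big[(\mathcal{I}_{\{1,\ldots,i-2\}} \otimes \Phi_{\{i-1\}}^{\{i-1,i\}})\circ\cdots\circ\Phi_{\{1\}}^{\{1,2\}}(\tilde{\rho}^{\{1\}})\big]$. *)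

theory Defs
  imports "Jordan_Normal_Form.Schur_Decomposition"
begin

text \<open>
  The tensor product of spaces of dimension \<open>k\<close> and \<open>m\<close> is the space of dimension \<open>k * m\<close> in which
  the product of the basis vectors \<open>a < k\<close> and \<open>p < m\<close> has index \<open>a * m + p\<close>. Hence sites
  \<open>1,\<dots>,n\<close> of dimension \<open>d\<close> together have dimension \<open>d ^ n\<close>, site \<open>1\<close> being the most significant digit.
\<close>

definition mat_trace :: "complex mat \<Rightarrow> complex" where
  "mat_trace A = (\<Sum>i<dim_row A. A $$ (i, i))"

definition psd :: "nat \<Rightarrow> complex mat \<Rightarrow> bool" where
  "psd N A \<longleftrightarrow> A \<in> carrier_mat N N \<and> (\<forall>v \<in> carrier_vec N. 0 \<le> (A *\<^sub>v v) \<bullet>c v)"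

definition density :: "nat \<Rightarrow> complex mat \<Rightarrow> bool" where
  "density N A \<longleftrightarrow> psd N A \<and> mat_trace A = 1"

text \<open>
  Functional calculus for Hermitian matrices. The value depends neither on the choice of the
  unitary \<open>U\<close> nor on the order of the eigenvalues \<open>l\<close>.
\<close>

definition unitary_diag :: "complex mat \<Rightarrow> complex mat \<Rightarrow> (nat \<Rightarrow> real) \<Rightarrow> bool" where
  "unitary_diag A U l \<longleftrightarrow>
     U \<in> carrier_mat (dim_row A) (dim_row A) \<and>
     mat_adjoint U * U = 1\<^sub>m (dim_row A) \<and>
     A = U * mat_diag (dim_row A) (\<lambda>i. complex_of_real (l i)) * mat_adjoint U"

definition mat_fun :: "(real \<Rightarrow> real) \<Rightarrow> complex mat \<Rightarrow> complex mat" where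
  "mat_fun f A = (SOME B. \<exists>U l. unitary_diag A U l \<and>
     B = U * mat_diag (dim_row A) (\<lambda>i. complex_of_real (f (l i))) * mat_adjoint U)"

definition trace_norm :: "complex mat \<Rightarrow> real" where
  "trace_norm A = Re (mat_trace (mat_fun sqrt (mat_adjoint A * A)))"

text \<open>
  The base \<open>b\<close> of the logarithm is a parameter. The convention \<open>0 log 0 = 0\<close> holds below because
  \<open>log\<close> is total in HOL, so that the factor \<open>0\<close> decides.
\<close>

definition vn_entropy :: "real \<Rightarrow> complex mat \<Rightarrow> real" where
  "vn_entropy b \<rho> = - Re (mat_trace (\<rho> * mat_fun (log b) \<rho>))"

definition binary_entropy :: "real \<Rightarrow> real \<Rightarrow> real" where
  "binary_entropy b p = - p * log b p - (1 - p) * log b (1 - p)"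

text \<open>Partial traces over the first and over the second factor of dimensions \<open>k\<close>, \<open>m\<close>.\<close>

definition ptrace_left :: "nat \<Rightarrow> nat \<Rightarrow> complex mat \<Rightarrow> complex mat" where
  "ptrace_left k m A = mat m m (\<lambda>(p, q). \<Sum>a<k. A $$ (a * m + p, a * m + q))"

definition ptrace_right :: "nat \<Rightarrow> nat \<Rightarrow> complex mat \<Rightarrow> complex mat" where
  "ptrace_right k m A = mat k k (\<lambda>(a, b). \<Sum>p<m. A $$ (a * m + p, b * m + p))"

text \<open>Reduced density matrix on the sites \<open>i,\<dots>,j\<close>, for \<open>1 \<le> i \<le> j \<le> n\<close>.\<close>

definition reduced :: "nat \<Rightarrow> nat \<Rightarrow> nat \<Rightarrow> nat \<Rightarrow> complex mat \<Rightarrow> complex mat" where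
  "reduced d n i j \<rho> =
     ptrace_left (d ^ (i - 1)) (d ^ (j + 1 - i)) (ptrace_right (d ^ j) (d ^ (n - j)) \<rho>)"

text \<open>
  The superoperator \<open>\<I> \<otimes> \<Phi>\<close>, where \<open>\<I>\<close> acts on \<open>k\<close>-dimensional operators and \<open>\<Phi>\<close> maps
  \<open>m\<close>-dimensional to \<open>m'\<close>-dimensional operators: if \<open>A\<close> is the sum of \<open>E\<^sub>a\<^sub>b \<otimes> A\<^sub>a\<^sub>b\<close> over the matrix
  units \<open>E\<^sub>a\<^sub>b\<close>, the result is the sum of \<open>E\<^sub>a\<^sub>b \<otimes> \<Phi> A\<^sub>a\<^sub>b\<close>.
\<close>

definition block :: "nat \<Rightarrow> complex mat \<Rightarrow> nat \<Rightarrow> nat \<Rightarrow> complex mat" where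
  "block m A a b = mat m m (\<lambda>(p, q). A $$ (a * m + p, b * m + q))"

definition id_tensor ::
    "nat \<Rightarrow> nat \<Rightarrow> nat \<Rightarrow> (complex mat \<Rightarrow> complex mat) \<Rightarrow> complex mat \<Rightarrow> complex mat" where
  "id_tensor k m m' \<Phi> A = mat (k * m') (k * m')
     (\<lambda>(i, j). \<Phi> (block m A (i div m') (j div m')) $$ (i mod m', j mod m'))"

definition superoperator :: "nat \<Rightarrow> nat \<Rightarrow> (complex mat \<Rightarrow> complex mat) \<Rightarrow> bool" where
  "superoperator m m' \<Phi> \<longleftrightarrow>
     (\<forall>A \<in> carrier_mat m m. \<Phi> A \<in> carrier_mat m' m') \<and>
     (\<forall>A \<in> carrier_mat m m. \<forall>B \<in> carrier_mat m m. \<Phi> (A + B) = \<Phi> A + \<Phi> B) \<and>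
     (\<forall>c. \<forall>A \<in> carrier_mat m m. \<Phi> (c \<cdot>\<^sub>m A) = c \<cdot>\<^sub>m \<Phi> A)"

definition cptp :: "nat \<Rightarrow> nat \<Rightarrow> (complex mat \<Rightarrow> complex mat) \<Rightarrow> bool" where
  "cptp m m' \<Phi> \<longleftrightarrow>
     superoperator m m' \<Phi> \<and>
     (\<forall>k A. psd (k * m) A \<longrightarrow> psd (k * m') (id_tensor k m m' \<Phi> A)) \<and>
     (\<forall>A \<in> carrier_mat m m. mat_trace (\<Phi> A) = mat_trace A)"

text \<open>
  \<open>chain d \<Phi> \<sigma> k\<close> is the state on the sites \<open>1,\<dots>,k+1\<close> after applying \<open>\<Phi> 1,\<dots>,\<Phi> k\<close> to the state
  \<open>\<sigma>\<close> of site \<open>1\<close>, where \<open>\<Phi> i\<close> maps operators on site \<open>i\<close> to operators on sites \<open>i\<close> and \<open>i+1\<close>.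
  \<open>chain_site d \<Phi> \<sigma> i\<close> is the state of site \<open>i\<close> just after \<open>\<Phi> (i-1)\<close>.
\<close>

primrec chain ::
    "nat \<Rightarrow> (nat \<Rightarrow> complex mat \<Rightarrow> complex mat) \<Rightarrow> complex mat \<Rightarrow> nat \<Rightarrow> complex mat" where
  "chain d \<Phi> \<sigma> 0 = \<sigma>"
| "chain d \<Phi> \<sigma> (Suc k) = id_tensor (d ^ k) d (d * d) (\<Phi> (Suc k)) (chain d \<Phi> \<sigma> k)"

definition chain_site ::
    "nat \<Rightarrow> (nat \<Rightarrow> complex mat \<Rightarrow> complex mat) \<Rightarrow> complex mat \<Rightarrow> nat \<Rightarrow> complex mat" where
  "chain_site d \<Phi> \<sigma> i = ptrace_left (d ^ (i - 1)) d (chain d \<Phi> \<sigma> (i - 1))"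

definition approx_markov_mpdo :: "real \<Rightarrow> nat \<Rightarrow> nat \<Rightarrow> complex mat \<Rightarrow> bool" where
  "approx_markov_mpdo \<epsilon> n d \<rho> \<longleftrightarrow>
     n \<ge> 2 \<and> density (d ^ n) \<rho> \<and>
     (\<exists>\<Phi> \<sigma>.
        (\<forall>i \<in> {1..n - 1}. cptp d (d * d) (\<Phi> i)) \<and>
        density d \<sigma> \<and>
        \<rho> = chain d \<Phi> \<sigma> (n - 1) \<and>
        (\<forall>i \<in> {2..n - 1}.
           let \<omega> = \<Phi> (i - 1) (chain_site d \<Phi> \<sigma> (i - 1))
           in trace_norm (\<omega> - ptrace_right (d * d) d (id_tensor d d (d * d) (\<Phi> i) \<omega>)) \<le> \<epsilon>))"

end

theory Submission
  imports Defs "Jordan_Normal_Form.Spectral_Radius"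
begin

text \<open>
  Telescoping rewrites the left-hand side as the sum over \<open>i = 2, \<dots>, n - 1\<close> of
  \<open>S(i-1 | i,\<dots>,n) - S(i-1 | i)\<close>, conditional entropies of \<open>\<rho>\<close>. These terms are nonpositive because
  discarding the sites \<open>i + 1, \<dots>, n\<close> cannot decrease the conditional entropy. For the converse,
  the state of the sites \<open>i - 1, \<dots>, n\<close> arises from \<open>\<omega> = \<Phi> (i-1) (chain_site (i-1))\<close> by maps
  acting on the right of site \<open>i - 1\<close> only, so \<open>S(i-1 | i,\<dots>,n) \<ge> S(i-1 | i)\<^sub>\<omega>\<close>, and \<open>\<omega>\<close> is
  \<open>\<epsilon>\<close>-close to the reduced state of \<open>\<rho>\<close> on \<open>i - 1, i\<close>: the Alicki--Fannes inequality applies.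

  Monotonicity of the relative entropy rests on
  \<open>p ln (p / q) - p + q = \<integral> (1 - s) (p - q)\<^sup>2 / (s p + (1 - s) q) ds\<close> over \<open>0 < s < 1\<close>. In the
  eigenbases of two positive matrices the integrand becomes the maximum over \<open>X\<close> of
  \<open>2 Re tr X\<^sup>*(\<rho> - \<sigma>) - s tr X\<^sup>*\<rho>X - (1 - s) tr X\<sigma>X\<^sup>*\<close>, which is additive in \<open>(\<rho>, \<sigma>)\<close> and, by the
  Schwarz inequality for completely positive maps, monotone under such maps. The integral is
  replaced by comparing derivatives of antiderivatives.
\<close>

section \<open>Adjoints, traces and positive semidefinite matrices\<close>

text \<open>All entropies are taken of positive matrices of arbitrary trace. Joint convexity of the
  relative entropy then reads as subadditivity, concavity of the conditional entropy as
  superadditivity, and the two parts of a difference of states enter the Alicki-Fannes argument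
  without normalisation. The price is the pair of trace terms that accompanies the relative entropy
  in the integral formula. Since \<open>ln 0 = 0\<close> in HOL, the relative entropy is finite for
  all arguments, and its inequalities can fail when \<rho> charges the kernel of \<sigma>. The
  predicate \<open>dominated\<close>, an operator inequality between \<rho> and a multiple of
  \<sigma>, excludes this and is carried through every step. The continuity argument yields 2
  \<delta> ln d + (1 + \<delta>) ln (1 + \<delta>) - \<delta> ln \<delta>, with \<delta> half the
  trace norm. This is not the shape of the stated bound; an elementary comparison of the two closes
  the gap for d \<ge> 2, and d = 1 is treated apart.\<close>

lemma mat_adjoint_carrier [simp]:
  "A \<in> carrier_mat n m \<Longrightarrow> mat_adjoint A \<in> carrier_mat m n"
  by (auto simp: mat_adjoint_def mat_of_rows_def)

lemma mat_adjoint_dim [simp]: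
  "dim_row (mat_adjoint A) = dim_col A" "dim_col (mat_adjoint A) = dim_row A"
  by (auto simp: mat_adjoint_def mat_of_rows_def)

lemma mat_adjoint_index [simp]:
  fixes A :: "complex mat"
  shows "i < dim_col A \<Longrightarrow> j < dim_row A \<Longrightarrow> mat_adjoint A $$ (i, j) = cnj (A $$ (j, i))"
  by (auto simp: mat_adjoint_def mat_of_rows_def)

lemma mat_adjoint_adjoint [simp]: "mat_adjoint (mat_adjoint A) = (A :: complex mat)"
  by (rule eq_matI) auto

lemma mat_adjoint_one [simp]: "mat_adjoint (1\<^sub>m n) = (1\<^sub>m n :: complex mat)"
  by (rule eq_matI) auto

lemma mat_adjoint_add:
  fixes A B :: "complex mat"
  shows "A \<in> carrier_mat n m \<Longrightarrow> B \<in> carrier_mat n m \<Longrightarrow>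
    mat_adjoint (A + B) = mat_adjoint A + mat_adjoint B"
  by (rule eq_matI) auto

lemma mat_adjoint_minus:
  fixes A B :: "complex mat"
  shows "A \<in> carrier_mat n m \<Longrightarrow> B \<in> carrier_mat n m \<Longrightarrow>
    mat_adjoint (A - B) = mat_adjoint A - mat_adjoint B"
  by (rule eq_matI) auto

lemma mat_adjoint_smult:
  fixes A :: "complex mat"
  shows "mat_adjoint (c \<cdot>\<^sub>m A) = cnj c \<cdot>\<^sub>m mat_adjoint A"
  by (rule eq_matI) auto

lemma mat_adjoint_mult:
  fixes A B :: "complex mat"
  shows "A \<in> carrier_mat n m \<Longrightarrow> B \<in> carrier_mat m k \<Longrightarrow>
    mat_adjoint (A * B) = mat_adjoint B * mat_adjoint A"
  by (rule eq_matI) (auto simp: scalar_prod_def mult.commute)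

lemma mat_adjoint_diag [simp]:
  "mat_adjoint (mat_diag n (\<lambda>i. complex_of_real (f i))) = mat_diag n (\<lambda>i. complex_of_real (f i))"
  by (rule eq_matI) (auto simp: mat_diag_def)

lemma adjoint_scalar_prod:
  fixes A :: "complex mat"
  assumes "A \<in> carrier_mat n m" "w \<in> carrier_vec m" "v \<in> carrier_vec n"
  shows "(A *\<^sub>v w) \<bullet>c v = w \<bullet>c (mat_adjoint A *\<^sub>v v)"
proof -
  have "(A *\<^sub>v w) \<bullet>c v = (\<Sum>i<n. \<Sum>j<m. A $$ (i, j) * w $ j * cnj (v $ i))"
    using assms by (auto simp: scalar_prod_def atLeast0LessThan sum_distrib_right)
  also have "\<dots> = (\<Sum>j<m. \<Sum>i<n. A $$ (i, j) * w $ j * cnj (v $ i))"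
    by (rule sum.swap)
  also have "\<dots> = w \<bullet>c (mat_adjoint A *\<^sub>v v)"
    using assms by (auto simp: scalar_prod_def atLeast0LessThan sum_distrib_left
        intro!: sum.cong)
  finally show ?thesis .
qed

lemma mat_trace_mult:
  "A \<in> carrier_mat n m \<Longrightarrow> B \<in> carrier_mat m n \<Longrightarrow>
    mat_trace (A * B) = (\<Sum>i<n. \<Sum>j<m. A $$ (i, j) * B $$ (j, i))"
  by (auto simp: mat_trace_def scalar_prod_def atLeast0LessThan)

lemma mat_trace_comm:
  assumes "A \<in> carrier_mat n m" "B \<in> carrier_mat m n"
  shows "mat_trace (A * B) = mat_trace (B * A)"
proof -
  have "mat_trace (A * B) = (\<Sum>i<n. \<Sum>j<m. A $$ (i, j) * B $$ (j, i))"
    by (rule mat_trace_mult[OF assms])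
  also have "\<dots> = (\<Sum>j<m. \<Sum>i<n. A $$ (i, j) * B $$ (j, i))"
    by (rule sum.swap)
  also have "\<dots> = mat_trace (B * A)"
    by (subst mat_trace_mult[OF assms(2,1)]) (simp add: mult.commute)
  finally show ?thesis .
qed

lemma mat_trace_add:
  "A \<in> carrier_mat n n \<Longrightarrow> B \<in> carrier_mat n n \<Longrightarrow> mat_trace (A + B) = mat_trace A + mat_trace B"
  by (auto simp: mat_trace_def sum.distrib)

lemma mat_trace_minus:
  "A \<in> carrier_mat n n \<Longrightarrow> B \<in> carrier_mat n n \<Longrightarrow> mat_trace (A - B) = mat_trace A - mat_trace B"
  by (auto simp: mat_trace_def sum_subtractf)

lemma mat_trace_smult: "A \<in> carrier_mat n n \<Longrightarrow> mat_trace (c \<cdot>\<^sub>m A) = c * mat_trace A"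
  by (auto simp: mat_trace_def sum_distrib_left)

lemma mat_trace_adjoint: "A \<in> carrier_mat n n \<Longrightarrow> mat_trace (mat_adjoint A) = cnj (mat_trace A)"
  by (auto simp: mat_trace_def)

lemma mat_trace_diag [simp]: "mat_trace (mat_diag n f) = (\<Sum>i<n. f i)"
  by (simp add: mat_trace_def mat_diag_def)

lemma unitary_right:
  fixes U :: "complex mat"
  assumes "U \<in> carrier_mat n n" "mat_adjoint U * U = 1\<^sub>m n"
  shows "U * mat_adjoint U = 1\<^sub>m n"
  using mat_mult_left_right_inverse[of "mat_adjoint U" n U] assms by simp

lemma psd_carrier: "psd N A \<Longrightarrow> A \<in> carrier_mat N N"
  by (simp add: psd_def)

lemma unit_vec_form:
  fixes A :: "complex mat"
  assumes "A \<in> carrier_mat N N" "i < N" "j < N"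
  shows "(A *\<^sub>v unit_vec N j) \<bullet>c unit_vec N i = A $$ (i, j)"
proof -
  have "conjugate (unit_vec N i :: complex vec) = unit_vec N i"
    by (rule eq_vecI) (auto simp: unit_vec_def)
  then show ?thesis
    using assms mat_vec_as_mat_mat_mult scalar_prod_right_unit[of i N "row A i"]
    by (simp add: scalar_prod_right_unit)
qed

text \<open>On complex numbers \<open>0 \<le> z\<close> includes that \<open>z\<close> is real, so
  positivity already makes the form real and polarization gives hermiticity: on
  \<open>e_i + c e_j\<close>, c = 0 makes the diagonal real, c = 1 relates the imaginary parts of
  the entries (i, j) and (j, i), and c = \<i> their real parts.\<close>

lemma psd_hermitian:
  assumes "psd N A"
  shows "mat_adjoint A = A"
proof -
  have A: "A \<in> carrier_mat N N" using assms by (rule psd_carrier)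
  have ev: "A *\<^sub>v unit_vec N i \<in> carrier_vec N" for i using A by auto
  note entry = unit_vec_form[OF A]
  have form: "(A *\<^sub>v (unit_vec N i + c \<cdot>\<^sub>v unit_vec N j)) \<bullet>c (unit_vec N i + c \<cdot>\<^sub>v unit_vec N j)
      = A $$ (i, i) + c * A $$ (i, j) + cnj c * A $$ (j, i) + c * cnj c * A $$ (j, j)"
    if "i < N" "j < N" for i j c
  proof -
    have "A *\<^sub>v (unit_vec N i + c \<cdot>\<^sub>v unit_vec N j) =
        A *\<^sub>v unit_vec N i + c \<cdot>\<^sub>v (A *\<^sub>v unit_vec N j)"
      using A by (auto simp: mult_add_distrib_mat_vec[of A N N] mult_mat_vec[of A N N])
    then show ?thesis
      using that A ev
      by (simp add: conjugate_add_vec[of _ N] conjugate_smult_vec add_scalar_prod_distrib[of _ N]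
          scalar_prod_add_distrib[of _ N] smult_scalar_prod_distrib[of _ N]
          scalar_prod_smult_distrib[of _ N] entry algebra_simps del: conjugate_complex_def)
         (simp add: algebra_simps)
  qed
  have ge: "0 \<le> A $$ (i, i) + c * A $$ (i, j) + cnj c * A $$ (j, i) + c * cnj c * A $$ (j, j)"
    if "i < N" "j < N" for i j c
  proof -
    have "unit_vec N i + c \<cdot>\<^sub>v unit_vec N j \<in> carrier_vec N" by simp
    then show ?thesis using assms form[OF that, of c] unfolding psd_def by metis
  qed
  have Im0: "Im (A $$ (i, i)) = 0" if "i < N" for i
    using ge[OF that that, of 0] by (simp add: less_eq_complex_def)
  have "cnj (A $$ (j, i)) = A $$ (i, j)" if "i < N" "j < N" for i j
    using ge[OF that, of 1] ge[OF that, of \<i>] Im0[OF that(1)] Im0[OF that(2)]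
    by (auto simp: less_eq_complex_def complex_eq_iff)
  then show ?thesis using A by (intro eq_matI) auto
qed

lemma psdI:
  assumes "A \<in> carrier_mat N N"
    and "\<And>v. v \<in> carrier_vec N \<Longrightarrow> 0 \<le> (A *\<^sub>v v) \<bullet>c v"
  shows "psd N A"
  using assms by (simp add: psd_def)

lemma psd_sandwich:
  assumes "psd N A" "X \<in> carrier_mat M N"
  shows "psd M (X * A * mat_adjoint X)"
proof (rule psdI)
  have A: "A \<in> carrier_mat N N" using assms(1) by (rule psd_carrier)
  show "X * A * mat_adjoint X \<in> carrier_mat M M" using A assms(2) by auto
  fix v :: "complex vec" assume v: "v \<in> carrier_vec M"
  let ?w = "mat_adjoint X *\<^sub>v v"
  have X': "mat_adjoint X \<in> carrier_mat N M" using assms(2) by simp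
  have w: "?w \<in> carrier_vec N" using X' v by auto
  have "X * A * mat_adjoint X *\<^sub>v v = X *\<^sub>v (A *\<^sub>v ?w)"
    using A assms(2) X' v w by (simp add: assoc_mult_mat_vec[of _ M N] assoc_mult_mat_vec[of _ M N _ M])
  moreover have "(X *\<^sub>v (A *\<^sub>v ?w)) \<bullet>c v = (A *\<^sub>v ?w) \<bullet>c ?w"
    using adjoint_scalar_prod[OF assms(2) _ v, of "A *\<^sub>v ?w"] A w by auto
  ultimately show "0 \<le> (X * A * mat_adjoint X *\<^sub>v v) \<bullet>c v"
    using assms(1) w by (auto simp: psd_def)
qed

lemma psd_add: "psd N A \<Longrightarrow> psd N B \<Longrightarrow> psd N (A + B)"
  unfolding psd_def
  by (auto simp: add_mult_distrib_mat_vec[of _ N N] add_scalar_prod_distrib[of _ N])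

lemma smult_mult_mat_vec:
  "A \<in> carrier_mat n m \<Longrightarrow> v \<in> carrier_vec m \<Longrightarrow> (c \<cdot>\<^sub>m A) *\<^sub>v v = c \<cdot>\<^sub>v (A *\<^sub>v (v :: complex vec))"
  by (rule eq_vecI) (auto simp: scalar_prod_def sum_distrib_left mult.assoc)

lemma psd_smult: "psd N A \<Longrightarrow> 0 \<le> c \<Longrightarrow> psd N (complex_of_real c \<cdot>\<^sub>m A)"
  unfolding psd_def
  by (auto simp: smult_mult_mat_vec[of _ N N] smult_scalar_prod_distrib[of _ N] less_eq_complex_def)

lemma psd_diag: "(\<And>i. i < N \<Longrightarrow> 0 \<le> l i) \<Longrightarrow> psd N (mat_diag N (\<lambda>i. complex_of_real (l i)))"
proof (rule psdI)
  assume l: "\<And>i. i < N \<Longrightarrow> 0 \<le> l i"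
  fix v :: "complex vec" assume v: "v \<in> carrier_vec N"
  have "(mat_diag N (\<lambda>i. complex_of_real (l i)) *\<^sub>v v) $ k = complex_of_real (l k) * v $ k" if "k < N" for k
  proof -
    have "(mat_diag N (\<lambda>i. complex_of_real (l i)) *\<^sub>v v) $ k =
        (\<Sum>j<N. (if k = j then complex_of_real (l j) else 0) * v $ j)"
      using that v by (auto simp: scalar_prod_def mat_diag_def atLeast0LessThan)
    then show ?thesis using that by (simp add: sum.remove[of _ k])
  qed
  then have "(mat_diag N (\<lambda>i. complex_of_real (l i)) *\<^sub>v v) \<bullet>c v =
      (\<Sum>k<N. complex_of_real (l k * (cmod (v $ k))\<^sup>2))"
    unfolding scalar_prod_def using v
    by (auto simp: atLeast0LessThan complex_norm_square simp del: mat_diag_dim of_real_power intro!: sum.cong)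
  moreover have "0 \<le> \<dots>"
    using l by (auto intro!: sum_nonneg simp: less_eq_complex_def)
  ultimately show "0 \<le> (mat_diag N (\<lambda>i. complex_of_real (l i)) *\<^sub>v v) \<bullet>c v" by simp
qed simp

lemma psd_index_diag:
  assumes "psd N A" "i < N"
  shows "0 \<le> A $$ (i, i)"
proof -
  have A: "A \<in> carrier_mat N N" using assms(1) by (rule psd_carrier)
  show ?thesis using assms unit_vec_form[OF A, of i i] unfolding psd_def by (metis unit_vec_carrier)
qed

lemma psd_trace:
  assumes "psd N A"
  shows "0 \<le> mat_trace A"
  unfolding mat_trace_def using assms psd_carrier[OF assms]
  by (auto intro!: sum_nonneg psd_index_diag)

section \<open>The spectral theorem and functional calculus\<close>

text \<open>Gram-Schmidt on a basis containing \<open>v\<close> yields an orthogonal list with head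
  \<open>v\<close>; dividing each vector by its norm makes it orthonormal, so the first column is
  only a multiple of \<open>v\<close>.\<close>

lemma unitary_completion:
  fixes v :: "complex vec"
  assumes v: "v \<in> carrier_vec n" and v0: "v \<noteq> 0\<^sub>v n"
  shows "\<exists>W c. W \<in> carrier_mat n n \<and> mat_adjoint W * W = 1\<^sub>m n \<and> col W 0 = c \<cdot>\<^sub>v v"
proof -
  interpret cof_vec_space n "TYPE(complex)" .
  have n: "n \<noteq> 0" using v v0 by auto
  define b where "b = basis_completion v"
  define ws where "ws = gram_schmidt n b"
  note bc = basis_completion[OF v v0, folded b_def]
  obtain vs where bv: "b = v # vs" using bc(6,7) n by (cases b) auto
  have ws: "set ws \<subseteq> carrier_vec n" "corthogonal ws" "length ws = n"
    using gram_schmidt_result[OF bc(2) bc(4) bc(5) refl, folded ws_def] bc(6) by auto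
  have hd: "hd ws = v" using gram_schmidt_hd[OF v, of vs, folded bv] unfolding ws_def .
  have wc: "ws ! j \<in> carrier_vec n" if "j < n" for j using that ws by auto
  have orth: "(ws ! i \<bullet>c ws ! j = 0) = (i \<noteq> j)" if "i < n" "j < n" for i j
    using corthogonalD[OF ws(2)] that ws(3) by auto
  define r where "r j = Re (ws ! j \<bullet>c ws ! j)" for j
  have r: "ws ! j \<bullet>c ws ! j = complex_of_real (r j)" "r j > 0" if "j < n" for j
  proof -
    have "0 \<le> ws ! j \<bullet>c ws ! j" by (rule conjugate_square_ge_0_vec)
    moreover have "ws ! j \<bullet>c ws ! j \<noteq> 0" using orth[OF that that] by simp
    ultimately show "ws ! j \<bullet>c ws ! j = complex_of_real (r j)" "r j > 0"
      by (auto simp: r_def less_eq_complex_def complex_eq_iff)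
  qed
  define c where "c j = complex_of_real (1 / sqrt (r j))" for j
  define W where "W = mat n n (\<lambda>(i, j). c j * (ws ! j) $ i)"
  have W: "W \<in> carrier_mat n n" by (simp add: W_def)
  have "(mat_adjoint W * W) $$ (i, j) = (if i = j then 1 else 0)" if ij: "i < n" "j < n" for i j
  proof -
    have "(mat_adjoint W * W) $$ (i, j) = (\<Sum>k<n. cnj (W $$ (k, i)) * W $$ (k, j))"
      using ij W by (auto simp: scalar_prod_def atLeast0LessThan)
    also have "\<dots> = (\<Sum>k<n. c i * c j * ((ws ! j) $ k * cnj ((ws ! i) $ k)))"
      using ij by (intro sum.cong) (auto simp: W_def c_def)
    also have "\<dots> = c i * c j * (ws ! j \<bullet>c ws ! i)"
      using wc[OF ij(1)] by (simp add: scalar_prod_def sum_distrib_left atLeast0LessThan)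
    also have "\<dots> = (if i = j then 1 else 0)"
    proof (cases "i = j")
      case True
      have "c i * c i * complex_of_real (r i) = complex_of_real (1 / sqrt (r i) * (1 / sqrt (r i)) * r i)"
        unfolding c_def of_real_mult[symmetric] ..
      also have "1 / sqrt (r i) * (1 / sqrt (r i)) * r i = 1"
        using r(2)[OF ij(1)] by (simp add: field_simps)
      finally show ?thesis using True r(1)[OF ij(1)] by simp
    next
      case False
      then show ?thesis using orth[OF ij(2,1)] by simp
    qed
    finally show ?thesis .
  qed
  then have WW: "mat_adjoint W * W = 1\<^sub>m n"
    using W by (intro eq_matI) auto
  have "ws ! 0 = v" using hd ws(3) n by (cases ws) auto
  then have "col W 0 = c 0 \<cdot>\<^sub>v v"
    using n v by (intro eq_vecI) (auto simp: W_def)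
  then show ?thesis using W WW by blast
qed

text \<open>The direct sum of the scalar \<open>c\<close> and \<open>A\<close>; it carries a
  diagonalisation of the deflated block up by one dimension.\<close>

definition extend_mat :: "complex \<Rightarrow> complex mat \<Rightarrow> complex mat" where
  "extend_mat c A = mat (Suc (dim_row A)) (Suc (dim_col A)) (\<lambda>(i, j).
     if i = 0 \<and> j = 0 then c else if i = 0 \<or> j = 0 then 0 else A $$ (i - 1, j - 1))"

lemma extend_mat_carrier [simp]:
  "A \<in> carrier_mat n m \<Longrightarrow> extend_mat c A \<in> carrier_mat (Suc n) (Suc m)"
  by (auto simp: extend_mat_def)

lemma extend_mat_adjoint: "mat_adjoint (extend_mat c A) = extend_mat (cnj c) (mat_adjoint A)"
  by (rule eq_matI) (auto simp: extend_mat_def)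

lemma extend_mat_mult:
  assumes "A \<in> carrier_mat n n" "B \<in> carrier_mat n n"
  shows "extend_mat a A * extend_mat b B = extend_mat (a * b) (A * B)"
proof (rule eq_matI)
  fix i j
  assume "i < dim_row (extend_mat (a * b) (A * B))" "j < dim_col (extend_mat (a * b) (A * B))"
  then have ij: "i < Suc n" "j < Suc n" using assms by (auto simp: extend_mat_def)
  then have "(extend_mat a A * extend_mat b B) $$ (i, j) =
      (\<Sum>k<Suc n. extend_mat a A $$ (i, k) * extend_mat b B $$ (k, j))"
    using assms by (simp add: extend_mat_def scalar_prod_def atLeast0LessThan)
  also have "\<dots> = extend_mat a A $$ (i, 0) * extend_mat b B $$ (0, j) +
      (\<Sum>k<n. extend_mat a A $$ (i, Suc k) * extend_mat b B $$ (Suc k, j))"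
    by (rule sum.lessThan_Suc_shift)
  also have "\<dots> = extend_mat (a * b) (A * B) $$ (i, j)"
    using ij assms
    by (cases i; cases j) (simp_all add: extend_mat_def scalar_prod_def atLeast0LessThan)
  finally show "(extend_mat a A * extend_mat b B) $$ (i, j) = extend_mat (a * b) (A * B) $$ (i, j)" .
qed (auto simp: extend_mat_def)

text \<open>Deflation: in a unitary basis whose first vector is an eigenvector, the first column of
  the matrix is (e, 0, ..., 0). Hermiticity clears the first row as well and makes e real, and the
  induction hypothesis diagonalises the remaining block.\<close>

lemma hermitian_unitary_diag:
  assumes "A \<in> carrier_mat n n" "mat_adjoint A = A"
  shows "\<exists>U l. unitary_diag A U l"
  using assms
proof (induction n arbitrary: A)
  case 0
  then have "unitary_diag A (1\<^sub>m 0) (\<lambda>_. 0)"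
    by (auto simp: unitary_diag_def intro!: eq_matI)
  then show ?case by blast
next
  case (Suc n)
  let ?n = "Suc n"
  note A = Suc.prems(1) and herm = Suc.prems(2)
  obtain e v where "eigenvector A v e"
    using spectrum_non_empty[OF A] by (auto simp: spectrum_def eigenvalue_def)
  then have v: "v \<in> carrier_vec ?n" "v \<noteq> 0\<^sub>v ?n" and Av: "A *\<^sub>v v = e \<cdot>\<^sub>v v"
    using A by (auto simp: eigenvector_def)
  obtain W c where W: "W \<in> carrier_mat ?n ?n" and WW: "mat_adjoint W * W = 1\<^sub>m ?n"
    and col: "col W 0 = c \<cdot>\<^sub>v v"
    using unitary_completion[OF v] by blast
  note WW' = unitary_right[OF W WW]
  have W': "mat_adjoint W \<in> carrier_mat ?n ?n" using W by simp
  define B where "B = mat_adjoint W * A * W"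
  have B: "B \<in> carrier_mat ?n ?n" using W W' A by (simp add: B_def mult_carrier_mat[of _ ?n ?n])
  have hB: "mat_adjoint B = B"
    unfolding B_def
    using W W' A herm by (simp add: mat_adjoint_mult[of _ ?n ?n _ ?n] assoc_mult_mat[of _ ?n ?n _ ?n _ ?n])
  have AW: "A = W * B * mat_adjoint W"
  proof -
    have "W * B * mat_adjoint W = (W * mat_adjoint W) * A * (W * mat_adjoint W)"
      unfolding B_def using W W' A
      by (smt (verit) assoc_mult_mat mult_carrier_mat)
    then show ?thesis using WW' A by simp
  qed
  have "col (A * W) 0 = e \<cdot>\<^sub>v col W 0"
  proof -
    have "col (A * W) 0 = A *\<^sub>v col W 0" by (rule col_mult2[OF A W]) simp
    also have "\<dots> = c \<cdot>\<^sub>v (A *\<^sub>v v)" using A v by (simp add: col mult_mat_vec[of A ?n ?n])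
    also have "\<dots> = e \<cdot>\<^sub>v col W 0" by (simp add: Av col smult_smult_assoc mult.commute)
    finally show ?thesis .
  qed
  then have B0: "B $$ (i, 0) = (if i = 0 then e else 0)" if "i < ?n" for i
  proof -
    have "B = mat_adjoint W * (A * W)" unfolding B_def by (rule assoc_mult_mat[OF W' A W])
    then have "B $$ (i, 0) = row (mat_adjoint W) i \<bullet> col (A * W) 0"
      using that W A by simp
    also have "\<dots> = e * (row (mat_adjoint W) i \<bullet> col W 0)"
      using that W by (subst \<open>col (A * W) 0 = _\<close>) simp
    also have "row (mat_adjoint W) i \<bullet> col W 0 = (mat_adjoint W * W) $$ (i, 0)"
      using that W by simp
    also have "\<dots> = (if i = 0 then 1 else 0)" using that by (simp add: WW)
    finally show ?thesis by simp
  qed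
  have B0': "B $$ (0, i) = (if i = 0 then cnj e else 0)" if "i < ?n" for i
  proof -
    have "B $$ (0, i) = cnj (B $$ (i, 0))"
      using that B arg_cong[OF hB, of "\<lambda>M. M $$ (0, i)"] by simp
    then show ?thesis using B0[OF that] by simp
  qed
  have e: "complex_of_real (Re e) = e"
    using B0[of 0] B0'[of 0] by (simp add: complex_eq_iff)
  define C where "C = mat n n (\<lambda>(i, j). B $$ (Suc i, Suc j))"
  have C: "C \<in> carrier_mat n n" by (simp add: C_def)
  have "mat_adjoint C = C"
  proof (rule eq_matI)
    fix i j assume "i < dim_row C" "j < dim_col C"
    then show "mat_adjoint C $$ (i, j) = C $$ (i, j)"
      using B arg_cong[OF hB, of "\<lambda>M. M $$ (Suc i, Suc j)"] by (simp add: C_def)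
  qed (use C in auto)
  with Suc.IH[OF C] obtain V l where "unitary_diag C V l" by blast
  then have V: "V \<in> carrier_mat n n" and VV: "mat_adjoint V * V = 1\<^sub>m n"
    and CV: "C = V * mat_diag n (\<lambda>i. complex_of_real (l i)) * mat_adjoint V"
    using C by (auto simp: unitary_diag_def)
  have V': "mat_adjoint V \<in> carrier_mat n n" using V by simp
  let ?D = "mat_diag n (\<lambda>i. complex_of_real (l i))"
  define l' where "l' i = (if i = 0 then Re e else l (i - 1))" for i
  let ?D' = "mat_diag ?n (\<lambda>i. complex_of_real (l' i))"
  let ?E = "mat 1 1 (\<lambda>_. e)"
  define V1 where "V1 = extend_mat 1 V"
  have V1: "V1 \<in> carrier_mat ?n ?n" using V by (simp add: V1_def)
  have V1': "mat_adjoint V1 = extend_mat 1 (mat_adjoint V)"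
    by (simp add: V1_def extend_mat_adjoint)
  have D': "?D' = extend_mat e ?D"
  proof (rule eq_matI)
    fix i j assume "i < dim_row (extend_mat e ?D)" "j < dim_col (extend_mat e ?D)"
    then show "?D' $$ (i, j) = extend_mat e ?D $$ (i, j)"
      by (cases i; cases j) (simp_all add: extend_mat_def mat_diag_def l'_def e)
  qed (simp_all add: extend_mat_def mat_diag_def)
  have V1V1: "mat_adjoint V1 * V1 = 1\<^sub>m ?n"
    unfolding V1' unfolding V1_def extend_mat_mult[OF V' V] VV
    by (rule eq_matI) (auto simp: extend_mat_def)
  have "V1 * ?D' * mat_adjoint V1 = extend_mat e C"
    unfolding V1' unfolding V1_def D' CV
    using V V' by (simp add: extend_mat_mult[of _ n])
  also have "\<dots> = B"
  proof (rule eq_matI)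
    fix i j assume ij: "i < dim_row B" "j < dim_col B"
    then show "extend_mat e C $$ (i, j) = B $$ (i, j)"
      using B B0[of i] B0'[of j]
      by (cases i; cases j) (simp_all add: extend_mat_def C_def)
  qed (use B C in \<open>simp_all add: extend_mat_def\<close>)
  finally have BV: "B = V1 * ?D' * mat_adjoint V1" by simp
  have V1a: "mat_adjoint V1 \<in> carrier_mat ?n ?n" and Dc: "?D' \<in> carrier_mat ?n ?n" using V1 by auto
  have "unitary_diag A (W * V1) l'"
  proof -
    have adj: "mat_adjoint (W * V1) = mat_adjoint V1 * mat_adjoint W"
      using W V1 by (rule mat_adjoint_mult)
    have "mat_adjoint (W * V1) * (W * V1) = mat_adjoint V1 * (mat_adjoint W * W) * V1"
      unfolding adj using W W' V1 V1a by (smt (verit) assoc_mult_mat mult_carrier_mat)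
    also have "\<dots> = 1\<^sub>m ?n"
      unfolding WW by (simp only: right_mult_one_mat[OF V1a] V1V1)
    finally have u: "mat_adjoint (W * V1) * (W * V1) = 1\<^sub>m ?n" .
    have "A = W * (V1 * ?D' * mat_adjoint V1) * mat_adjoint W" using AW BV by simp
    also have "\<dots> = (W * V1) * ?D' * mat_adjoint (W * V1)"
      unfolding adj using W W' V1 V1a Dc by (smt (verit) assoc_mult_mat mult_carrier_mat)
    finally show ?thesis
      using A u W V1 by (simp add: unitary_diag_def)
  qed
  then show ?case by blast
qed

lemma unitary_diagD:
  assumes "A \<in> carrier_mat n n" "unitary_diag A U l"
  shows "U \<in> carrier_mat n n" "mat_adjoint U * U = 1\<^sub>m n" "U * mat_adjoint U = 1\<^sub>m n"
    "A = U * mat_diag n (\<lambda>i. complex_of_real (l i)) * mat_adjoint U"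
  using assms unitary_right[of U n] by (auto simp: unitary_diag_def)

lemma unitary_diag_conj:
  assumes "A \<in> carrier_mat n n" "unitary_diag A U l"
  shows "mat_adjoint U * A * U = mat_diag n (\<lambda>i. complex_of_real (l i))"
proof -
  note U = unitary_diagD[OF assms]
  let ?D = "mat_diag n (\<lambda>i. complex_of_real (l i))"
  have U': "mat_adjoint U \<in> carrier_mat n n" and D: "?D \<in> carrier_mat n n" using U by auto
  have "mat_adjoint U * A * U = (mat_adjoint U * U) * ?D * (mat_adjoint U * U)"
    unfolding U(4) using U(1) U' D by (smt (verit) assoc_mult_mat mult_carrier_mat)
  then show ?thesis using U(2) D by simp
qed

lemma psd_unitary_diag:
  assumes "psd N A"
  shows "\<exists>U l. unitary_diag A U l \<and> (\<forall>i<N. 0 \<le> l i)"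
proof -
  have A: "A \<in> carrier_mat N N" using assms by (rule psd_carrier)
  obtain U l where U: "unitary_diag A U l"
    using hermitian_unitary_diag[OF A psd_hermitian[OF assms]] by blast
  have "psd N (mat_diag N (\<lambda>i. complex_of_real (l i)))"
    using psd_sandwich[OF assms, of "mat_adjoint U" N] unitary_diag_conj[OF A U]
      unitary_diagD[OF A U] by simp
  then have "0 \<le> l i" if "i < N" for i
    using psd_index_diag[OF _ that, of "mat_diag N (\<lambda>i. complex_of_real (l i))"] that
    by (simp add: mat_diag_def less_eq_complex_def)
  then show ?thesis using U by blast
qed

text \<open>If \<open>U l U\<^sup>* = V m V\<^sup>*\<close>, then \<open>W = U\<^sup>* V\<close> satisfies \<open>l\<^sub>i W\<^sub>i\<^sub>j = W\<^sub>i\<^sub>j m\<^sub>j\<close>,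
  and this survives the application of any function to the eigenvalues.\<close>

lemma mat_fun_unitary_diag:
  assumes A: "A \<in> carrier_mat n n" and U: "unitary_diag A U l"
  shows "mat_fun f A = U * mat_diag n (\<lambda>i. complex_of_real (f (l i))) * mat_adjoint U"
proof -
  have uniq: "V * mat_diag n (\<lambda>i. complex_of_real (f (m i))) * mat_adjoint V =
      U * mat_diag n (\<lambda>i. complex_of_real (f (l i))) * mat_adjoint U"
    if V: "unitary_diag A V m" for V m
  proof -
    note u = unitary_diagD[OF A U] and v = unitary_diagD[OF A V]
    let ?Dl = "\<lambda>f. mat_diag n (\<lambda>i. complex_of_real (f (l i)))"
    let ?Dm = "\<lambda>f. mat_diag n (\<lambda>i. complex_of_real (f (m i)))"
    define W where "W = mat_adjoint U * V"
    have U': "mat_adjoint U \<in> carrier_mat n n" and V': "mat_adjoint V \<in> carrier_mat n n"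
      and W: "W \<in> carrier_mat n n" and D: "?Dl f \<in> carrier_mat n n" "?Dm f \<in> carrier_mat n n"
        "?Dl id \<in> carrier_mat n n" "?Dm id \<in> carrier_mat n n"
      using u v by (auto simp: W_def)
    have "?Dl id * W = mat_adjoint U * A * V"
    proof -
      have "?Dl id = mat_adjoint U * A * U" using unitary_diag_conj[OF A U] by simp
      then have "?Dl id * W = mat_adjoint U * A * (U * mat_adjoint U) * V"
        unfolding W_def using u(1) U' v(1) A by (smt (verit) assoc_mult_mat mult_carrier_mat)
      then show ?thesis using u(3) U' A v(1) by simp
    qed
    moreover have "W * ?Dm id = mat_adjoint U * A * V"
    proof -
      have "?Dm id = mat_adjoint V * A * V" using unitary_diag_conj[OF A V] by simp
      then have "W * ?Dm id = mat_adjoint U * (V * mat_adjoint V) * A * V"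
        unfolding W_def using v(1) V' U' A by (smt (verit) assoc_mult_mat mult_carrier_mat)
      also have "mat_adjoint U * (V * mat_adjoint V) = mat_adjoint U"
        unfolding v(3) by (rule right_mult_one_mat[OF U'])
      finally show ?thesis .
    qed
    ultimately have eq: "?Dl id * W = W * ?Dm id" by simp
    have "complex_of_real (l i) * W $$ (i, j) = W $$ (i, j) * complex_of_real (m j)"
      if "i < n" "j < n" for i j
      using that arg_cong[OF eq, of "\<lambda>M. M $$ (i, j)"] W
      by (simp add: mat_diag_mult_left[of _ n n] mat_diag_mult_right[of _ n n])
    then have "W $$ (i, j) = 0 \<or> l i = m j" if "i < n" "j < n" for i j
      using that by (metis mult.commute mult_cancel_left of_real_eq_iff)
    then have "complex_of_real (f (l i)) * W $$ (i, j) = W $$ (i, j) * complex_of_real (f (m j))"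
      if "i < n" "j < n" for i j
      using that by fastforce
    then have eqf: "?Dl f * W = W * ?Dm f"
      using W by (intro eq_matI)
        (auto simp: mat_diag_mult_left[of _ n n] mat_diag_mult_right[of _ n n])
    have VUW: "V = U * W" and V'UW: "W * mat_adjoint V = mat_adjoint U"
    proof -
      have "U * W = (U * mat_adjoint U) * V"
        unfolding W_def using u(1) U' v(1) by (smt (verit) assoc_mult_mat mult_carrier_mat)
      then show "V = U * W" using u(3) v(1) by simp
      have "W * mat_adjoint V = mat_adjoint U * (V * mat_adjoint V)"
        unfolding W_def using V' U' v(1) by (smt (verit) assoc_mult_mat mult_carrier_mat)
      then show "W * mat_adjoint V = mat_adjoint U"
        unfolding v(3) by (simp only: right_mult_one_mat[OF U'])
    qed
    have "V * ?Dm f * mat_adjoint V = U * (W * ?Dm f) * mat_adjoint V"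
      using W u(1) D V' by (subst VUW) (smt (verit) assoc_mult_mat mult_carrier_mat)
    also have "\<dots> = U * ?Dl f * (W * mat_adjoint V)"
      unfolding eqf[symmetric] using W u(1) D V' by (smt (verit) assoc_mult_mat mult_carrier_mat)
    finally show ?thesis unfolding V'UW .
  qed
  have n: "dim_row A = n" using A by simp
  \<comment> \<open>By \<open>uniq\<close> exactly one matrix satisfies the predicate under
    \<open>SOME\<close>, so the choice must return it.\<close>
  have "mat_fun f A = (SOME B. B = U * mat_diag n (\<lambda>i. complex_of_real (f (l i))) * mat_adjoint U)"
    unfolding mat_fun_def n
    by (rule arg_cong[of _ _ Eps]) (use uniq U in \<open>blast intro!: ext\<close>)
  then show ?thesis by simp
qed

text \<open>Dimension equations in place of carrier assumptions let simp discharge the side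
  conditions and bring long products into right-nested form.\<close>

lemma mult_mat_assoc:
  fixes A :: "'a :: semiring_0 mat"
  shows "dim_col A = dim_row B \<Longrightarrow> dim_col B = dim_row C \<Longrightarrow> A * B * C = A * (B * C)"
  by (rule assoc_mult_mat[of A "dim_row A" "dim_row B" B "dim_row C" C "dim_col C"]) auto

text \<open>Cancels a pair such as U* U inside a right-nested product, where the two factors are no
  longer a subterm of their own.\<close>

lemma mult_mat_cancel_left:
  fixes A :: "complex mat"
  assumes "A * B = 1\<^sub>m n" "dim_col A = dim_row B" "dim_col B = dim_row C" "dim_row C = n"
  shows "A * (B * C) = C"
  using mult_mat_assoc[OF assms(2,3)] assms(1,4) by (simp add: left_mult_one_mat')

lemma mat_diag_dims [simp]: "dim_row (mat_diag n f) = n" "dim_col (mat_diag n f) = n"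
  by (auto simp: mat_diag_def)

section \<open>Overlaps of two eigenbases\<close>

lemma mult_adjoint_diag:
  assumes "W \<in> carrier_mat n n" "j < n"
  shows "(mat_adjoint W * mat_diag n (\<lambda>i. complex_of_real (p i)) * W) $$ (j, j) =
    (\<Sum>i<n. complex_of_real (p i * (cmod (W $$ (i, j)))\<^sup>2))"
proof -
  let ?D = "mat_diag n (\<lambda>i. complex_of_real (p i))"
  have W': "mat_adjoint W \<in> carrier_mat n n" using assms by simp
  have "(mat_adjoint W * ?D * W) $$ (j, j) =
      (\<Sum>i<n. (mat_adjoint W * ?D) $$ (j, i) * W $$ (i, j))"
    using assms by (simp add: scalar_prod_def atLeast0LessThan)
  also have "\<dots> = (\<Sum>i<n. complex_of_real (p i * (cmod (W $$ (i, j)))\<^sup>2))"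
    using assms W' by (intro sum.cong)
      (auto simp: mat_diag_mult_right[OF W'] complex_norm_square mult_ac simp del: of_real_power)
  finally show ?thesis .
qed

text \<open>The columns of a unitary are unit vectors, and so are its rows by passing to the
  adjoint. The squared overlaps of two eigenbases are thus doubly stochastic, which is how double
  sums later collapse to traces.\<close>

lemma unitary_sum_rows:
  assumes "W \<in> carrier_mat n n" "mat_adjoint W * W = 1\<^sub>m n" "j < n"
  shows "(\<Sum>i<n. (cmod (W $$ (i, j)))\<^sup>2) = 1"
proof -
  have "complex_of_real (\<Sum>i<n. (cmod (W $$ (i, j)))\<^sup>2) =
      (mat_adjoint W * mat_diag n (\<lambda>i. complex_of_real 1) * W) $$ (j, j)"
    using mult_adjoint_diag[OF assms(1,3), of "\<lambda>_. 1"] by simp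
  also have "mat_adjoint W * mat_diag n (\<lambda>i. complex_of_real 1) * W = 1\<^sub>m n"
    using assms by simp
  finally show ?thesis using assms(3) by (simp add: complex_eq_iff)
qed

lemma unitary_sum_cols:
  assumes "W \<in> carrier_mat n n" "mat_adjoint W * W = 1\<^sub>m n" "i < n"
  shows "(\<Sum>j<n. (cmod (W $$ (i, j)))\<^sup>2) = 1"
  using unitary_sum_rows[of "mat_adjoint W" n i] unitary_right[OF assms(1,2)] assms(1,3) by simp

lemma unitary_diag_overlap:
  assumes "A \<in> carrier_mat n n" "unitary_diag A U p" "B \<in> carrier_mat n n" "unitary_diag B V q"
  shows "mat_adjoint U * V \<in> carrier_mat n n"
    "mat_adjoint (mat_adjoint U * V) * (mat_adjoint U * V) = 1\<^sub>m n"
proof -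
  note u = unitary_diagD[OF assms(1,2)] and v = unitary_diagD[OF assms(3,4)]
  have c: "mat_adjoint U \<in> carrier_mat n n" "mat_adjoint V \<in> carrier_mat n n" using u v by auto
  show "mat_adjoint U * V \<in> carrier_mat n n" using c v by auto
  have "mat_adjoint (mat_adjoint U * V) = mat_adjoint V * U"
    using mat_adjoint_mult[OF c(1) v(1)] by simp
  then show "mat_adjoint (mat_adjoint U * V) * (mat_adjoint U * V) = 1\<^sub>m n"
    using carrier_matD[OF u(1)] carrier_matD[OF v(1)] v(2)
    by (simp add: mult_mat_assoc mult_mat_cancel_left[OF u(3)])
qed

lemma mat_trace_diag_product:
  assumes W: "W \<in> carrier_mat n n" and Z: "Z \<in> carrier_mat n n"
  shows "mat_trace (mat_adjoint Z * mat_diag n (\<lambda>i. complex_of_real (p i)) * W *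
      mat_diag n (\<lambda>i. complex_of_real (q i))) =
    (\<Sum>i<n. \<Sum>j<n. complex_of_real (p i * q j) * (cnj (Z $$ (i, j)) * W $$ (i, j)))"
proof -
  let ?P = "mat_diag n (\<lambda>i. complex_of_real (p i))" and ?Q = "mat_diag n (\<lambda>i. complex_of_real (q i))"
  have Z': "mat_adjoint Z \<in> carrier_mat n n" using Z by simp
  have P: "?P \<in> carrier_mat n n" and Q: "?Q \<in> carrier_mat n n" by auto
  have "mat_adjoint Z * ?P * W * ?Q = (mat_adjoint Z * ?P) * (W * ?Q)"
    using carrier_matD[OF Z] carrier_matD[OF W] by (simp add: mult_mat_assoc)
  then have "mat_trace (mat_adjoint Z * ?P * W * ?Q) = mat_trace ((mat_adjoint Z * ?P) * (W * ?Q))"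
    by (rule arg_cong)
  also have "\<dots> = (\<Sum>j<n. \<Sum>i<n. (mat_adjoint Z * ?P) $$ (j, i) * (W * ?Q) $$ (i, j))"
    by (rule mat_trace_mult) (use mult_carrier_mat[OF Z' P] mult_carrier_mat[OF W Q] in auto)
  also have "\<dots> = (\<Sum>i<n. \<Sum>j<n. (mat_adjoint Z * ?P) $$ (j, i) * (W * ?Q) $$ (i, j))"
    by (rule sum.swap)
  also have "\<dots> = (\<Sum>i<n. \<Sum>j<n. complex_of_real (p i * q j) * (cnj (Z $$ (i, j)) * W $$ (i, j)))"
    using Z W Z' by (intro sum.cong)
      (auto simp: mat_diag_mult_right[OF Z'] mat_diag_mult_right[OF W])
  finally show ?thesis .
qed

lemma Re_trace_diag_square:
  assumes W: "W \<in> carrier_mat n n"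
  shows "Re (mat_trace (mat_adjoint W * mat_diag n (\<lambda>i. complex_of_real (p i)) * W *
      mat_diag n (\<lambda>i. complex_of_real (q i)))) = (\<Sum>i<n. \<Sum>j<n. p i * q j * (cmod (W $$ (i, j)))\<^sup>2)"
proof -
  have "complex_of_real (p i * q j) * (cnj (W $$ (i, j)) * W $$ (i, j)) =
      complex_of_real (p i * q j * (cmod (W $$ (i, j)))\<^sup>2)" for i j
    unfolding of_real_mult complex_norm_square by (simp add: mult_ac)
  then show ?thesis
    unfolding mat_trace_diag_product[OF W W] by (simp only: Re_sum Re_complex_of_real)
qed

text \<open>Noncommuting matrices are handled as two classical spectra joined by the weights |<u_i,
  v_j>|^2. Taking \<open>mat_fun ln \<sigma>\<close> for \<open>B\<close> keeps the eigenbasis of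
  \<sigma> and gives the cross term of the relative entropy.\<close>

lemma Re_trace_spectral:
  assumes "A \<in> carrier_mat n n" "unitary_diag A U p" "B \<in> carrier_mat n n" "unitary_diag B V q"
  shows "Re (mat_trace (A * B)) = (\<Sum>i<n. \<Sum>j<n. p i * q j * (cmod ((mat_adjoint U * V) $$ (i, j)))\<^sup>2)"
proof -
  note u = unitary_diagD[OF assms(1,2)] and v = unitary_diagD[OF assms(3,4)]
  let ?P = "mat_diag n (\<lambda>i. complex_of_real (p i))" and ?Q = "mat_diag n (\<lambda>i. complex_of_real (q i))"
  let ?W = "mat_adjoint U * V"
  have c: "mat_adjoint U \<in> carrier_mat n n" "mat_adjoint V \<in> carrier_mat n n"
    "?P \<in> carrier_mat n n" "?Q \<in> carrier_mat n n" using u v by auto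
  have W: "?W \<in> carrier_mat n n" using c v by auto
  have W': "mat_adjoint ?W = mat_adjoint V * U"
    using mat_adjoint_mult[OF c(1) v(1)] by simp
  note dims = carrier_matD[OF u(1)] carrier_matD[OF v(1)]
  have "A * B = (U * ?P * ?W * ?Q) * mat_adjoint V"
    unfolding u(4) v(4) using dims by (simp add: mult_mat_assoc)
  moreover have "U * ?P * ?W * ?Q \<in> carrier_mat n n" using dims by (intro carrier_matI) simp_all
  ultimately have "mat_trace (A * B) = mat_trace (mat_adjoint V * (U * ?P * ?W * ?Q))"
    using mat_trace_comm[OF _ c(2), of "U * ?P * ?W * ?Q"] by simp
  also have "mat_adjoint V * (U * ?P * ?W * ?Q) = mat_adjoint ?W * ?P * ?W * ?Q"
    unfolding W' using dims by (simp add: mult_mat_assoc)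
  finally show ?thesis using Re_trace_diag_square[OF W] by simp
qed

definition variational_form :: "real \<Rightarrow> complex mat \<Rightarrow> complex mat \<Rightarrow> complex mat \<Rightarrow> real" where
  "variational_form s \<rho> \<sigma> X = 2 * Re (mat_trace (mat_adjoint X * (\<rho> - \<sigma>)))
     - s * Re (mat_trace (mat_adjoint X * \<rho> * X)) - (1 - s) * Re (mat_trace (X * \<sigma> * mat_adjoint X))"

text \<open>In the coordinates Y = U* X V, left multiplication by A scales row i by p_i and right
  multiplication by B scales column j by q_j. The quadratic part becomes diagonal, and the
  maximisation splits into one problem per entry.\<close>

lemma variational_form_spectral:
  assumes "A \<in> carrier_mat n n" "unitary_diag A U p" "B \<in> carrier_mat n n" "unitary_diag B V q"
    and Y: "Y \<in> carrier_mat n n"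
  defines "W \<equiv> mat_adjoint U * V"
  shows "variational_form s A B (U * Y * mat_adjoint V) =
    (\<Sum>i<n. \<Sum>j<n. 2 * Re (cnj (Y $$ (i, j)) * (complex_of_real (p i - q j) * W $$ (i, j)))
       - (s * p i + (1 - s) * q j) * (cmod (Y $$ (i, j)))\<^sup>2)"
proof -
  note u = unitary_diagD[OF assms(1,2)] and v = unitary_diagD[OF assms(3,4)]
  let ?P = "mat_diag n (\<lambda>i. complex_of_real (p i))" and ?Q = "mat_diag n (\<lambda>i. complex_of_real (q i))"
  \<comment> \<open>The identity is written as a diagonal matrix of ones so that all four traces
    take the shape of \<open>mat_trace_diag_product\<close>.\<close>
  let ?I = "mat_diag n (\<lambda>i. complex_of_real 1)"
  let ?X = "U * Y * mat_adjoint V"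
  have c: "mat_adjoint U \<in> carrier_mat n n" "mat_adjoint V \<in> carrier_mat n n"
    "?P \<in> carrier_mat n n" "?Q \<in> carrier_mat n n" "mat_adjoint Y \<in> carrier_mat n n" using u v Y by auto
  have W: "W \<in> carrier_mat n n" using c v by (auto simp: W_def)
  have X: "?X \<in> carrier_mat n n"
    using carrier_matD[OF u(1)] carrier_matD[OF v(1)] by (intro carrier_matI) simp_all
  have I: "?I = 1\<^sub>m n" by simp
  note dims = carrier_matD[OF u(1)] carrier_matD[OF v(1)] carrier_matD[OF Y]
    carrier_matD[OF assms(1)] carrier_matD[OF assms(3)] carrier_matD[OF W]
  note canc = mult_mat_cancel_left[OF u(2)] mult_mat_cancel_left[OF u(3)]
    mult_mat_cancel_left[OF v(2)] mult_mat_cancel_left[OF v(3)]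
  have X': "mat_adjoint ?X = V * mat_adjoint Y * mat_adjoint U"
    using mat_adjoint_mult[of "U * Y" n n "mat_adjoint V" n] mat_adjoint_mult[OF u(1) Y] u(1) v(1) Y c dims
    by (simp add: mult_mat_assoc)
  have X'c: "mat_adjoint ?X \<in> carrier_mat n n" using X by simp
  have UA: "mat_adjoint U * A = ?P * mat_adjoint U"
    by (subst u(4)) (use dims in \<open>simp add: mult_mat_assoc canc\<close>)
  have VB: "mat_adjoint V * B = ?Q * mat_adjoint V"
    by (subst v(4)) (use dims in \<open>simp add: mult_mat_assoc canc\<close>)
  have BV: "B * V = V * ?Q"
    by (subst v(4)) (use dims in \<open>simp add: mult_mat_assoc v(2) right_mult_one_mat'\<close>)
  have cycV: "mat_trace (V * M) = mat_trace (M * V)" if "dim_row M = n" "dim_col M = n" for M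
    by (rule mat_trace_comm[OF v(1)]) (use that in auto)
  have cycU: "mat_trace (U * M) = mat_trace (M * U)" if "dim_row M = n" "dim_col M = n" for M
    by (rule mat_trace_comm[OF u(1)]) (use that in auto)
  have cycY: "mat_trace (Y * M) = mat_trace (M * Y)" if "dim_row M = n" "dim_col M = n" for M
    by (rule mat_trace_comm[OF Y]) (use that in auto)
  have "mat_adjoint ?X * A = V * (mat_adjoint Y * (?P * mat_adjoint U))"
    unfolding X' UA[symmetric] using dims by (simp add: mult_mat_assoc)
  then have t1: "mat_trace (mat_adjoint ?X * A) = mat_trace (mat_adjoint Y * ?P * W * ?I)"
    unfolding I W_def using dims by (simp add: cycV mult_mat_assoc right_mult_one_mat')
  have "mat_adjoint ?X * B = V * (mat_adjoint Y * (mat_adjoint U * B))"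
    unfolding X' using dims by (simp add: mult_mat_assoc)
  then have t2: "mat_trace (mat_adjoint ?X * B) = mat_trace (mat_adjoint Y * ?I * W * ?Q)"
    unfolding I W_def using dims by (simp add: cycV mult_mat_assoc BV right_mult_one_mat')
  have "mat_adjoint ?X * A * ?X = V * (mat_adjoint Y * ((mat_adjoint U * A) * (U * (Y * mat_adjoint V))))"
    unfolding X' using dims by (simp add: mult_mat_assoc)
  then have t3: "mat_trace (mat_adjoint ?X * A * ?X) = mat_trace (mat_adjoint Y * ?P * Y * ?I)"
    unfolding I UA using dims by (simp add: cycV mult_mat_assoc canc v(2) right_mult_one_mat')
  have "?X * B * mat_adjoint ?X = U * (Y * ((mat_adjoint V * B) * (V * (mat_adjoint Y * mat_adjoint U))))"
    unfolding X' using dims by (simp add: mult_mat_assoc)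
  then have "mat_trace (?X * B * mat_adjoint ?X) = mat_trace (Y * (?Q * mat_adjoint Y))"
    unfolding VB using dims by (simp add: cycU mult_mat_assoc canc u(2) right_mult_one_mat')
  also have "\<dots> = mat_trace ((?Q * mat_adjoint Y) * Y)"
    by (rule cycY) (use dims in auto)
  also have "\<dots> = mat_trace (mat_adjoint Y * (Y * ?Q))"
    using mat_trace_comm[of "?Q" n n "mat_adjoint Y * Y"] Y c dims by (simp add: mult_mat_assoc)
  finally have t4: "mat_trace (?X * B * mat_adjoint ?X) = mat_trace (mat_adjoint Y * ?I * Y * ?Q)"
    unfolding I using dims by (simp add: mult_mat_assoc right_mult_one_mat')
  have t12: "mat_trace (mat_adjoint ?X * (A - B)) = mat_trace (mat_adjoint ?X * A) - mat_trace (mat_adjoint ?X * B)"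
    using X'c assms(1,3) by (subst mult_minus_distrib_mat[of _ n n]) (auto simp: mat_trace_minus[of _ n])
  have e1: "Re (mat_trace (mat_adjoint ?X * (A - B))) =
      (\<Sum>i<n. \<Sum>j<n. Re (cnj (Y $$ (i, j)) * (complex_of_real (p i - q j) * W $$ (i, j))))"
    unfolding t12 t1 t2 mat_trace_diag_product[OF W Y] minus_complex.sel Re_sum sum_subtractf[symmetric]
    by (intro sum.cong refl) (simp add: algebra_simps)
  have e3: "Re (mat_trace (mat_adjoint ?X * A * ?X)) = (\<Sum>i<n. \<Sum>j<n. p i * (cmod (Y $$ (i, j)))\<^sup>2)"
    unfolding t3 Re_trace_diag_square[OF Y] by simp
  have e4: "Re (mat_trace (?X * B * mat_adjoint ?X)) = (\<Sum>i<n. \<Sum>j<n. q j * (cmod (Y $$ (i, j)))\<^sup>2)"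
    unfolding t4 Re_trace_diag_square[OF Y] by simp
  show ?thesis
    unfolding variational_form_def e1 e3 e4 sum_distrib_left sum_subtractf[symmetric]
    by (intro sum.cong refl) (simp add: algebra_simps)
qed

section \<open>A variational formula for the relative entropy\<close>

text \<open>Completing the square in y: the defect is r |y - ((p - q) / r) w|^2. If r = 0, then 0 <
  s < 1 forces p = q = 0 and both sides are 0.\<close>

lemma variational_pointwise:
  fixes y w :: complex and p q s :: real
  assumes "0 < s" "s < 1" "0 \<le> p" "0 \<le> q"
  defines "r \<equiv> s * p + (1 - s) * q"
  shows "2 * Re (cnj y * (complex_of_real (p - q) * w)) - r * (cmod y)\<^sup>2
      \<le> (cmod w)\<^sup>2 * ((p - q)\<^sup>2 / r)" (is ?le)
    and "y = complex_of_real ((p - q) / r) * w \<Longrightarrow>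
      2 * Re (cnj y * (complex_of_real (p - q) * w)) - r * (cmod y)\<^sup>2
      = (cmod w)\<^sup>2 * ((p - q)\<^sup>2 / r)" (is "_ \<Longrightarrow> ?eq")
proof -
  have r0: "r \<ge> 0" using assms by (simp add: r_def)
  have zero: "p - q = 0" if "r = 0"
  proof -
    have "s * p = 0" "(1 - s) * q = 0"
      using that assms(1-4) by (auto simp: r_def add_nonneg_eq_0_iff)
    then show ?thesis using assms(1,2) by simp
  qed
  have sq: "2 * Re (cnj y * (complex_of_real (p - q) * w)) - r * (cmod y)\<^sup>2
      = (cmod w)\<^sup>2 * ((p - q)\<^sup>2 / r) - r * (cmod (y - complex_of_real ((p - q) / r) * w))\<^sup>2" if "r \<noteq> 0"
  proof -
    define k where "k = (p - q) / r"
    have k: "p - q = k * r" using that by (simp add: k_def)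
    have "(p - q)\<^sup>2 / r = k\<^sup>2 * r" unfolding k using that by (simp add: power2_eq_square)
    then show ?thesis
      unfolding k_def[symmetric] unfolding k
      by (simp only: cmod_power2) (simp add: algebra_simps power2_eq_square)
  qed
  show ?le
  proof (cases "r = 0")
    case True
    then show ?thesis using zero by simp
  next
    case False
    show ?thesis unfolding sq[OF False] using r0 by simp
  qed
  show ?eq if "y = complex_of_real ((p - q) / r) * w"
  proof (cases "r = 0")
    case True
    then show ?thesis using zero by simp
  next
    case False
    show ?thesis unfolding sq[OF False] using that by simp
  qed
qed

text \<open>\<open>a\<close> is an explicit antiderivative of the integrand. For q = 0 < p the
  logarithm would diverge at s = 0, which the support condition excludes; for p = 0 the logarithm
  carries the factor 0.\<close>

lemma relative_entropy_path_scalar: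
  fixes p q :: real
  assumes "0 \<le> p" "0 \<le> q" "q = 0 \<Longrightarrow> p = 0"
  defines "a \<equiv> \<lambda>s. p * ln (q + s * (p - q)) - (q + s * (p - q))"
  shows "continuous_on {0..1} a"
    and "0 < s \<Longrightarrow> s < 1 \<Longrightarrow>
      (a has_real_derivative (1 - s) * ((p - q)\<^sup>2 / (s * p + (1 - s) * q))) (at s)"
proof -
  have conv: "q + s * (p - q) = s * p + (1 - s) * q" for s by (simp add: algebra_simps)
  show "continuous_on {0..1} a"
  proof (cases "p = 0")
    case True
    then show ?thesis by (auto simp: a_def intro!: continuous_intros)
  next
    case False
    then have pq: "0 < p" "0 < q" using assms(1-3) by fastforce+
    have "q + s * (p - q) > 0" if "s \<in> {0..1}" for s
    proof (cases "s = 0")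
      case True
      then show ?thesis using pq by simp
    next
      case False
      then have "0 < s * p" "0 \<le> (1 - s) * q" using that pq by auto
      then show ?thesis unfolding conv by linarith
    qed
    then have "\<forall>s\<in>{0..1}. q + s * (p - q) \<noteq> 0" by force
    then show ?thesis unfolding a_def by (intro continuous_intros)
  qed
  show "(a has_real_derivative (1 - s) * ((p - q)\<^sup>2 / (s * p + (1 - s) * q))) (at s)"
    if s: "0 < s" "s < 1"
  proof (cases "p = 0 \<and> q = 0")
    case True
    then show ?thesis by (simp add: a_def)
  next
    case False
    define r where "r = q + s * (p - q)"
    have r: "r > 0"
    proof -
      have "0 \<le> s * p" "0 \<le> (1 - s) * q" "0 < s * p \<or> 0 < (1 - s) * q"
        using s False assms(1,2) by (auto simp: less_le)
      then show ?thesis unfolding r_def conv by linarith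
    qed
    have "(a has_real_derivative p * ((p - q) / r) - (p - q)) (at s)"
      unfolding a_def using r by (auto intro!: derivative_eq_intros simp: r_def)
    moreover have "p * ((p - q) / r) - (p - q) = (1 - s) * ((p - q)\<^sup>2 / r)"
    proof -
      have "(1 - s) * (p - q) = p - r" by (simp add: r_def algebra_simps)
      then have "(1 - s) * ((p - q)\<^sup>2 / r) = (p - q) * (p - r) / r"
        by (simp add: power2_eq_square mult.assoc[symmetric] mult.commute)
      then show ?thesis using r by (simp add: field_simps)
    qed
    ultimately show ?thesis by (simp add: r_def conv)
  qed
qed

definition relative_entropy :: "complex mat \<Rightarrow> complex mat \<Rightarrow> real" where
  "relative_entropy \<rho> \<sigma> =
     Re (mat_trace (\<rho> * mat_fun ln \<rho>)) - Re (mat_trace (\<rho> * mat_fun ln \<sigma>))"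

text \<open>In finite dimension this is inclusion of the support of \<rho> in that of \<sigma>. As
  an operator inequality it passes directly through positive linear maps and through sums.\<close>

definition dominated :: "nat \<Rightarrow> complex mat \<Rightarrow> complex mat \<Rightarrow> bool" where
  "dominated N \<rho> \<sigma> \<longleftrightarrow> psd N \<rho> \<and> psd N \<sigma> \<and> (\<exists>c. psd N (complex_of_real c \<cdot>\<^sub>m \<sigma> - \<rho>))"

lemma unitary_diag_mat_fun:
  assumes "A \<in> carrier_mat n n" "unitary_diag A U l"
  shows "mat_fun f A \<in> carrier_mat n n" "unitary_diag (mat_fun f A) U (\<lambda>i. f (l i))"
proof -
  note u = unitary_diagD[OF assms]
  have "dim_row (mat_fun f A) = n" "dim_col (mat_fun f A) = n"
    using carrier_matD[OF u(1)] by (simp_all add: mat_fun_unitary_diag[OF assms])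
  then show "mat_fun f A \<in> carrier_mat n n" "unitary_diag (mat_fun f A) U (\<lambda>i. f (l i))"
    using u(1,2) by (auto simp: unitary_diag_def mat_fun_unitary_diag[OF assms])
qed

lemma unitary_diag_trace:
  assumes "A \<in> carrier_mat n n" "unitary_diag A U l"
  shows "mat_trace A = (\<Sum>i<n. complex_of_real (l i))"
proof -
  note u = unitary_diagD[OF assms]
  have "mat_trace A = mat_trace (mat_adjoint U * A * U)"
    using mat_trace_comm[of "mat_adjoint U" n n "A * U"] assms(1) u
      carrier_matD[OF u(1)] carrier_matD[OF assms(1)]
    by (simp add: mult_mat_assoc mult_mat_cancel_left[OF u(3)])
  then show ?thesis unfolding unitary_diag_conj[OF assms] by simp
qed

lemma Re_trace_common_basis:
  assumes "A \<in> carrier_mat n n" "unitary_diag A U p" "B \<in> carrier_mat n n" "unitary_diag B U q"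
  shows "Re (mat_trace (A * B)) = (\<Sum>i<n. p i * q i)"
proof -
  have "Re (mat_trace (A * B)) = (\<Sum>i<n. \<Sum>j<n. p i * q j * (cmod ((mat_adjoint U * U) $$ (i, j)))\<^sup>2)"
    by (rule Re_trace_spectral[OF assms])
  also have "\<dots> = (\<Sum>i<n. \<Sum>j<n. if i = j then p i * q j else 0)"
    unfolding unitary_diagD(2)[OF assms(1,2)] by (intro sum.cong) auto
  finally show ?thesis by simp
qed

lemma Re_trace_mult_mat_fun:
  assumes "A \<in> carrier_mat n n" "unitary_diag A U l"
  shows "Re (mat_trace (A * mat_fun f A)) = (\<Sum>i<n. l i * f (l i))"
  by (rule Re_trace_common_basis[OF assms unitary_diag_mat_fun[OF assms]])

text \<open>The scalar antiderivatives, weighted by the squared overlaps, add up to a path whose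
  derivative is (1 - s) times the maximum of the variational form. Because the maximum is attained,
  derivatives of two paths can be compared through trial matrices.\<close>

lemma relative_entropy_path:
  assumes "dominated N \<rho> \<sigma>"
  shows "\<exists>A. continuous_on {0..1} A \<and>
     A 1 - A 0 = relative_entropy \<rho> \<sigma> - Re (mat_trace \<rho>) + Re (mat_trace \<sigma>) \<and>
     (\<forall>s. 0 < s \<longrightarrow> s < 1 \<longrightarrow> (\<exists>X \<in> carrier_mat N N.
        (A has_real_derivative (1 - s) * variational_form s \<rho> \<sigma> X) (at s) \<and>
        (\<forall>Y \<in> carrier_mat N N. variational_form s \<rho> \<sigma> Y \<le> variational_form s \<rho> \<sigma> X)))"
proof -
  obtain c where rho: "psd N \<rho>" and sigma: "psd N \<sigma>" and c: "psd N (complex_of_real c \<cdot>\<^sub>m \<sigma> - \<rho>)"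
    using assms by (auto simp: dominated_def)
  obtain U p where U: "unitary_diag \<rho> U p" and p: "\<And>i. i < N \<Longrightarrow> 0 \<le> p i"
    using psd_unitary_diag[OF rho] by blast
  obtain V q where V: "unitary_diag \<sigma> V q" and q: "\<And>i. i < N \<Longrightarrow> 0 \<le> q i"
    using psd_unitary_diag[OF sigma] by blast
  note rc = psd_carrier[OF rho] and sc = psd_carrier[OF sigma]
  note u = unitary_diagD[OF rc U] and v = unitary_diagD[OF sc V]
  note dims = carrier_matD[OF u(1)] carrier_matD[OF v(1)] carrier_matD[OF rc] carrier_matD[OF sc]
  define W where "W = mat_adjoint U * V"
  have W: "W \<in> carrier_mat N N" "mat_adjoint W * W = 1\<^sub>m N"
    using unitary_diag_overlap[OF rc U sc V] by (simp_all add: W_def)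
  define w where "w i j = (cmod (W $$ (i, j)))\<^sup>2" for i j
  have w0: "0 \<le> w i j" for i j by (simp add: w_def)
  have rows: "(\<Sum>i<N. w i j) = 1" if "j < N" for j
    using unitary_sum_rows[OF W that] by (simp add: w_def)
  have cols: "(\<Sum>j<N. w i j) = 1" if "i < N" for i
    using unitary_sum_cols[OF W that] by (simp add: w_def)
  \<comment> \<open>For an eigenvector v_j in the kernel of \<sigma>, the diagonal entry of c
    \<sigma> - \<rho> at v_j is minus the sum of the nonnegative terms p_i w_ij, so each of these
    vanishes.\<close>
  have supp: "w i j = 0" if ij: "i < N" "j < N" and "q j = 0" "p i \<noteq> 0" for i j
  proof -
    let ?M = "mat_adjoint V * (complex_of_real c \<cdot>\<^sub>m \<sigma> - \<rho>) * V"
    have "psd N ?M" using psd_sandwich[OF c, of "mat_adjoint V" N] v(1) by simp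
    then have "0 \<le> ?M $$ (j, j)" using ij(2) by (rule psd_index_diag)
    moreover have "?M = complex_of_real c \<cdot>\<^sub>m (mat_adjoint V * \<sigma> * V) - mat_adjoint V * \<rho> * V"
      using v(1) rc sc
      by (simp add: mult_minus_distrib_mat[of _ N N _ N] minus_mult_distrib_mat[of _ N N _ _ N]
          mult_smult_distrib[of _ N N _ N] mult_smult_assoc_mat[of _ N N _ N] mult_carrier_mat[of _ N N])
    moreover have "mat_adjoint V * \<rho> * V = mat_adjoint W * mat_diag N (\<lambda>i. complex_of_real (p i)) * W"
    proof -
      have "mat_adjoint W = mat_adjoint V * U"
        using mat_adjoint_mult[of "mat_adjoint U" N N V N] u(1) v(1) by (simp add: W_def)
      then show ?thesis
        by (subst u(4)) (use dims in \<open>simp add: W_def mult_mat_assoc\<close>)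
    qed
    ultimately have "0 \<le> complex_of_real (c * q j) - (\<Sum>i<N. complex_of_real (p i * w i j))"
      using ij(2) W(1) unitary_diag_conj[OF sc V] mult_adjoint_diag[OF W(1) ij(2), of p]
      by (simp add: mat_diag_def w_def)
    then have "(\<Sum>i<N. p i * w i j) \<le> 0"
      using \<open>q j = 0\<close> by (simp add: less_eq_complex_def)
    moreover have "p i * w i j \<le> (\<Sum>i<N. p i * w i j)"
      using ij(1) p w0 by (intro member_le_sum) auto
    ultimately have "p i * w i j \<le> 0" by linarith
    then show ?thesis using p[OF ij(1)] w0[of i j] \<open>p i \<noteq> 0\<close>
      by (smt (verit) mult_pos_pos)
  qed
  define a where "a i j s = p i * ln (q j + s * (p i - q j)) - (q j + s * (p i - q j))" for i j s
  define A where "A s = (\<Sum>i<N. \<Sum>j<N. w i j * a i j s)" for s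
  have a: "continuous_on {0..1} (\<lambda>s. w i j * a i j s)"
      "\<And>s. 0 < s \<Longrightarrow> s < 1 \<Longrightarrow> ((\<lambda>s. w i j * a i j s) has_real_derivative
        w i j * ((1 - s) * ((p i - q j)\<^sup>2 / (s * p i + (1 - s) * q j)))) (at s)"
    if ij: "i < N" "j < N" for i j
  proof -
    have "w i j = 0 \<or> (q j = 0 \<longrightarrow> p i = 0)" using supp[OF ij] by blast
    then show "continuous_on {0..1} (\<lambda>s. w i j * a i j s)"
      using relative_entropy_path_scalar(1)[of "p i" "q j"] p[OF ij(1)] q[OF ij(2)]
      by (cases "w i j = 0") (auto simp: a_def[abs_def] intro: continuous_on_mult_left)
    show "((\<lambda>s. w i j * a i j s) has_real_derivative
        w i j * ((1 - s) * ((p i - q j)\<^sup>2 / (s * p i + (1 - s) * q j)))) (at s)" if "0 < s" "s < 1" for s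
    proof (cases "w i j = 0")
      case False
      then have "q j = 0 \<Longrightarrow> p i = 0" using supp[OF ij] by blast
      from relative_entropy_path_scalar(2)[OF p[OF ij(1)] q[OF ij(2)] this that]
      show ?thesis unfolding a_def by (rule DERIV_cmult)
    qed simp
  qed
  have cont: "continuous_on {0..1} A"
    unfolding A_def[abs_def] by (intro continuous_on_sum a(1)) auto
  \<comment> \<open>Terms in p_i alone or in q_j alone lose their weights because \<open>w\<close>
    has row and column sums 1; only p_i ln q_j keeps them.\<close>
  have ends: "A 1 - A 0 = relative_entropy \<rho> \<sigma> - Re (mat_trace \<rho>) + Re (mat_trace \<sigma>)"
  proof -
    note f = unitary_diag_mat_fun[OF sc V, of ln]
    have "A 1 - A 0 = (\<Sum>i<N. \<Sum>j<N. p i * ln (p i) * w i j - p i * ln (q j) * w i j - p i * w i j + q j * w i j)"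
      unfolding A_def sum_subtractf[symmetric] a_def by (simp add: algebra_simps)
    also have "\<dots> = (\<Sum>i<N. \<Sum>j<N. p i * ln (p i) * w i j) - (\<Sum>i<N. \<Sum>j<N. p i * ln (q j) * w i j)
        - (\<Sum>i<N. \<Sum>j<N. p i * w i j) + (\<Sum>i<N. \<Sum>j<N. q j * w i j)"
      by (simp add: sum.distrib sum_subtractf)
    also have "(\<Sum>i<N. \<Sum>j<N. p i * ln (p i) * w i j) = Re (mat_trace (\<rho> * mat_fun ln \<rho>))"
      unfolding Re_trace_mult_mat_fun[OF rc U] by (simp add: sum_distrib_left[symmetric] cols)
    also have "(\<Sum>i<N. \<Sum>j<N. p i * ln (q j) * w i j) = Re (mat_trace (\<rho> * mat_fun ln \<sigma>))"
      unfolding Re_trace_spectral[OF rc U f] by (simp add: w_def W_def)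
    also have "(\<Sum>i<N. \<Sum>j<N. p i * w i j) = Re (mat_trace \<rho>)"
      unfolding unitary_diag_trace[OF rc U] by (simp add: sum_distrib_left[symmetric] cols)
    also have "(\<Sum>i<N. \<Sum>j<N. q j * w i j) = (\<Sum>j<N. \<Sum>i<N. q j * w i j)"
      by (rule sum.swap)
    also have "\<dots> = Re (mat_trace \<sigma>)"
      unfolding unitary_diag_trace[OF sc V] by (simp add: sum_distrib_left[symmetric] rows)
    finally show ?thesis by (simp add: relative_entropy_def)
  qed
  have "\<exists>X \<in> carrier_mat N N.
        (A has_real_derivative (1 - s) * variational_form s \<rho> \<sigma> X) (at s) \<and>
        (\<forall>Y \<in> carrier_mat N N. variational_form s \<rho> \<sigma> Y \<le> variational_form s \<rho> \<sigma> X)"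
    if s: "0 < s" "s < 1" for s
  proof -
    define r where "r i j = s * p i + (1 - s) * q j" for i j
    \<comment> \<open>The maximiser of each entry from \<open>variational_pointwise\<close>;
      conjugating back by U and V yields a single X that attains all maxima at once.\<close>
    define Z where "Z = mat N N (\<lambda>(i, j). complex_of_real ((p i - q j) / r i j) * W $$ (i, j))"
    have Z: "Z \<in> carrier_mat N N" by (simp add: Z_def)
    define X where "X = U * Z * mat_adjoint V"
    have X: "X \<in> carrier_mat N N" unfolding X_def using dims by (intro carrier_matI) simp_all
    define Q where "Q = (\<Sum>i<N. \<Sum>j<N. w i j * ((p i - q j)\<^sup>2 / r i j))"
    have FX: "variational_form s \<rho> \<sigma> X = Q"
      unfolding X_def variational_form_spectral[OF rc U sc V Z] Q_def
    proof (intro sum.cong refl)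
      fix i j assume ij: "i \<in> {..<N}" "j \<in> {..<N}"
      then have "0 \<le> p i" "0 \<le> q j" using p q by auto
      moreover have "Z $$ (i, j) = complex_of_real ((p i - q j) / r i j) * W $$ (i, j)"
        using ij by (simp add: Z_def)
      ultimately show "2 * Re (cnj (Z $$ (i, j)) * (complex_of_real (p i - q j) * (mat_adjoint U * V) $$ (i, j))) -
          (s * p i + (1 - s) * q j) * (cmod (Z $$ (i, j)))\<^sup>2 = w i j * ((p i - q j)\<^sup>2 / r i j)"
        using variational_pointwise(2)[OF s, of "p i" "q j" "Z $$ (i, j)" "W $$ (i, j)"]
        unfolding w_def r_def W_def by blast
    qed
    have FY: "variational_form s \<rho> \<sigma> Y \<le> Q" if Y: "Y \<in> carrier_mat N N" for Y
    proof -
      define Y' where "Y' = mat_adjoint U * Y * V"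
      have Y': "Y' \<in> carrier_mat N N" unfolding Y'_def using dims by (intro carrier_matI) simp_all
      have "U * Y' * mat_adjoint V = Y"
        unfolding Y'_def using dims carrier_matD[OF Y]
        by (simp add: mult_mat_assoc mult_mat_cancel_left[OF u(3)] v(3))
      then have "variational_form s \<rho> \<sigma> Y = variational_form s \<rho> \<sigma> (U * Y' * mat_adjoint V)" by simp
      also have "\<dots> \<le> Q"
        unfolding variational_form_spectral[OF rc U sc V Y'] Q_def
      proof (intro sum_mono)
        fix i j assume ij: "i \<in> {..<N}" "j \<in> {..<N}"
        then have "0 \<le> p i" "0 \<le> q j" using p q by auto
        from variational_pointwise(1)[OF s this, of "Y' $$ (i, j)" "W $$ (i, j)"]
        show "2 * Re (cnj (Y' $$ (i, j)) * (complex_of_real (p i - q j) * (mat_adjoint U * V) $$ (i, j))) -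
            (s * p i + (1 - s) * q j) * (cmod (Y' $$ (i, j)))\<^sup>2 \<le> w i j * ((p i - q j)\<^sup>2 / r i j)"
          unfolding w_def r_def W_def .
      qed
      finally show ?thesis .
    qed
    have "(A has_real_derivative (\<Sum>i<N. \<Sum>j<N. w i j * ((1 - s) * ((p i - q j)\<^sup>2 / r i j)))) (at s)"
        unfolding A_def[abs_def] r_def by (intro DERIV_sum a(2) s) auto
    also have "(\<Sum>i<N. \<Sum>j<N. w i j * ((1 - s) * ((p i - q j)\<^sup>2 / r i j))) = (1 - s) * Q"
      unfolding Q_def sum_distrib_left by (intro sum.cong refl) simp
    finally show ?thesis using X FX FY by auto
  qed
  then show ?thesis using cont ends by blast
qed

lemma relative_entropy_pathE:
  assumes "dominated N \<rho> \<sigma>"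
  obtains A X where "continuous_on {0..1} A"
    and "A 1 - A 0 = relative_entropy \<rho> \<sigma> - Re (mat_trace \<rho>) + Re (mat_trace \<sigma>)"
    and "\<And>s. 0 < s \<Longrightarrow> s < 1 \<Longrightarrow> X s \<in> carrier_mat N N"
    and "\<And>s. 0 < s \<Longrightarrow> s < 1 \<Longrightarrow>
      (A has_real_derivative (1 - s) * variational_form s \<rho> \<sigma> (X s)) (at s)"
    and "\<And>s Y. 0 < s \<Longrightarrow> s < 1 \<Longrightarrow> Y \<in> carrier_mat N N \<Longrightarrow>
      variational_form s \<rho> \<sigma> Y \<le> variational_form s \<rho> \<sigma> (X s)"
proof -
  obtain A where A: "continuous_on {0..1} A"
    "A 1 - A 0 = relative_entropy \<rho> \<sigma> - Re (mat_trace \<rho>) + Re (mat_trace \<sigma>)"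
    and A': "\<forall>s. \<exists>X. 0 < s \<longrightarrow> s < 1 \<longrightarrow> X \<in> carrier_mat N N \<and>
      (A has_real_derivative (1 - s) * variational_form s \<rho> \<sigma> X) (at s) \<and>
      (\<forall>Y \<in> carrier_mat N N. variational_form s \<rho> \<sigma> Y \<le> variational_form s \<rho> \<sigma> X)"
    using relative_entropy_path[OF assms] by blast
  obtain X where "\<forall>s. 0 < s \<longrightarrow> s < 1 \<longrightarrow> X s \<in> carrier_mat N N \<and>
      (A has_real_derivative (1 - s) * variational_form s \<rho> \<sigma> (X s)) (at s) \<and>
      (\<forall>Y \<in> carrier_mat N N. variational_form s \<rho> \<sigma> Y \<le> variational_form s \<rho> \<sigma> (X s))"
    using choice[OF A'] by blast
  then show thesis using that[OF A, of X] by blast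
qed

text \<open>Takes the place of monotonicity of the integral. Derivatives are compared on the open
  interval only, since at the end points the argument of a logarithm may be 0; continuity suffices
  there.\<close>

lemma derivative_le_imp_increment_le:
  fixes f g :: "real \<Rightarrow> real"
  assumes "continuous_on {0..1} f" "continuous_on {0..1} g"
    and "\<And>s. 0 < s \<Longrightarrow> s < 1 \<Longrightarrow> \<exists>f' g'. (f has_real_derivative f') (at s) \<and>
      (g has_real_derivative g') (at s) \<and> f' \<le> g'"
  shows "f 1 - f 0 \<le> g 1 - g 0"
proof -
  have "g 0 - f 0 \<le> g 1 - f 1"
  proof (rule DERIV_nonneg_imp_increasing_open[where f = "\<lambda>s. g s - f s"])
    fix s :: real assume "0 < s" "s < 1"
    then obtain f' g' where "(f has_real_derivative f') (at s)"
      "(g has_real_derivative g') (at s)" "f' \<le> g'" using assms(3) by blast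
    then show "\<exists>y. ((\<lambda>s. g s - f s) has_real_derivative y) (at s) \<and> 0 \<le> y"
      by (intro exI[of _ "g' - f'"]) (auto intro!: derivative_intros)
  qed (use assms in \<open>auto intro!: continuous_intros\<close>)
  then show ?thesis by simp
qed

section \<open>Monotonicity, sign and subadditivity of the relative entropy\<close>

lemma dominatedD:
  assumes "dominated N \<rho> \<sigma>"
  shows "psd N \<rho>" "psd N \<sigma>" "\<rho> \<in> carrier_mat N N" "\<sigma> \<in> carrier_mat N N"
  using assms psd_carrier[of N \<rho>] psd_carrier[of N \<sigma>] unfolding dominated_def by blast+

lemma variational_form_zero:
  assumes "\<rho> \<in> carrier_mat N N" "\<sigma> \<in> carrier_mat N N"
  shows "variational_form s \<rho> \<sigma> (0\<^sub>m N N) = 0"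
proof -
  have "mat_adjoint (0\<^sub>m N N) = (0\<^sub>m N N :: complex mat)" by (rule eq_matI) auto
  then show ?thesis
    using assms by (simp add: variational_form_def mat_trace_def minus_carrier_mat)
qed

lemma variational_form_add:
  assumes "\<rho> \<in> carrier_mat N N" "\<sigma> \<in> carrier_mat N N" "\<rho>' \<in> carrier_mat N N" "\<sigma>' \<in> carrier_mat N N"
    and X: "X \<in> carrier_mat N N"
  shows "variational_form s (\<rho> + \<rho>') (\<sigma> + \<sigma>') X =
    variational_form s \<rho> \<sigma> X + variational_form s \<rho>' \<sigma>' X"
proof -
  have X': "mat_adjoint X \<in> carrier_mat N N" using X by simp
  have diff: "\<rho> + \<rho>' - (\<sigma> + \<sigma>') = (\<rho> - \<sigma>) + (\<rho>' - \<sigma>')"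
    using assms by (intro eq_matI) auto
  have 1: "mat_trace (mat_adjoint X * (A + B)) = mat_trace (mat_adjoint X * A) + mat_trace (mat_adjoint X * B)"
    if "A \<in> carrier_mat N N" "B \<in> carrier_mat N N" for A B
    using that X' mult_add_distrib_mat[OF X' that] mat_trace_add[of "mat_adjoint X * A" N "mat_adjoint X * B"]
    by (simp add: mult_carrier_mat[OF X'])
  have 2: "mat_trace (Z * (A + B) * Z') = mat_trace (Z * A * Z') + mat_trace (Z * B * Z')"
    if "A \<in> carrier_mat N N" "B \<in> carrier_mat N N" "Z \<in> carrier_mat N N" "Z' \<in> carrier_mat N N"
    for A B Z Z'
    unfolding mult_add_distrib_mat[OF that(3,1,2)]
      add_mult_distrib_mat[OF mult_carrier_mat[OF that(3,1)] mult_carrier_mat[OF that(3,2)] that(4)]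
    by (rule mat_trace_add) (use that in \<open>auto intro!: mult_carrier_mat\<close>)
  have 3: "\<rho> - \<sigma> \<in> carrier_mat N N" "\<rho>' - \<sigma>' \<in> carrier_mat N N" using assms by (auto intro: minus_carrier_mat)
  show ?thesis
    unfolding variational_form_def diff 1[OF 3] 2[OF assms(1,3) X' X] 2[OF assms(2,4) X X']
    by (simp add: algebra_simps)
qed

lemma Re_psd_trace: "psd N A \<Longrightarrow> 0 \<le> Re (mat_trace A)"
  by (drule psd_trace) (simp add: less_eq_complex_def)

lemma psd_smult_diff_mono:
  assumes "psd N \<sigma>" "psd N (complex_of_real c \<cdot>\<^sub>m \<sigma> - \<rho>)" "\<rho> \<in> carrier_mat N N" "c \<le> c'"
  shows "psd N (complex_of_real c' \<cdot>\<^sub>m \<sigma> - \<rho>)"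
proof -
  have "complex_of_real c' \<cdot>\<^sub>m \<sigma> - \<rho> =
      (complex_of_real c \<cdot>\<^sub>m \<sigma> - \<rho>) + complex_of_real (c' - c) \<cdot>\<^sub>m \<sigma>"
    using assms(3) psd_carrier[OF assms(1)] by (intro eq_matI) (auto simp: algebra_simps)
  then show ?thesis using psd_add[OF assms(2) psd_smult[OF assms(1), of "c' - c"]] assms(4) by simp
qed

lemma dominated_add:
  assumes "dominated N \<rho> \<sigma>" "dominated N \<rho>' \<sigma>'"
  shows "dominated N (\<rho> + \<rho>') (\<sigma> + \<sigma>')"
proof -
  note d = dominatedD[OF assms(1)] and d' = dominatedD[OF assms(2)]
  obtain c c' where c: "psd N (complex_of_real c \<cdot>\<^sub>m \<sigma> - \<rho>)" "psd N (complex_of_real c' \<cdot>\<^sub>m \<sigma>' - \<rho>')"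
    using assms by (auto simp: dominated_def)
  let ?m = "max c c'"
  have "psd N ((complex_of_real ?m \<cdot>\<^sub>m \<sigma> - \<rho>) + (complex_of_real ?m \<cdot>\<^sub>m \<sigma>' - \<rho>'))"
    by (intro psd_add psd_smult_diff_mono[OF d(2) c(1) d(3)] psd_smult_diff_mono[OF d'(2) c(2) d'(3)]) auto
  also have "(complex_of_real ?m \<cdot>\<^sub>m \<sigma> - \<rho>) + (complex_of_real ?m \<cdot>\<^sub>m \<sigma>' - \<rho>') =
      complex_of_real ?m \<cdot>\<^sub>m (\<sigma> + \<sigma>') - (\<rho> + \<rho>')"
    using d(3,4) d'(3,4) by (intro eq_matI) (auto simp: algebra_simps)
  finally show ?thesis
    unfolding dominated_def using psd_add[OF d(1) d'(1)] psd_add[OF d(2) d'(2)] by blast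
qed

lemma dominated_le:
  assumes "psd N \<rho>" "psd N \<sigma>" "psd N (complex_of_real c \<cdot>\<^sub>m \<sigma> - \<rho>)"
  shows "dominated N \<rho> \<sigma>"
  unfolding dominated_def using assms by blast

text \<open>The path of (\<rho>, \<sigma>) runs through maxima, so each trial matrix for the second
  pair only has to be matched by some trial matrix for the first. That match may depend on s and X,
  which leaves room for the dual of a channel.\<close>

lemma relative_entropy_mono:
  assumes "dominated N \<rho> \<sigma>" "dominated M \<rho>' \<sigma>'"
    and "\<And>s X. 0 < s \<Longrightarrow> s < 1 \<Longrightarrow> X \<in> carrier_mat M M \<Longrightarrow>
      \<exists>Y \<in> carrier_mat N N. variational_form s \<rho>' \<sigma>' X \<le> variational_form s \<rho> \<sigma> Y"
  shows "relative_entropy \<rho>' \<sigma>' - Re (mat_trace \<rho>') + Re (mat_trace \<sigma>') \<le>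
    relative_entropy \<rho> \<sigma> - Re (mat_trace \<rho>) + Re (mat_trace \<sigma>)"
proof -
  obtain A X where A: "continuous_on {0..1} A"
    "A 1 - A 0 = relative_entropy \<rho> \<sigma> - Re (mat_trace \<rho>) + Re (mat_trace \<sigma>)"
    and X: "\<And>s. 0 < s \<Longrightarrow> s < 1 \<Longrightarrow>
      (A has_real_derivative (1 - s) * variational_form s \<rho> \<sigma> (X s)) (at s)"
      "\<And>s Y. 0 < s \<Longrightarrow> s < 1 \<Longrightarrow> Y \<in> carrier_mat N N \<Longrightarrow>
        variational_form s \<rho> \<sigma> Y \<le> variational_form s \<rho> \<sigma> (X s)"
    by (rule relative_entropy_pathE[OF assms(1)]) blast
  obtain B Z where B: "continuous_on {0..1} B"
    "B 1 - B 0 = relative_entropy \<rho>' \<sigma>' - Re (mat_trace \<rho>') + Re (mat_trace \<sigma>')"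
    and Z: "\<And>s. 0 < s \<Longrightarrow> s < 1 \<Longrightarrow> Z s \<in> carrier_mat M M"
      "\<And>s. 0 < s \<Longrightarrow> s < 1 \<Longrightarrow>
        (B has_real_derivative (1 - s) * variational_form s \<rho>' \<sigma>' (Z s)) (at s)"
    by (rule relative_entropy_pathE[OF assms(2)]) blast
  have "B 1 - B 0 \<le> A 1 - A 0"
  proof (rule derivative_le_imp_increment_le[OF B(1) A(1)])
    fix s :: real assume s: "0 < s" "s < 1"
    obtain Y where Y: "Y \<in> carrier_mat N N" "variational_form s \<rho>' \<sigma>' (Z s) \<le> variational_form s \<rho> \<sigma> Y"
      using assms(3)[OF s Z(1)[OF s]] by blast
    have "(1 - s) * variational_form s \<rho>' \<sigma>' (Z s) \<le> (1 - s) * variational_form s \<rho> \<sigma> (X s)"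
      using s X(2)[OF s Y(1)] Y(2) by (intro mult_left_mono) auto
    then show "\<exists>f' g'. (B has_real_derivative f') (at s) \<and> (A has_real_derivative g') (at s) \<and> f' \<le> g'"
      using X(1)[OF s] Z(2)[OF s] by blast
  qed
  then show ?thesis using A(2) B(2) by simp
qed

text \<open>Klein's inequality: the trial matrix 0 shows that every maximum is nonnegative.\<close>

lemma relative_entropy_ge:
  assumes "dominated N \<rho> \<sigma>"
  shows "Re (mat_trace \<rho>) - Re (mat_trace \<sigma>) \<le> relative_entropy \<rho> \<sigma>"
proof -
  note d = dominatedD[OF assms]
  obtain A X where A: "continuous_on {0..1} A"
    "A 1 - A 0 = relative_entropy \<rho> \<sigma> - Re (mat_trace \<rho>) + Re (mat_trace \<sigma>)"
    and X: "\<And>s. 0 < s \<Longrightarrow> s < 1 \<Longrightarrow>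
      (A has_real_derivative (1 - s) * variational_form s \<rho> \<sigma> (X s)) (at s)"
      "\<And>s Y. 0 < s \<Longrightarrow> s < 1 \<Longrightarrow> Y \<in> carrier_mat N N \<Longrightarrow>
        variational_form s \<rho> \<sigma> Y \<le> variational_form s \<rho> \<sigma> (X s)"
    by (rule relative_entropy_pathE[OF assms]) blast
  have "(\<lambda>s::real. 0::real) 1 - (\<lambda>s::real. 0::real) 0 \<le> A 1 - A 0"
  proof (rule derivative_le_imp_increment_le[OF _ A(1)])
    fix s :: real assume s: "0 < s" "s < 1"
    have "0 \<le> (1 - s) * variational_form s \<rho> \<sigma> (X s)"
      using X(2)[OF s, of "0\<^sub>m N N"] variational_form_zero[OF d(3,4)] s by simp
    then show "\<exists>f' g'. ((\<lambda>s. 0) has_real_derivative f') (at s) \<and> (A has_real_derivative g') (at s) \<and> f' \<le> g'"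
      using X(1)[OF s] by (intro exI[of _ 0] exI conjI) auto
  qed auto
  then show ?thesis using A(2) by simp
qed

text \<open>Writing \<sigma> = \<rho> + D with D \<ge> 0 and dropping the quadratic terms in \<rho>
  leaves a quadratic in X weighted by D alone. Completing the square with a multiple of the identity
  bounds it by the trace of D.\<close>

lemma variational_form_le_trace_diff:
  assumes "psd N \<rho>" and Z: "psd N (\<sigma> - \<rho>)" and sc: "\<sigma> \<in> carrier_mat N N"
    and X: "X \<in> carrier_mat N N" and s: "0 < s" "s < 1"
  shows "(1 - s) * variational_form s \<rho> \<sigma> X \<le> Re (mat_trace (\<sigma> - \<rho>))"
proof -
  note rc = psd_carrier[OF assms(1)]
  define D where "D = \<sigma> - \<rho>"
  have D: "psd N D" "D \<in> carrier_mat N N" using Z sc psd_carrier by (auto simp: D_def)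
  \<comment> \<open>This is the shift that completes the square: (1 - s)^2 tr C D C* contains the
    trace of D with coefficient exactly 1.\<close>
  define c where "c = 1 / (1 - s)"
  define C where "C = X + complex_of_real c \<cdot>\<^sub>m 1\<^sub>m N"
  have C: "C \<in> carrier_mat N N" using X by (simp add: C_def)
  have X': "mat_adjoint X \<in> carrier_mat N N" using X by simp
  note dims = carrier_matD[OF rc] carrier_matD[OF sc] carrier_matD[OF X] carrier_matD[OF D(2)]
  have XD: "X * D \<in> carrier_mat N N" "D * mat_adjoint X \<in> carrier_mat N N"
      "X * D * mat_adjoint X \<in> carrier_mat N N" "mat_adjoint X * D \<in> carrier_mat N N"
    by (intro carrier_matI; simp add: dims)+
  have "mat_adjoint C = mat_adjoint X + complex_of_real c \<cdot>\<^sub>m 1\<^sub>m N"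
    using X by (simp add: C_def mat_adjoint_add[of _ N N] mat_adjoint_smult)
  moreover have "C * D = X * D + complex_of_real c \<cdot>\<^sub>m D"
    using X D(2) by (simp add: C_def add_mult_distrib_mat[of _ N N _ _ N] mult_smult_assoc_mat[of _ N N _ N])
  moreover have CD: "C * D \<in> carrier_mat N N" by (rule mult_carrier_mat[OF C D(2)])
  ultimately have "C * D * mat_adjoint C = (X * D + complex_of_real c \<cdot>\<^sub>m D) * mat_adjoint X +
      complex_of_real c \<cdot>\<^sub>m (X * D + complex_of_real c \<cdot>\<^sub>m D)"
    using X' mult_add_distrib_mat[OF CD X', of "complex_of_real c \<cdot>\<^sub>m 1\<^sub>m N"]
      mult_smult_distrib[OF CD one_carrier_mat, of "complex_of_real c"] dims by simp
  also have "(X * D + complex_of_real c \<cdot>\<^sub>m D) * mat_adjoint X =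
      X * D * mat_adjoint X + complex_of_real c \<cdot>\<^sub>m (D * mat_adjoint X)"
    using add_mult_distrib_mat[OF XD(1) smult_carrier_mat[OF D(2)] X', of "complex_of_real c"]
      mult_smult_assoc_mat[OF D(2) X', of "complex_of_real c"] by simp
  also have "\<dots> + complex_of_real c \<cdot>\<^sub>m (X * D + complex_of_real c \<cdot>\<^sub>m D) =
      (X * D * mat_adjoint X + complex_of_real c \<cdot>\<^sub>m (X * D))
      + (complex_of_real c \<cdot>\<^sub>m (D * mat_adjoint X) + complex_of_real (c * c) \<cdot>\<^sub>m D)"
    by (intro eq_matI) (simp_all add: dims algebra_simps del: index_mult_mat(1))
  finally have "C * D * mat_adjoint C = (X * D * mat_adjoint X + complex_of_real c \<cdot>\<^sub>m (X * D))
      + (complex_of_real c \<cdot>\<^sub>m (D * mat_adjoint X) + complex_of_real (c * c) \<cdot>\<^sub>m D)" .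
  moreover have "0 \<le> Re (mat_trace (C * D * mat_adjoint C))"
    by (rule Re_psd_trace[OF psd_sandwich[OF D(1) C]])
  ultimately have "0 \<le> Re (mat_trace (X * D * mat_adjoint X)) + c * Re (mat_trace (X * D))
      + c * Re (mat_trace (D * mat_adjoint X)) + c * c * Re (mat_trace D)"
    using XD D(2) by (simp add: mat_trace_add[of _ N] mat_trace_smult[of _ N])
  moreover have "mat_trace (D * mat_adjoint X) = mat_trace (mat_adjoint X * D)"
    by (rule mat_trace_comm[OF D(2) X'])
  moreover have "Re (mat_trace (X * D)) = Re (mat_trace (mat_adjoint X * D))"
  proof -
    have "mat_adjoint (mat_adjoint X * D) = D * X"
      using mat_adjoint_mult[OF X' D(2)] psd_hermitian[OF D(1)] by simp
    then show ?thesis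
      using mat_trace_adjoint[OF XD(4)] mat_trace_comm[OF D(2) X] by simp
  qed
  ultimately have key: "0 \<le> Re (mat_trace (X * D * mat_adjoint X)) + 2 * c * Re (mat_trace (mat_adjoint X * D))
      + c * c * Re (mat_trace D)" by simp
  have "X * \<sigma> * mat_adjoint X = X * \<rho> * mat_adjoint X + X * D * mat_adjoint X"
  proof -
    have "\<sigma> = \<rho> + D" unfolding D_def using rc sc by (intro eq_matI) auto
    then show ?thesis
      using X X' rc D(2)
      by (simp add: mult_add_distrib_mat[of _ N N _ N] add_mult_distrib_mat[of _ N N _ _ N] mult_carrier_mat[of _ N N])
  qed
  then have "mat_trace (X * \<sigma> * mat_adjoint X) = mat_trace (X * \<rho> * mat_adjoint X) + mat_trace (X * D * mat_adjoint X)"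
    using mat_trace_add[of "X * \<rho> * mat_adjoint X" N] XD psd_carrier[OF psd_sandwich[OF assms(1) X]] by simp
  moreover have "0 \<le> Re (mat_trace (X * \<rho> * mat_adjoint X))"
    by (rule Re_psd_trace[OF psd_sandwich[OF assms(1) X]])
  ultimately have sig: "Re (mat_trace (X * D * mat_adjoint X)) \<le> Re (mat_trace (X * \<sigma> * mat_adjoint X))" by simp
  have rho: "0 \<le> Re (mat_trace (mat_adjoint X * \<rho> * X))"
    using Re_psd_trace[OF psd_sandwich[OF assms(1) X']] by simp
  have "mat_adjoint X * (\<rho> - \<sigma>) = - (mat_adjoint X * D)"
  proof -
    have "\<rho> - \<sigma> = - D" unfolding D_def using rc sc by (intro eq_matI) auto
    then show ?thesis using dims by simp
  qed
  then have diff: "Re (mat_trace (mat_adjoint X * (\<rho> - \<sigma>))) = - Re (mat_trace (mat_adjoint X * D))"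
    using dims by (simp add: mat_trace_def sum_negf)
  have "variational_form s \<rho> \<sigma> X \<le>
      - 2 * Re (mat_trace (mat_adjoint X * D)) - (1 - s) * Re (mat_trace (X * D * mat_adjoint X))"
    unfolding variational_form_def diff using mult_left_mono[OF sig, of "1 - s"] rho s
      mult_nonneg_nonneg[of s, OF _ rho] by linarith
  then have "(1 - s) * variational_form s \<rho> \<sigma> X \<le> (1 - s) * (
      - 2 * Re (mat_trace (mat_adjoint X * D)) - (1 - s) * Re (mat_trace (X * D * mat_adjoint X)))"
    using s by (intro mult_left_mono) auto
  also have "\<dots> \<le> Re (mat_trace D)"
  proof -
    have c: "(1 - s) * c = 1" using s by (simp add: c_def)
    have "0 \<le> (1 - s)\<^sup>2 * (Re (mat_trace (X * D * mat_adjoint X)) + 2 * c * Re (mat_trace (mat_adjoint X * D))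
      + c * c * Re (mat_trace D))" using key by simp
    also have "\<dots> = (1 - s)\<^sup>2 * Re (mat_trace (X * D * mat_adjoint X))
      + (1 - s) * ((1 - s) * c) * (2 * Re (mat_trace (mat_adjoint X * D)))
      + ((1 - s) * c) * ((1 - s) * c) * Re (mat_trace D)"
      by (simp add: power2_eq_square algebra_simps)
    finally show ?thesis unfolding c by (simp add: power2_eq_square algebra_simps)
  qed
  finally show ?thesis by (simp add: D_def)
qed

text \<open>Stands in for operator monotonicity of the logarithm. The derivative bound makes the
  increment of the path at most the trace of \<sigma> - \<rho>, which is exactly the trace term of
  the formula and cancels.\<close>

lemma relative_entropy_le_zero:
  assumes "psd N \<rho>" "psd N (\<sigma> - \<rho>)" "\<sigma> \<in> carrier_mat N N"
  shows "dominated N \<rho> \<sigma>" "relative_entropy \<rho> \<sigma> \<le> 0"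
proof -
  note rc = psd_carrier[OF assms(1)]
  have "\<sigma> = \<rho> + (\<sigma> - \<rho>)" using rc assms(3) by (intro eq_matI) auto
  then have "psd N \<sigma>" using psd_add[OF assms(1,2)] by simp
  moreover have "complex_of_real 1 \<cdot>\<^sub>m \<sigma> = \<sigma>" by (rule eq_matI) auto
  ultimately show dom: "dominated N \<rho> \<sigma>" using dominated_le[OF assms(1), of \<sigma> 1] assms(2) by metis
  obtain A X where A: "continuous_on {0..1} A"
    "A 1 - A 0 = relative_entropy \<rho> \<sigma> - Re (mat_trace \<rho>) + Re (mat_trace \<sigma>)"
    and X: "\<And>s. 0 < s \<Longrightarrow> s < 1 \<Longrightarrow> X s \<in> carrier_mat N N"
      "\<And>s. 0 < s \<Longrightarrow> s < 1 \<Longrightarrow>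
        (A has_real_derivative (1 - s) * variational_form s \<rho> \<sigma> (X s)) (at s)"
    by (rule relative_entropy_pathE[OF dom]) blast
  let ?t = "Re (mat_trace (\<sigma> - \<rho>))"
  have "A 1 - A 0 \<le> (\<lambda>s. s * ?t) 1 - (\<lambda>s. s * ?t) 0"
  proof (rule derivative_le_imp_increment_le[OF A(1)])
    fix s :: real assume s: "0 < s" "s < 1"
    have "((\<lambda>s. s * ?t) has_real_derivative ?t) (at s)" by (auto intro!: derivative_eq_intros)
    then show "\<exists>f' g'. (A has_real_derivative f') (at s) \<and> ((\<lambda>s. s * ?t) has_real_derivative g') (at s) \<and> f' \<le> g'"
      using X(2)[OF s] variational_form_le_trace_diff[OF assms X(1)[OF s] s] by blast
  qed (auto intro!: continuous_intros)
  then show "relative_entropy \<rho> \<sigma> \<le> 0"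
    using A(2) mat_trace_minus[OF assms(3) rc] by simp
qed

text \<open>Joint convexity for unnormalised arguments. A maximiser for the sum is a trial matrix
  for each summand, and the form is additive in the pair.\<close>

lemma relative_entropy_add_le:
  assumes "dominated N \<rho> \<sigma>" "dominated N \<rho>' \<sigma>'"
  shows "relative_entropy (\<rho> + \<rho>') (\<sigma> + \<sigma>') \<le> relative_entropy \<rho> \<sigma> + relative_entropy \<rho>' \<sigma>'"
proof -
  note d = dominatedD[OF assms(1)] and d' = dominatedD[OF assms(2)]
  obtain A X where A: "continuous_on {0..1} A"
    "A 1 - A 0 = relative_entropy \<rho> \<sigma> - Re (mat_trace \<rho>) + Re (mat_trace \<sigma>)"
    and X: "\<And>s. 0 < s \<Longrightarrow> s < 1 \<Longrightarrow>
      (A has_real_derivative (1 - s) * variational_form s \<rho> \<sigma> (X s)) (at s)"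
      "\<And>s Y. 0 < s \<Longrightarrow> s < 1 \<Longrightarrow> Y \<in> carrier_mat N N \<Longrightarrow>
        variational_form s \<rho> \<sigma> Y \<le> variational_form s \<rho> \<sigma> (X s)"
    by (rule relative_entropy_pathE[OF assms(1)]) blast
  obtain B X' where B: "continuous_on {0..1} B"
    "B 1 - B 0 = relative_entropy \<rho>' \<sigma>' - Re (mat_trace \<rho>') + Re (mat_trace \<sigma>')"
    and X': "\<And>s. 0 < s \<Longrightarrow> s < 1 \<Longrightarrow>
      (B has_real_derivative (1 - s) * variational_form s \<rho>' \<sigma>' (X' s)) (at s)"
      "\<And>s Y. 0 < s \<Longrightarrow> s < 1 \<Longrightarrow> Y \<in> carrier_mat N N \<Longrightarrow>
        variational_form s \<rho>' \<sigma>' Y \<le> variational_form s \<rho>' \<sigma>' (X' s)"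
    by (rule relative_entropy_pathE[OF assms(2)]) blast
  obtain C Y where C: "continuous_on {0..1} C"
    "C 1 - C 0 = relative_entropy (\<rho> + \<rho>') (\<sigma> + \<sigma>') - Re (mat_trace (\<rho> + \<rho>')) + Re (mat_trace (\<sigma> + \<sigma>'))"
    and Y: "\<And>s. 0 < s \<Longrightarrow> s < 1 \<Longrightarrow> Y s \<in> carrier_mat N N"
      "\<And>s. 0 < s \<Longrightarrow> s < 1 \<Longrightarrow>
        (C has_real_derivative (1 - s) * variational_form s (\<rho> + \<rho>') (\<sigma> + \<sigma>') (Y s)) (at s)"
    by (rule relative_entropy_pathE[OF dominated_add[OF assms]]) blast
  have "C 1 - C 0 \<le> (\<lambda>s. A s + B s) 1 - (\<lambda>s. A s + B s) 0"
  proof (rule derivative_le_imp_increment_le[OF C(1)])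
    fix s :: real assume s: "0 < s" "s < 1"
    have "(1 - s) * variational_form s (\<rho> + \<rho>') (\<sigma> + \<sigma>') (Y s) \<le>
        (1 - s) * (variational_form s \<rho> \<sigma> (X s) + variational_form s \<rho>' \<sigma>' (X' s))"
      unfolding variational_form_add[OF d(3,4) d'(3,4) Y(1)[OF s]]
      using X(2)[OF s Y(1)[OF s]] X'(2)[OF s Y(1)[OF s]] s by (intro mult_left_mono add_mono) auto
    moreover have "((\<lambda>s. A s + B s) has_real_derivative
        (1 - s) * (variational_form s \<rho> \<sigma> (X s) + variational_form s \<rho>' \<sigma>' (X' s))) (at s)"
      using DERIV_add[OF X(1)[OF s] X'(1)[OF s]] by (simp add: algebra_simps)
    ultimately show "\<exists>f' g'. (C has_real_derivative f') (at s) \<and>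
        ((\<lambda>s. A s + B s) has_real_derivative g') (at s) \<and> f' \<le> g'"
      using Y(2)[OF s] by blast
  qed (intro continuous_intros A B)
  then show ?thesis
    using A(2) B(2) C(2) mat_trace_add[OF d(3) d'(3)] mat_trace_add[OF d(4) d'(4)] by simp
qed

section \<open>Block matrices and the data processing inequality\<close>

lemma mult_add_less: "a < k \<Longrightarrow> p < m \<Longrightarrow> a * m + p < k * (m::nat)"
proof -
  assume "a < k" "p < m"
  then have "a * m + p < Suc a * m" by simp
  also have "\<dots> \<le> k * m" using \<open>a < k\<close> by (intro mult_le_mono1) simp
  finally show ?thesis .
qed

lemma sum_mult_index:
  fixes f :: "nat \<Rightarrow> 'a :: comm_monoid_add"
  shows "(\<Sum>i<k * m. f i) = (\<Sum>a<k. \<Sum>p<m. f (a * m + p))"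
proof (induction k)
  have append: "(\<Sum>i<n + m. f i) = (\<Sum>i<n. f i) + (\<Sum>p<m. f (n + p))" for n
    by (induction m) (simp_all add: add.assoc)
  case (Suc k)
  have "(\<Sum>i<Suc k * m. f i) = (\<Sum>i<k * m + m. f i)" by (simp add: add.commute)
  also have "\<dots> = (\<Sum>i<k * m. f i) + (\<Sum>p<m. f (k * m + p))"
    using append by blast
  finally show ?case using Suc by simp
qed simp

lemma block_carrier [simp]: "block m A a b \<in> carrier_mat m m"
  by (simp add: block_def)

lemma block_dims [simp]: "dim_row (block m A a b) = m" "dim_col (block m A a b) = m"
  by (simp_all add: block_def)

lemma block_index [simp]:
  "p < m \<Longrightarrow> q < m \<Longrightarrow> block m A a b $$ (p, q) = A $$ (a * m + p, b * m + q)"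
  by (simp add: block_def)

lemma id_tensor_carrier [simp]: "id_tensor k m m' \<Phi> A \<in> carrier_mat (k * m') (k * m')"
  by (simp add: id_tensor_def)

lemma id_tensor_dims [simp]:
  "dim_row (id_tensor k m m' \<Phi> A) = k * m'" "dim_col (id_tensor k m m' \<Phi> A) = k * m'"
  by (simp_all add: id_tensor_def)

lemma eq_blocksI:
  assumes "A \<in> carrier_mat (k * m) (k * m)" "B \<in> carrier_mat (k * m) (k * m)"
    and "\<And>a b. a < k \<Longrightarrow> b < k \<Longrightarrow> block m A a b = block m B a b"
  shows "A = B"
proof (rule eq_matI)
  fix i j assume "i < dim_row B" "j < dim_col B"
  then have ij: "i < k * m" "j < k * m" using assms by auto
  then have "m > 0" by (auto intro: Nat.gr0I)
  then have "i div m < k" "j div m < k" "i mod m < m" "j mod m < m"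
    using ij by (auto simp: less_mult_imp_div_less)
  then have "block m A (i div m) (j div m) $$ (i mod m, j mod m) =
      block m B (i div m) (j div m) $$ (i mod m, j mod m)" using assms(3) by simp
  then show "A $$ (i, j) = B $$ (i, j)"
    using \<open>i mod m < m\<close> \<open>j mod m < m\<close> by simp
qed (use assms in auto)

lemma superoperatorD:
  assumes "superoperator m m' \<Phi>"
  shows "A \<in> carrier_mat m m \<Longrightarrow> \<Phi> A \<in> carrier_mat m' m'"
    and "A \<in> carrier_mat m m \<Longrightarrow> B \<in> carrier_mat m m \<Longrightarrow> \<Phi> (A + B) = \<Phi> A + \<Phi> B"
    and "A \<in> carrier_mat m m \<Longrightarrow> \<Phi> (c \<cdot>\<^sub>m A) = c \<cdot>\<^sub>m \<Phi> A"
  using assms by (auto simp: superoperator_def)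

lemma superoperator_minus:
  assumes "superoperator m m' \<Phi>" "A \<in> carrier_mat m m" "B \<in> carrier_mat m m"
  shows "\<Phi> (A - B) = \<Phi> A - \<Phi> B"
proof -
  note d = superoperatorD[OF assms(1)]
  have "A - B = A + (-1) \<cdot>\<^sub>m B" using assms by (intro eq_matI) auto
  then have "\<Phi> (A - B) = \<Phi> A + (-1) \<cdot>\<^sub>m \<Phi> B" using d assms by simp
  also have "\<dots> = \<Phi> A - \<Phi> B"
    using d(1)[OF assms(2)] d(1)[OF assms(3)] by (intro eq_matI) auto
  finally show ?thesis .
qed

lemma superoperator_zero:
  assumes "superoperator m m' \<Phi>"
  shows "\<Phi> (0\<^sub>m m m) = 0\<^sub>m m' m'"
proof -
  have "\<Phi> (0 \<cdot>\<^sub>m 0\<^sub>m m m) = 0 \<cdot>\<^sub>m \<Phi> (0\<^sub>m m m)" by (rule superoperatorD(3)[OF assms]) simp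
  moreover have "\<Phi> (0\<^sub>m m m) \<in> carrier_mat m' m'" by (rule superoperatorD(1)[OF assms]) simp
  then have "0 \<cdot>\<^sub>m \<Phi> (0\<^sub>m m m) = 0\<^sub>m m' m'" by (intro eq_matI) auto
  ultimately show ?thesis by simp
qed

lemma block_id_tensor:
  assumes "superoperator m m' \<Phi>" "a < k" "b < k"
  shows "block m' (id_tensor k m m' \<Phi> A) a b = \<Phi> (block m A a b)"
proof (rule eq_matI)
  have c: "\<Phi> (block m A a b) \<in> carrier_mat m' m'" by (rule superoperatorD(1)[OF assms(1)]) simp
  fix p q assume "p < dim_row (\<Phi> (block m A a b))" "q < dim_col (\<Phi> (block m A a b))"
  then have "p < m'" "q < m'" using c by auto
  then show "block m' (id_tensor k m m' \<Phi> A) a b $$ (p, q) = \<Phi> (block m A a b) $$ (p, q)"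
    using mult_add_less[OF assms(2)] mult_add_less[OF assms(3)] by (simp add: id_tensor_def)
qed (use superoperatorD(1)[OF assms(1) block_carrier[of m A a b]] in auto)

lemma block_add:
  "A \<in> carrier_mat (k * m) (k * m) \<Longrightarrow> B \<in> carrier_mat (k * m) (k * m) \<Longrightarrow> a < k \<Longrightarrow> b < k \<Longrightarrow>
    block m (A + B) a b = block m A a b + block m B a b"
  by (rule eq_matI) (auto simp: mult_add_less)

lemma block_smult:
  "A \<in> carrier_mat (k * m) (k * m) \<Longrightarrow> a < k \<Longrightarrow> b < k \<Longrightarrow>
    block m (c \<cdot>\<^sub>m A) a b = c \<cdot>\<^sub>m block m A a b"
  by (rule eq_matI) (auto simp: mult_add_less)

lemma block_adjoint:
  "A \<in> carrier_mat (k * m) (k * m) \<Longrightarrow> a < k \<Longrightarrow> b < k \<Longrightarrow>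
    block m (mat_adjoint A) a b = mat_adjoint (block m A b a)"
  by (rule eq_matI) (auto simp: mult_add_less)

lemma block_block:
  assumes "c < k" "e < k"
  shows "block m (block (k * m) A a b) c e = block m A (a * k + c) (b * k + e)"
proof (rule eq_matI)
  fix p q assume "p < dim_row (block m A (a * k + c) (b * k + e))" "q < dim_col (block m A (a * k + c) (b * k + e))"
  then have pq: "p < m" "q < m" by auto
  have "a * (k * m) + (c * m + p) = (a * k + c) * m + p" "b * (k * m) + (e * m + q) = (b * k + e) * m + q"
    by (simp_all add: algebra_simps)
  then show "block m (block (k * m) A a b) c e $$ (p, q) = block m A (a * k + c) (b * k + e) $$ (p, q)"
    using pq mult_add_less[OF assms(1) pq(1)] mult_add_less[OF assms(2) pq(2)]
    by (simp add: add.assoc[symmetric])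
qed auto

lemma mat_trace_blocks:
  "A \<in> carrier_mat (k * m) (k * m) \<Longrightarrow> mat_trace A = (\<Sum>a<k. mat_trace (block m A a a))"
  by (simp add: mat_trace_def sum_mult_index)

lemma mat_trace_mult_blocks:
  assumes A: "A \<in> carrier_mat (k * m) (k * m)" and B: "B \<in> carrier_mat (k * m) (k * m)"
  shows "mat_trace (A * B) = (\<Sum>a<k. \<Sum>b<k. mat_trace (block m A a b * block m B b a))"
proof -
  have "mat_trace (A * B) = (\<Sum>a<k. \<Sum>p<m. \<Sum>b<k. \<Sum>q<m.
      A $$ (a * m + p, b * m + q) * B $$ (b * m + q, a * m + p))"
    unfolding mat_trace_mult[OF A B] sum_mult_index ..
  also have "\<dots> = (\<Sum>a<k. \<Sum>b<k. \<Sum>p<m. \<Sum>q<m.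
      A $$ (a * m + p, b * m + q) * B $$ (b * m + q, a * m + p))"
    by (intro sum.cong refl sum.swap)
  also have "\<dots> = (\<Sum>a<k. \<Sum>b<k. mat_trace (block m A a b * block m B b a))"
    by (intro sum.cong refl) (simp add: mat_trace_mult[OF block_carrier block_carrier])
  finally show ?thesis .
qed

lemma superoperator_id_tensor:
  assumes "superoperator m m' \<Phi>"
  shows "superoperator (k * m) (k * m') (id_tensor k m m' \<Phi>)"
  unfolding superoperator_def
proof (intro conjI ballI allI)
  fix A B :: "complex mat" and c
  assume A: "A \<in> carrier_mat (k * m) (k * m)"
  show "id_tensor k m m' \<Phi> A \<in> carrier_mat (k * m') (k * m')" by simp
  show "id_tensor k m m' \<Phi> (c \<cdot>\<^sub>m A) = c \<cdot>\<^sub>m id_tensor k m m' \<Phi> A"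
    by (rule eq_blocksI[of _ k m'])
      (simp_all add: block_id_tensor[OF assms] block_smult[OF A] block_smult[OF id_tensor_carrier]
        superoperatorD(3)[OF assms])
next
  fix A B :: "complex mat"
  assume A: "A \<in> carrier_mat (k * m) (k * m)" "B \<in> carrier_mat (k * m) (k * m)"
  show "id_tensor k m m' \<Phi> (A + B) = id_tensor k m m' \<Phi> A + id_tensor k m m' \<Phi> B"
    by (rule eq_blocksI[of _ k m'])
      (simp_all add: block_id_tensor[OF assms] block_add[OF A] block_add[OF id_tensor_carrier id_tensor_carrier]
        superoperatorD(2)[OF assms])
qed

text \<open>A block index below \<open>l * k\<close> splits as a1 * k + a2, so blocks of blocks are
  blocks. This regrouping allows any splitting of the sites to the left of the one acted on.\<close>

lemma id_tensor_id_tensor: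
  assumes "superoperator m m' \<Phi>"
  shows "id_tensor l (k * m) (k * m') (id_tensor k m m' \<Phi>) A = id_tensor (l * k) m m' \<Phi> A"
proof (rule eq_blocksI[of _ "l * k" m'])
  have so: "superoperator (k * m) (k * m') (id_tensor k m m' \<Phi>)"
    by (rule superoperator_id_tensor[OF assms])
  fix a b assume ab: "a < l * k" "b < l * k"
  then have "k > 0" by (auto intro: Nat.gr0I)
  define a1 a2 b1 b2 where "a1 = a div k" and "a2 = a mod k" and "b1 = b div k" and "b2 = b mod k"
  have a: "a = a1 * k + a2" "a1 < l" "a2 < k" and b: "b = b1 * k + b2" "b1 < l" "b2 < k"
    using ab \<open>k > 0\<close> by (auto simp: a1_def a2_def b1_def b2_def less_mult_imp_div_less)
  show "block m' (id_tensor l (k * m) (k * m') (id_tensor k m m' \<Phi>) A) a b =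
      block m' (id_tensor (l * k) m m' \<Phi> A) a b"
    unfolding block_id_tensor[OF assms ab]
    unfolding a(1) b(1) block_block[OF a(3) b(3), symmetric]
    by (simp add: block_id_tensor[OF so a(2) b(2)] block_id_tensor[OF assms a(3) b(3)])
qed (simp_all add: id_tensor_def mult.assoc)

lemma cptp_id_tensor:
  assumes "cptp m m' \<Phi>"
  shows "cptp (k * m) (k * m') (id_tensor k m m' \<Phi>)"
proof -
  have so: "superoperator m m' \<Phi>" using assms by (simp add: cptp_def)
  have "psd (l * (k * m')) (id_tensor l (k * m) (k * m') (id_tensor k m m' \<Phi>) A)"
    if "psd (l * (k * m)) A" for l A
  proof -
    have "psd (l * k * m') (id_tensor (l * k) m m' \<Phi> A)"
      using assms that unfolding cptp_def mult.assoc[symmetric] by blast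
    then show ?thesis by (simp add: id_tensor_id_tensor[OF so] mult.assoc)
  qed
  moreover have "mat_trace (id_tensor k m m' \<Phi> A) = mat_trace A"
    if "A \<in> carrier_mat (k * m) (k * m)" for A
    using assms
    by (simp add: mat_trace_blocks[OF that] mat_trace_blocks[OF id_tensor_carrier] block_id_tensor[OF so] cptp_def)
  ultimately show ?thesis using superoperator_id_tensor[OF so] by (simp add: cptp_def)
qed

lemma cptp_psd:
  assumes "cptp m m' \<Phi>" "psd m A"
  shows "psd m' (\<Phi> A)"
proof -
  have so: "superoperator m m' \<Phi>" using assms by (simp add: cptp_def)
  have A: "A \<in> carrier_mat m m" using assms(2) by (rule psd_carrier)
  have "block m A 0 0 = A" using A by (intro eq_matI) auto
  then have "block m' (id_tensor 1 m m' \<Phi> A) 0 0 = \<Phi> A" using block_id_tensor[OF so, of 0 1 0 A] by simp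
  moreover have "block m' (id_tensor 1 m m' \<Phi> A) 0 0 = id_tensor 1 m m' \<Phi> A"
    by (rule eq_matI) auto
  moreover have "psd (1 * m') (id_tensor 1 m m' \<Phi> A)"
    using assms unfolding cptp_def by (metis mult_1)
  ultimately show ?thesis by simp
qed

section \<open>Complete positivity: duality and the Schwarz inequality\<close>

lemma linear_functional_expand:
  fixes f :: "complex mat \<Rightarrow> complex"
  assumes add: "\<And>A B. A \<in> carrier_mat m m \<Longrightarrow> B \<in> carrier_mat m m \<Longrightarrow> f (A + B) = f A + f B"
    and smult: "\<And>c A. A \<in> carrier_mat m m \<Longrightarrow> f (c \<cdot>\<^sub>m A) = c * f A"
    and A: "A \<in> carrier_mat m m"
  defines "E \<equiv> \<lambda>a b. mat m m (\<lambda>(i, j). if i = a \<and> j = b then 1 else 0)"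
  shows "f A = (\<Sum>a<m. \<Sum>b<m. A $$ (a, b) * f (E a b))"
proof -
  have E: "E a b \<in> carrier_mat m m" for a b by (simp add: E_def)
  \<comment> \<open>Keeping only the entries in S turns the expansion in matrix units into an
    induction over finite sets of index pairs.\<close>
  define R where "R S = mat m m (\<lambda>ij. if ij \<in> S then A $$ ij else 0)" for S
  have R: "R S \<in> carrier_mat m m" for S by (simp add: R_def)
  have "f (R S) = (\<Sum>ab\<in>S. A $$ ab * f (E (fst ab) (snd ab)))" if "finite S" for S
    using that
  proof (induction S rule: finite_induct)
    case empty
    have "R {} = 0 \<cdot>\<^sub>m R {}" by (intro eq_matI) (auto simp: R_def)
    then have "f (R {}) = 0" using smult[OF R, of 0 "{}"] by simp
    then show ?case by simp
  next
    case (insert x S)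
    have "R (insert x S) = A $$ x \<cdot>\<^sub>m E (fst x) (snd x) + R S"
      using insert by (intro eq_matI) (auto simp: R_def E_def)
    then show ?case using insert add[OF smult_carrier_mat[OF E] R] smult[OF E] by simp
  qed
  from this[of "{..<m} \<times> {..<m}"] have "f (R ({..<m} \<times> {..<m})) = (\<Sum>a<m. \<Sum>b<m. A $$ (a, b) * f (E a b))"
    by (simp add: sum.cartesian_product split_beta)
  moreover have "R ({..<m} \<times> {..<m}) = A" using A by (intro eq_matI) (auto simp: R_def)
  ultimately show ?thesis by simp
qed

text \<open>Riesz representation for the trace form: Y is the value at X of the Hilbert-Schmidt
  adjoint of \<Phi>, read off on matrix units.\<close>

lemma superoperator_dual:
  assumes "superoperator m m' \<Phi>" and X: "X \<in> carrier_mat m' m'"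
  shows "\<exists>Y \<in> carrier_mat m m. \<forall>A \<in> carrier_mat m m.
    mat_trace (mat_adjoint X * \<Phi> A) = mat_trace (mat_adjoint Y * A)"
proof -
  note d = superoperatorD[OF assms(1)]
  have X': "mat_adjoint X \<in> carrier_mat m' m'" using X by simp
  define f where "f A = mat_trace (mat_adjoint X * \<Phi> A)" for A
  define Y where "Y = mat m m (\<lambda>(a, b). cnj (f (mat m m (\<lambda>(i, j). if i = a \<and> j = b then 1 else 0))))"
  have Y: "Y \<in> carrier_mat m m" by (simp add: Y_def)
  have "f A = mat_trace (mat_adjoint Y * A)" if A: "A \<in> carrier_mat m m" for A
  proof -
    have "f A = (\<Sum>a<m. \<Sum>b<m. A $$ (a, b) * f (mat m m (\<lambda>(i, j). if i = a \<and> j = b then 1 else 0)))"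
    proof (rule linear_functional_expand[OF _ _ A])
      fix A B :: "complex mat" and c
      assume A: "A \<in> carrier_mat m m"
      show "f (c \<cdot>\<^sub>m A) = c * f A"
        unfolding f_def d(3)[OF A] mult_smult_distrib[OF X' d(1)[OF A]]
        by (rule mat_trace_smult[OF mult_carrier_mat[OF X' d(1)[OF A]]])
      assume B: "B \<in> carrier_mat m m"
      show "f (A + B) = f A + f B"
        unfolding f_def d(2)[OF A B] mult_add_distrib_mat[OF X' d(1)[OF A] d(1)[OF B]]
        by (rule mat_trace_add[OF mult_carrier_mat[OF X' d(1)[OF A]] mult_carrier_mat[OF X' d(1)[OF B]]])
    qed
    also have "\<dots> = (\<Sum>a<m. \<Sum>b<m. mat_adjoint Y $$ (b, a) * A $$ (a, b))"
      using Y by (intro sum.cong) (auto simp: Y_def)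
    also have "\<dots> = mat_trace (mat_adjoint Y * A)"
      unfolding mat_trace_mult[OF mat_adjoint_carrier[OF Y] A] by (rule sum.swap)
    finally show ?thesis .
  qed
  then show ?thesis using Y unfolding f_def by blast
qed

text \<open>The block column of C 0, ..., C (k - 1). Sandwiching a positive matrix between it and
  its adjoint produces the positive block matrices on which complete positivity is put to
  use.\<close>

definition stack :: "nat \<Rightarrow> nat \<Rightarrow> (nat \<Rightarrow> complex mat) \<Rightarrow> complex mat" where
  "stack k m C = mat (k * m) m (\<lambda>(i, j). C (i div m) $$ (i mod m, j))"

lemma stack_carrier [simp]: "stack k m C \<in> carrier_mat (k * m) m"
  by (simp add: stack_def)

lemma block_stack:
  assumes R: "R \<in> carrier_mat m m" and C: "\<And>a. a < k \<Longrightarrow> C a \<in> carrier_mat m m"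
    and ab: "a < k" "b < k"
  shows "block m (stack k m C * R * mat_adjoint (stack k m C)) a b = C a * R * mat_adjoint (C b)"
proof (rule eq_matI)
  note Ca = C[OF ab(1)] and Cb = C[OF ab(2)]
  fix p q assume "p < dim_row (C a * R * mat_adjoint (C b))" "q < dim_col (C a * R * mat_adjoint (C b))"
  then have pq: "p < m" "q < m" using Ca Cb by auto
  note l = mult_add_less[OF ab(1) pq(1)] mult_add_less[OF ab(2) pq(2)]
  have entry: "stack k m C $$ (c * m + r, j) = C c $$ (r, j)" if "c < k" "r < m" "j < m" for c r j
    using that mult_add_less[OF that(1,2)] by (simp add: stack_def)
  have dims: "dim_row (stack k m C) = k * m" "dim_col (stack k m C) = m" by (simp_all add: stack_def)
  have SR: "(stack k m C * R) $$ (a * m + p, j) = (C a * R) $$ (p, j)" if "j < m" for j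
    using that l pq dims R Ca entry[OF ab(1) pq(1)] by (simp add: scalar_prod_def)
  have "block m (stack k m C * R * mat_adjoint (stack k m C)) a b $$ (p, q) =
      (\<Sum>j<m. (stack k m C * R) $$ (a * m + p, j) * cnj (stack k m C $$ (b * m + q, j)))"
    using l pq dims R by (simp add: scalar_prod_def atLeast0LessThan del: index_mult_mat(1))
       (simp add: scalar_prod_def atLeast0LessThan)
  also have "\<dots> = (\<Sum>j<m. (C a * R) $$ (p, j) * cnj (C b $$ (q, j)))"
    using SR entry[OF ab(2) pq(2)] by simp
  also have "\<dots> = (C a * R * mat_adjoint (C b)) $$ (p, q)"
    using pq Ca Cb R by (simp add: scalar_prod_def atLeast0LessThan)
  finally show "block m (stack k m C * R * mat_adjoint (stack k m C)) a b $$ (p, q) =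
      (C a * R * mat_adjoint (C b)) $$ (p, q)" .
qed (use C[OF ab(1)] C[OF ab(2)] in auto)

lemma mat_trace_stack:
  assumes B: "B \<in> carrier_mat (k * m) (k * m)" and X: "\<And>a. a < k \<Longrightarrow> X a \<in> carrier_mat m m"
  shows "mat_trace (mat_adjoint (stack k m X) * B * stack k m X) =
    (\<Sum>a<k. \<Sum>b<k. mat_trace (mat_adjoint (X a) * block m B a b * X b))"
proof -
  let ?S = "stack k m X"
  have S: "?S \<in> carrier_mat (k * m) m" "mat_adjoint ?S \<in> carrier_mat m (k * m)" by simp_all
  note dims = carrier_matD[OF S(1)] carrier_matD[OF B]
  have "mat_trace (mat_adjoint ?S * B * ?S) = mat_trace (mat_adjoint ?S * (B * ?S))"
    using dims by (simp add: mult_mat_assoc)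
  also have "\<dots> = mat_trace (B * ?S * mat_adjoint ?S)"
    by (rule mat_trace_comm[OF S(2) mult_carrier_mat[OF B S(1)]])
  also have "B * ?S * mat_adjoint ?S = B * (?S * 1\<^sub>m m * mat_adjoint ?S)"
    using dims by (simp add: mult_mat_assoc)
  also have "mat_trace \<dots> = (\<Sum>a<k. \<Sum>b<k. mat_trace (block m B a b * block m (?S * 1\<^sub>m m * mat_adjoint ?S) b a))"
    by (rule mat_trace_mult_blocks[OF B]) (intro carrier_matI; use dims in simp)
  also have "\<dots> = (\<Sum>a<k. \<Sum>b<k. mat_trace (mat_adjoint (X a) * block m B a b * X b))"
  proof (intro sum.cong refl)
    fix a b assume "a \<in> {..<k}" "b \<in> {..<k}"
    then have ab: "a < k" "b < k" by auto
    note Xa = X[OF ab(1)] and Xb = X[OF ab(2)]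
    have "block m (?S * 1\<^sub>m m * mat_adjoint ?S) b a = X b * 1\<^sub>m m * mat_adjoint (X a)"
      by (rule block_stack[OF one_carrier_mat X ab(2,1)])
    then have "mat_trace (block m B a b * block m (?S * 1\<^sub>m m * mat_adjoint ?S) b a) =
        mat_trace ((block m B a b * X b) * mat_adjoint (X a))"
      using carrier_matD[OF Xa] carrier_matD[OF Xb] by (simp add: mult_mat_assoc)
    also have "\<dots> = mat_trace (mat_adjoint (X a) * (block m B a b * X b))"
      by (rule mat_trace_comm[OF mult_carrier_mat[OF block_carrier Xb] mat_adjoint_carrier[OF Xa]])
    also have "mat_adjoint (X a) * (block m B a b * X b) = mat_adjoint (X a) * block m B a b * X b"
      using carrier_matD[OF Xa] carrier_matD[OF Xb] by (simp add: mult_mat_assoc)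
    finally show "mat_trace (block m B a b * block m (?S * 1\<^sub>m m * mat_adjoint ?S) b a) =
        mat_trace (mat_adjoint (X a) * block m B a b * X b)" .
  qed
  finally show ?thesis .
qed

lemma cptp_adjoint:
  assumes "cptp m m' \<Phi>" and A: "A \<in> carrier_mat m m"
  shows "\<Phi> (mat_adjoint A) = mat_adjoint (\<Phi> A)"
proof -
  have so: "superoperator m m' \<Phi>" using assms by (simp add: cptp_def)
  define C where "C a = (if a = 0 then 1\<^sub>m m else A)" for a :: nat
  have C: "C a \<in> carrier_mat m m" for a using A by (simp add: C_def)
  define M where "M = stack 2 m C * 1\<^sub>m m * mat_adjoint (stack 2 m C)"
  have "psd m (1\<^sub>m m)" using psd_diag[of m "\<lambda>_. 1"] by simp
  then have "psd (2 * m) M" unfolding M_def by (rule psd_sandwich) simp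
  then have "psd (2 * m') (id_tensor 2 m m' \<Phi> M)" using assms by (simp add: cptp_def)
  then have "mat_adjoint (id_tensor 2 m m' \<Phi> M) = id_tensor 2 m m' \<Phi> M" by (rule psd_hermitian)
  then have "mat_adjoint (block m' (id_tensor 2 m m' \<Phi> M) 1 0) = block m' (id_tensor 2 m m' \<Phi> M) 0 1"
    using block_adjoint[OF id_tensor_carrier[of 2 m m' \<Phi> M], of 0 1] by simp
  then have "mat_adjoint (\<Phi> (block m M 1 0)) = \<Phi> (block m M 0 1)"
    by (simp add: block_id_tensor[OF so])
  moreover have "block m M 1 0 = A" "block m M 0 1 = mat_adjoint A"
  proof -
    have "block m M 1 0 = C 1 * 1\<^sub>m m * mat_adjoint (C 0)" "block m M 0 1 = C 0 * 1\<^sub>m m * mat_adjoint (C 1)"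
      unfolding M_def by (rule block_stack[OF one_carrier_mat C]; simp)+
    then show "block m M 1 0 = A" "block m M 0 1 = mat_adjoint A"
      using carrier_matD[OF A] by (simp_all add: C_def)
  qed
  ultimately show ?thesis by simp
qed

text \<open>A trace form of the Kadison-Schwarz inequality. The block matrix with rows (\<rho>,
  \<rho> Y) and (Y* \<rho>, Y* \<rho> Y) is positive, and so is its image. By duality and trace
  preservation, both cross terms and the last term of the image, once tested, equal tr Y* \<rho> Y
  up to conjugation.\<close>

lemma cptp_schwarz:
  assumes "cptp m m' \<Phi>" and X: "X \<in> carrier_mat m' m'" and Y: "Y \<in> carrier_mat m m"
    and dual: "\<And>A. A \<in> carrier_mat m m \<Longrightarrow>
      mat_trace (mat_adjoint X * \<Phi> A) = mat_trace (mat_adjoint Y * A)"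
    and rho: "psd m \<rho>"
  shows "Re (mat_trace (mat_adjoint Y * \<rho> * Y)) \<le> Re (mat_trace (mat_adjoint X * \<Phi> \<rho> * X))"
proof -
  have so: "superoperator m m' \<Phi>" using assms by (simp add: cptp_def)
  note rc = psd_carrier[OF rho] and d = superoperatorD[OF so]
  define C where "C a = (if a = 0 then 1\<^sub>m m else mat_adjoint Y)" for a :: nat
  have C: "C a \<in> carrier_mat m m" for a using Y by (simp add: C_def)
  define M where "M = stack 2 m C * \<rho> * mat_adjoint (stack 2 m C)"
  have "psd (2 * m) M" unfolding M_def by (rule psd_sandwich[OF rho]) simp
  then have N: "psd (2 * m') (id_tensor 2 m m' \<Phi> M)" using assms by (simp add: cptp_def)
  \<comment> \<open>Testing with the block column (X, -1) makes the cross terms negative, so that of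
    the three copies of tr Y* \<rho> Y one remains, with a minus sign.\<close>
  define Z where "Z a = (if a = 0 then X else - 1\<^sub>m m')" for a :: nat
  have Z: "Z a \<in> carrier_mat m' m'" for a using X by (simp add: Z_def)
  let ?S = "stack 2 m' Z"
  have "psd m' (mat_adjoint ?S * id_tensor 2 m m' \<Phi> M * mat_adjoint (mat_adjoint ?S))"
    by (rule psd_sandwich[OF N]) simp
  then have "0 \<le> Re (mat_trace (mat_adjoint ?S * id_tensor 2 m m' \<Phi> M * ?S))"
    by (simp add: Re_psd_trace)
  moreover have "mat_trace (mat_adjoint ?S * id_tensor 2 m m' \<Phi> M * ?S) =
      (\<Sum>a<2. \<Sum>b<2. mat_trace (mat_adjoint (Z a) * \<Phi> (C a * \<rho> * mat_adjoint (C b)) * Z b))"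
    unfolding mat_trace_stack[OF id_tensor_carrier Z]
    by (intro sum.cong refl) (simp add: block_id_tensor[OF so] M_def block_stack[OF rc C])
  moreover have "(\<Sum>a<2. \<Sum>b<2. mat_trace (mat_adjoint (Z a) * \<Phi> (C a * \<rho> * mat_adjoint (C b)) * Z b)) =
     mat_trace (mat_adjoint X * \<Phi> \<rho> * X) - mat_trace (mat_adjoint X * \<Phi> (\<rho> * Y))
     - mat_trace (\<Phi> (mat_adjoint Y * \<rho>) * X) + mat_trace (\<Phi> (mat_adjoint Y * \<rho> * Y))"
  proof -
    note dims = carrier_matD[OF X] carrier_matD[OF Y] carrier_matD[OF rc]
    have neg: "mat_adjoint (- 1\<^sub>m m') = (- 1\<^sub>m m' :: complex mat)"
      by (rule eq_matI) auto
    have tneg: "mat_trace (- A) = - mat_trace A" if "dim_row A = m'" "dim_col A = m'" for A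
      using that by (simp add: mat_trace_def sum_negf)
    have c1: "\<rho> * Y \<in> carrier_mat m m" "mat_adjoint Y * \<rho> \<in> carrier_mat m m" "mat_adjoint Y * \<rho> * Y \<in> carrier_mat m m"
      by (intro carrier_matI; simp add: dims)+
    note cd = carrier_matD[OF d(1)[OF rc]] carrier_matD[OF d(1)[OF c1(1)]]
      carrier_matD[OF d(1)[OF c1(2)]] carrier_matD[OF d(1)[OF c1(3)]]
    have "C 0 * \<rho> * mat_adjoint (C 0) = \<rho>" "C 0 * \<rho> * mat_adjoint (C 1) = \<rho> * Y"
      "C 1 * \<rho> * mat_adjoint (C 0) = mat_adjoint Y * \<rho>" "C 1 * \<rho> * mat_adjoint (C 1) = mat_adjoint Y * \<rho> * Y"
      by (simp_all add: C_def dims)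
    then show ?thesis
      using dims cd
      by (simp add: numeral_2_eq_2 Z_def neg tneg uminus_mult_left_mat uminus_mult_right_mat)
  qed
  moreover have "mat_trace (mat_adjoint X * \<Phi> (\<rho> * Y)) = mat_trace (mat_adjoint Y * \<rho> * Y)"
    using dual[OF mult_carrier_mat[OF rc Y]] carrier_matD[OF Y] carrier_matD[OF rc]
    by (simp add: mult_mat_assoc)
  moreover have "mat_trace (\<Phi> (mat_adjoint Y * \<rho>) * X) = cnj (mat_trace (mat_adjoint X * \<Phi> (\<rho> * Y)))"
  proof -
    have c: "\<rho> * Y \<in> carrier_mat m m" by (rule mult_carrier_mat[OF rc Y])
    have "mat_adjoint (\<rho> * Y) = mat_adjoint Y * \<rho>"
      using mat_adjoint_mult[OF rc Y] psd_hermitian[OF rho] by simp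
    then have "\<Phi> (mat_adjoint Y * \<rho>) = mat_adjoint (\<Phi> (\<rho> * Y))"
      using cptp_adjoint[OF assms(1) c] by simp
    then have "\<Phi> (mat_adjoint Y * \<rho>) * X = mat_adjoint (mat_adjoint X * \<Phi> (\<rho> * Y))"
      using mat_adjoint_mult[OF mat_adjoint_carrier[OF X] d(1)[OF c]] by simp
    then show ?thesis
      using mat_trace_adjoint[OF mult_carrier_mat[OF mat_adjoint_carrier[OF X] d(1)[OF c]]] by simp
  qed
  moreover have "mat_trace (\<Phi> (mat_adjoint Y * \<rho> * Y)) = mat_trace (mat_adjoint Y * \<rho> * Y)"
  proof -
    have "mat_adjoint Y * \<rho> * Y \<in> carrier_mat m m"
      by (intro carrier_matI; simp add: carrier_matD[OF Y])
    then show ?thesis using assms(1) by (simp add: cptp_def)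
  qed
  ultimately show ?thesis by simp
qed

text \<open>With Y dual to X the linear terms agree and both subtracted quadratic terms shrink by
  the Schwarz inequality. The \<sigma> term has its factors in the opposite order and uses the
  inequality for X*, whose dual is Y* because \<Phi> commutes with adjoints.\<close>

lemma cptp_variational_form:
  assumes "cptp m m' \<Phi>" "psd m \<rho>" "psd m \<sigma>" and X: "X \<in> carrier_mat m' m'" and s: "0 < s" "s < 1"
  shows "\<exists>Y \<in> carrier_mat m m. variational_form s (\<Phi> \<rho>) (\<Phi> \<sigma>) X \<le> variational_form s \<rho> \<sigma> Y"
proof -
  have so: "superoperator m m' \<Phi>" using assms by (simp add: cptp_def)
  note rc = psd_carrier[OF assms(2)] and sc = psd_carrier[OF assms(3)] and d = superoperatorD[OF so]
  obtain Y where Y: "Y \<in> carrier_mat m m" and dual: "\<And>A. A \<in> carrier_mat m m \<Longrightarrow>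
      mat_trace (mat_adjoint X * \<Phi> A) = mat_trace (mat_adjoint Y * A)"
    using superoperator_dual[OF so X] by blast
  have X': "mat_adjoint X \<in> carrier_mat m' m'" and Y': "mat_adjoint Y \<in> carrier_mat m m" using X Y by auto
  have dual': "mat_trace (mat_adjoint (mat_adjoint X) * \<Phi> A) = mat_trace (mat_adjoint (mat_adjoint Y) * A)"
    if A: "A \<in> carrier_mat m m" for A
  proof -
    have A': "mat_adjoint A \<in> carrier_mat m m" using A by simp
    have "mat_trace (X * \<Phi> A) = mat_trace (\<Phi> A * X)" by (rule mat_trace_comm[OF X d(1)[OF A]])
    also have "\<Phi> A * X = mat_adjoint (mat_adjoint X * \<Phi> (mat_adjoint A))"
      using mat_adjoint_mult[OF X' d(1)[OF A']] cptp_adjoint[OF assms(1) A'] by simp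
    also have "mat_trace \<dots> = cnj (mat_trace (mat_adjoint Y * mat_adjoint A))"
      using mat_trace_adjoint[OF mult_carrier_mat[OF X' d(1)[OF A']]] dual[OF A'] by simp
    also have "\<dots> = mat_trace (mat_adjoint (mat_adjoint Y * mat_adjoint A))"
      using mat_trace_adjoint[OF mult_carrier_mat[OF Y' A']] by simp
    also have "\<dots> = mat_trace (A * Y)"
      using mat_adjoint_mult[OF Y' A'] by simp
    also have "\<dots> = mat_trace (Y * A)" by (rule mat_trace_comm[OF A Y])
    finally show ?thesis by simp
  qed
  have 1: "Re (mat_trace (mat_adjoint Y * \<rho> * Y)) \<le> Re (mat_trace (mat_adjoint X * \<Phi> \<rho> * X))"
    by (rule cptp_schwarz[OF assms(1) X Y dual assms(2)])
  have 2: "Re (mat_trace (Y * \<sigma> * mat_adjoint Y)) \<le> Re (mat_trace (X * \<Phi> \<sigma> * mat_adjoint X))"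
    using cptp_schwarz[OF assms(1) X' Y' dual' assms(3)] by simp
  have 3: "mat_trace (mat_adjoint X * (\<Phi> \<rho> - \<Phi> \<sigma>)) = mat_trace (mat_adjoint Y * (\<rho> - \<sigma>))"
    using dual[OF minus_carrier_mat[OF sc], of \<rho>] superoperator_minus[OF so rc sc] by simp
  have "variational_form s (\<Phi> \<rho>) (\<Phi> \<sigma>) X \<le> variational_form s \<rho> \<sigma> Y"
    unfolding variational_form_def 3
    using mult_left_mono[OF 1, of s] mult_left_mono[OF 2, of "1 - s"] s by linarith
  then show ?thesis using Y by blast
qed

lemma data_processing:
  assumes "cptp m m' \<Phi>" "dominated m \<rho> \<sigma>"
  shows "dominated m' (\<Phi> \<rho>) (\<Phi> \<sigma>)" "relative_entropy (\<Phi> \<rho>) (\<Phi> \<sigma>) \<le> relative_entropy \<rho> \<sigma>"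
proof -
  have so: "superoperator m m' \<Phi>" using assms by (simp add: cptp_def)
  note D = dominatedD[OF assms(2)] and d = superoperatorD[OF so]
  obtain c where c: "psd m (complex_of_real c \<cdot>\<^sub>m \<sigma> - \<rho>)" using assms(2) by (auto simp: dominated_def)
  have "\<Phi> (complex_of_real c \<cdot>\<^sub>m \<sigma> - \<rho>) = complex_of_real c \<cdot>\<^sub>m \<Phi> \<sigma> - \<Phi> \<rho>"
    using superoperator_minus[OF so smult_carrier_mat[OF D(4)] D(3)] d(3)[OF D(4)] by simp
  then show dom: "dominated m' (\<Phi> \<rho>) (\<Phi> \<sigma>)"
    using dominated_le[OF cptp_psd[OF assms(1) D(1)] cptp_psd[OF assms(1) D(2)], of c]
      cptp_psd[OF assms(1) c] by simp
  have "mat_trace (\<Phi> \<rho>) = mat_trace \<rho>" "mat_trace (\<Phi> \<sigma>) = mat_trace \<sigma>"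
    using assms(1) D(3,4) by (auto simp: cptp_def)
  then show "relative_entropy (\<Phi> \<rho>) (\<Phi> \<sigma>) \<le> relative_entropy \<rho> \<sigma>"
    using relative_entropy_mono[OF assms(2) dom cptp_variational_form[OF assms(1) D(1,2)]] by simp
qed

section \<open>Partial traces\<close>

text \<open>The tensor product of the identity of dimension \<open>k\<close> with \<open>B\<close>.
  For \<open>B\<close> the right marginal of a state it is the reference operator that turns a
  relative entropy into a conditional entropy.\<close>

definition kron_one :: "nat \<Rightarrow> complex mat \<Rightarrow> complex mat" where
  "kron_one k B = mat (k * dim_row B) (k * dim_col B) (\<lambda>(i, j).
     if i div dim_row B = j div dim_col B then B $$ (i mod dim_row B, j mod dim_col B) else 0)"

lemma kron_one_carrier [simp]: "B \<in> carrier_mat m m \<Longrightarrow> kron_one k B \<in> carrier_mat (k * m) (k * m)"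
  by (auto simp: kron_one_def)

lemma kron_one_index:
  "B \<in> carrier_mat m m \<Longrightarrow> a < k \<Longrightarrow> b < k \<Longrightarrow> p < m \<Longrightarrow> q < m \<Longrightarrow>
    kron_one k B $$ (a * m + p, b * m + q) = (if a = b then B $$ (p, q) else 0)"
  by (auto simp: kron_one_def mult_add_less)

lemma block_kron_one:
  "B \<in> carrier_mat m m \<Longrightarrow> a < k \<Longrightarrow> b < k \<Longrightarrow>
    block m (kron_one k B) a b = (if a = b then B else 0\<^sub>m m m)"
  by (rule eq_matI) (auto simp: kron_one_index)

lemma kron_one_unique:
  assumes "A \<in> carrier_mat (k * m) (k * m)" "B \<in> carrier_mat m m"
    and "\<And>a b. a < k \<Longrightarrow> b < k \<Longrightarrow> block m A a b = (if a = b then B else 0\<^sub>m m m)"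
  shows "A = kron_one k B"
  by (rule eq_blocksI[OF assms(1) kron_one_carrier[OF assms(2)]])
    (simp only: assms(3) block_kron_one[OF assms(2)])

lemma kron_one_adjoint:
  assumes "B \<in> carrier_mat m m"
  shows "mat_adjoint (kron_one k B) = kron_one k (mat_adjoint B)"
proof (rule kron_one_unique)
  fix a b assume ab: "a < k" "b < k"
  have "mat_adjoint (0\<^sub>m m m) = (0\<^sub>m m m :: complex mat)" by (rule eq_matI) auto
  then show "block m (mat_adjoint (kron_one k B)) a b = (if a = b then mat_adjoint B else 0\<^sub>m m m)"
    using block_adjoint[OF kron_one_carrier[OF assms] ab] block_kron_one[OF assms ab(2,1)] by simp
qed (use assms in auto)

lemma kron_one_add:
  assumes "A \<in> carrier_mat m m" "B \<in> carrier_mat m m"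
  shows "kron_one k (A + B) = kron_one k A + kron_one k B"
proof (rule kron_one_unique[symmetric])
  fix a b assume ab: "a < k" "b < k"
  show "block m (kron_one k A + kron_one k B) a b = (if a = b then A + B else 0\<^sub>m m m)"
    using block_add[OF kron_one_carrier[OF assms(1)] kron_one_carrier[OF assms(2)] ab]
      block_kron_one[OF assms(1) ab] block_kron_one[OF assms(2) ab] by simp
qed (use assms in auto)

lemma kron_one_diag: "kron_one k (mat_diag m f) = mat_diag (k * m) (\<lambda>i. f (i mod m))"
proof (rule kron_one_unique[symmetric])
  fix a b assume ab: "a < k" "b < k"
  show "block m (mat_diag (k * m) (\<lambda>i. f (i mod m))) a b = (if a = b then mat_diag m f else 0\<^sub>m m m)"
  proof (rule eq_matI)
    fix p q assume "p < dim_row (if a = b then mat_diag m f else 0\<^sub>m m m)"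
      "q < dim_col (if a = b then mat_diag m f else 0\<^sub>m m m)"
    then have pq: "p < m" "q < m" by (auto split: if_splits)
    have "a * m + p = b * m + q \<longleftrightarrow> a = b \<and> p = q"
    proof
      assume eq: "a * m + p = b * m + q"
      have "a = (a * m + p) div m" "p = (a * m + p) mod m"
        "b = (b * m + q) div m" "q = (b * m + q) mod m" using pq by auto
      then show "a = b \<and> p = q" using eq by metis
    qed simp
    then show "block m (mat_diag (k * m) (\<lambda>i. f (i mod m))) a b $$ (p, q) =
        (if a = b then mat_diag m f else 0\<^sub>m m m) $$ (p, q)"
      using pq mult_add_less[OF ab(1) pq(1)] mult_add_less[OF ab(2) pq(2)]
      by (simp add: mat_diag_def)
  qed auto
qed auto

lemma kron_one_one: "kron_one k (1\<^sub>m m) = 1\<^sub>m (k * m)"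
  using kron_one_diag[of k m "\<lambda>_. 1"] by simp

lemma kron_one_mult:
  assumes A: "A \<in> carrier_mat m m" and B: "B \<in> carrier_mat m m"
  shows "kron_one k A * kron_one k B = kron_one k (A * B)"
proof (rule kron_one_unique)
  fix a b assume ab: "a < k" "b < k"
  show "block m (kron_one k A * kron_one k B) a b = (if a = b then A * B else 0\<^sub>m m m)"
  proof (rule eq_matI)
    fix p q assume "p < dim_row (if a = b then A * B else 0\<^sub>m m m)"
      "q < dim_col (if a = b then A * B else 0\<^sub>m m m)"
    then have pq: "p < m" "q < m" using A B by (auto split: if_splits)
    have "block m (kron_one k A * kron_one k B) a b $$ (p, q) =
        (\<Sum>i<k * m. kron_one k A $$ (a * m + p, i) * kron_one k B $$ (i, b * m + q))"
      using pq mult_add_less[OF ab(1) pq(1)] mult_add_less[OF ab(2) pq(2)]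
        carrier_matD[OF kron_one_carrier[OF A]] carrier_matD[OF kron_one_carrier[OF B]]
      by (simp add: scalar_prod_def atLeast0LessThan)
    also have "\<dots> = (\<Sum>c<k. \<Sum>r<m. (if a = c then A $$ (p, r) else 0) * (if c = b then B $$ (r, q) else 0))"
      unfolding sum_mult_index
      by (intro sum.cong refl) (simp add: kron_one_index[OF A ab(1)] kron_one_index[OF B _ ab(2)] pq)
    also have "\<dots> = (\<Sum>c<k. if a = c then if c = b then (\<Sum>r<m. A $$ (p, r) * B $$ (r, q)) else 0 else 0)"
      by (intro sum.cong refl) auto
    also have "\<dots> = (if a = b then (\<Sum>r<m. A $$ (p, r) * B $$ (r, q)) else 0)"
      using ab by (simp add: sum.delta')
    also have "\<dots> = (if a = b then A * B else 0\<^sub>m m m) $$ (p, q)"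
      using pq A B by (simp add: scalar_prod_def atLeast0LessThan)
    finally show "block m (kron_one k A * kron_one k B) a b $$ (p, q) =
        (if a = b then A * B else 0\<^sub>m m m) $$ (p, q)" .
  qed (use A B in auto)
qed (rule mult_carrier_mat[OF kron_one_carrier[OF A] kron_one_carrier[OF B]] mult_carrier_mat[OF A B])+

lemma unitary_diag_kron_one:
  assumes B: "B \<in> carrier_mat m m" and "unitary_diag B V q"
  shows "unitary_diag (kron_one k B) (kron_one k V) (\<lambda>i. q (i mod m))"
proof -
  note v = unitary_diagD[OF assms]
  let ?D = "mat_diag m (\<lambda>i. complex_of_real (q i))"
  have V': "mat_adjoint V \<in> carrier_mat m m" using v(1) by simp
  have "kron_one k B = kron_one k V * kron_one k ?D * kron_one k (mat_adjoint V)"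
    by (subst v(4)) (use kron_one_mult[OF v(1), of ?D k]
      kron_one_mult[OF mult_carrier_mat[OF v(1), of ?D m] V', of k] in simp)
  moreover have "kron_one k (mat_adjoint V) * kron_one k V = 1\<^sub>m (k * m)"
    by (simp add: kron_one_mult[OF V' v(1)] v(2) kron_one_one)
  moreover have "dim_row (kron_one k B) = k * m" using B by (simp add: kron_one_def)
  ultimately show ?thesis
    unfolding unitary_diag_def kron_one_adjoint[OF v(1)] kron_one_diag
    using kron_one_carrier[OF v(1)] by simp
qed

text \<open>A unitary that diagonalises B, tensored with the identity, diagonalises the ampliation
  with each eigenvalue repeated k times.\<close>

lemma mat_fun_kron_one:
  assumes "B \<in> carrier_mat m m" "unitary_diag B V q"
  shows "mat_fun f (kron_one k B) = kron_one k (mat_fun f B)"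
proof -
  note v = unitary_diagD[OF assms]
  let ?D = "mat_diag m (\<lambda>i. complex_of_real (f (q i)))"
  have V': "mat_adjoint V \<in> carrier_mat m m" using v(1) by simp
  have "mat_fun f (kron_one k B) = kron_one k V * kron_one k ?D * kron_one k (mat_adjoint V)"
    unfolding mat_fun_unitary_diag[OF kron_one_carrier[OF assms(1)] unitary_diag_kron_one[OF assms]]
      kron_one_diag kron_one_adjoint[OF v(1)] ..
  also have "\<dots> = kron_one k (V * ?D * mat_adjoint V)"
    using kron_one_mult[OF v(1), of ?D k] kron_one_mult[OF mult_carrier_mat[OF v(1), of ?D m] V', of k] by simp
  finally show ?thesis unfolding mat_fun_unitary_diag[OF assms] .
qed

lemma unitary_diag_psd:
  assumes "A \<in> carrier_mat n n" "unitary_diag A U l" "\<And>i. i < n \<Longrightarrow> 0 \<le> l i"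
  shows "psd n A"
  using psd_sandwich[OF psd_diag[of n l] unitary_diagD(1)[OF assms(1,2)]] assms(3)
    unitary_diagD(4)[OF assms(1,2)] by simp

lemma psd_kron_one:
  assumes "psd m B"
  shows "psd (k * m) (kron_one k B)"
proof -
  obtain V q where V: "unitary_diag B V q" "\<forall>i<m. 0 \<le> q i" using psd_unitary_diag[OF assms] by blast
  note B = psd_carrier[OF assms]
  show ?thesis
  proof (rule unitary_diag_psd[OF kron_one_carrier[OF B] unitary_diag_kron_one[OF B V(1)]])
    fix i assume "i < k * m"
    then have "m > 0" by (auto intro: Nat.gr0I)
    then show "0 \<le> q (i mod m)" using V(2) by simp
  qed
qed

section \<open>Positivity and complete positivity of partial traces\<close>

lemma form_sum:
  assumes "A \<in> carrier_mat n n" "v \<in> carrier_vec n"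
  shows "(A *\<^sub>v v) \<bullet>c v = (\<Sum>i<n. \<Sum>j<n. A $$ (i, j) * (v $ j * cnj (v $ i)))"
  using assms by (auto simp: scalar_prod_def atLeast0LessThan sum_distrib_right mult.assoc)

lemma sum_delta_nested:
  fixes g :: "nat \<Rightarrow> 'b \<Rightarrow> 'a :: comm_monoid_add"
  assumes "a < k"
  shows "(\<Sum>b<k. \<Sum>p\<in>P. if b = a then g b p else 0) = (\<Sum>p\<in>P. g a p)"
  using assms by (subst sum.swap) simp

lemma psd_block:
  assumes "psd (k * m) A" "a < k"
  shows "psd m (block m A a a)"
proof (rule psdI)
  fix v :: "complex vec" assume v: "v \<in> carrier_vec m"
  define x where "x = vec (k * m) (\<lambda>i. if i div m = a then v $ (i mod m) else 0)"
  have x: "x \<in> carrier_vec (k * m)" by (simp add: x_def)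
  have xi: "x $ (b * m + p) = (if b = a then v $ p else 0)" if "b < k" "p < m" for b p
    using that mult_add_less[OF that] by (simp add: x_def)
  have "(A *\<^sub>v x) \<bullet>c x = (\<Sum>b<k. \<Sum>p<m. \<Sum>c<k. \<Sum>q<m.
      A $$ (b * m + p, c * m + q) * (x $ (c * m + q) * cnj (x $ (b * m + p))))"
    unfolding form_sum[OF psd_carrier[OF assms(1)] x] sum_mult_index ..
  also have "\<dots> = (\<Sum>b<k. \<Sum>p<m. if b = a then (\<Sum>c<k. \<Sum>q<m. if c = a then
      A $$ (b * m + p, c * m + q) * (v $ q * cnj (v $ p)) else 0) else 0)"
    by (intro sum.cong refl) (auto simp: xi simp del: sum.delta sum.delta' intro!: sum.cong)
  also have "\<dots> = (\<Sum>p<m. \<Sum>q<m. block m A a a $$ (p, q) * (v $ q * cnj (v $ p)))"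
    unfolding sum_delta_nested[OF assms(2)] by simp
  also have "\<dots> = (block m A a a *\<^sub>v v) \<bullet>c v"
    unfolding form_sum[OF block_carrier v] ..
  finally show "0 \<le> (block m A a a *\<^sub>v v) \<bullet>c v"
    using assms(1) x unfolding psd_def by metis
qed simp

lemma ptrace_left_carrier [simp]: "ptrace_left k m A \<in> carrier_mat m m"
  by (simp add: ptrace_left_def)

lemma ptrace_right_carrier [simp]: "ptrace_right k m A \<in> carrier_mat k k"
  by (simp add: ptrace_right_def)

lemma form_ptrace_left:
  assumes "v \<in> carrier_vec m"
  shows "(ptrace_left k m A *\<^sub>v v) \<bullet>c v = (\<Sum>c<k. (block m A c c *\<^sub>v v) \<bullet>c v)"
proof -
  have "(ptrace_left k m A *\<^sub>v v) \<bullet>c v =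
      (\<Sum>p<m. \<Sum>q<m. \<Sum>c<k. A $$ (c * m + p, c * m + q) * (v $ q * cnj (v $ p)))"
    unfolding form_sum[OF ptrace_left_carrier assms]
    by (intro sum.cong refl) (simp add: ptrace_left_def sum_distrib_right)
  also have "\<dots> = (\<Sum>p<m. \<Sum>c<k. \<Sum>q<m. A $$ (c * m + p, c * m + q) * (v $ q * cnj (v $ p)))"
    by (intro sum.cong refl sum.swap)
  also have "\<dots> = (\<Sum>c<k. \<Sum>p<m. \<Sum>q<m. A $$ (c * m + p, c * m + q) * (v $ q * cnj (v $ p)))"
    by (rule sum.swap)
  finally show ?thesis unfolding form_sum[OF block_carrier assms] by simp
qed

lemma psd_ptrace_left:
  assumes "psd (k * m) A"
  shows "psd m (ptrace_left k m A)"
proof (rule psdI)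
  fix v :: "complex vec" assume v: "v \<in> carrier_vec m"
  show "0 \<le> (ptrace_left k m A *\<^sub>v v) \<bullet>c v"
    unfolding form_ptrace_left[OF v]
    using psd_block[OF assms] v by (intro sum_nonneg) (auto simp: psd_def)
qed simp

lemma mat_trace_ptrace_left:
  assumes "A \<in> carrier_mat (k * m) (k * m)"
  shows "mat_trace (ptrace_left k m A) = mat_trace A"
proof -
  have "mat_trace (ptrace_left k m A) = (\<Sum>p<m. \<Sum>a<k. A $$ (a * m + p, a * m + p))"
    by (simp add: mat_trace_def ptrace_left_def)
  also have "\<dots> = (\<Sum>a<k. \<Sum>p<m. A $$ (a * m + p, a * m + p))" by (rule sum.swap)
  finally show ?thesis using assms by (simp add: mat_trace_def sum_mult_index)
qed

lemma mat_trace_mult_kron_one: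
  assumes A: "A \<in> carrier_mat (k * m) (k * m)" and Y: "Y \<in> carrier_mat m m"
  shows "mat_trace (A * kron_one k Y) = mat_trace (ptrace_left k m A * Y)"
proof -
  have "mat_trace (A * kron_one k Y) = (\<Sum>a<k. \<Sum>b<k. if a = b then mat_trace (block m A a a * Y) else 0)"
    unfolding mat_trace_mult_blocks[OF A kron_one_carrier[OF Y]]
    by (intro sum.cong refl) (auto simp: block_kron_one[OF Y] right_mult_zero_mat[OF block_carrier] mat_trace_def)
  also have "\<dots> = (\<Sum>a<k. mat_trace (block m A a a * Y))" by simp
  also have "\<dots> = (\<Sum>a<k. \<Sum>p<m. \<Sum>q<m. A $$ (a * m + p, a * m + q) * Y $$ (q, p))"
    unfolding mat_trace_mult[OF block_carrier Y] by simp
  also have "\<dots> = (\<Sum>p<m. \<Sum>a<k. \<Sum>q<m. A $$ (a * m + p, a * m + q) * Y $$ (q, p))"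
    by (rule sum.swap)
  also have "\<dots> = (\<Sum>p<m. \<Sum>q<m. \<Sum>a<k. A $$ (a * m + p, a * m + q) * Y $$ (q, p))"
    by (intro sum.cong refl sum.swap)
  also have "\<dots> = mat_trace (ptrace_left k m A * Y)"
    unfolding mat_trace_mult[OF ptrace_left_carrier Y]
    by (intro sum.cong refl) (simp add: ptrace_left_def sum_distrib_right)
  finally show ?thesis .
qed

text \<open>With \<open>P\<^sub>a\<close> the projection onto the block \<open>a\<close>, summing \<open>(P\<^sub>a - P\<^sub>b) A (P\<^sub>a - P\<^sub>b) \<ge> 0\<close> over
  \<open>a, b\<close> gives \<open>A \<le> k * (\<Sum>a. P\<^sub>a A P\<^sub>a)\<close>.\<close>

lemma psd_kron_ptrace_left_diff:
  assumes "psd (k * m) A"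
  shows "psd (k * m) (kron_one k (complex_of_real (real k) \<cdot>\<^sub>m ptrace_left k m A) - A)"
proof (rule psdI)
  note A = psd_carrier[OF assms]
  let ?R = "ptrace_left k m A"
  let ?K = "kron_one k (complex_of_real (real k) \<cdot>\<^sub>m ?R)"
  have cR: "complex_of_real (real k) \<cdot>\<^sub>m ?R \<in> carrier_mat m m" by simp
  have K: "?K \<in> carrier_mat (k * m) (k * m)" by (rule kron_one_carrier[OF cR])
  show "?K - A \<in> carrier_mat (k * m) (k * m)" by (rule minus_carrier_mat[OF A])
  fix v :: "complex vec" assume v: "v \<in> carrier_vec (k * m)"
  define \<beta> where "\<beta> a b = (\<Sum>p<m. \<Sum>q<m. A $$ (a * m + p, b * m + q) * (v $ (b * m + q) * cnj (v $ (a * m + p))))"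
    for a b
  have vA: "(A *\<^sub>v v) \<bullet>c v = (\<Sum>a<k. \<Sum>b<k. \<beta> a b)"
    unfolding form_sum[OF A v] sum_mult_index \<beta>_def by (intro sum.cong refl sum.swap)
  have pos: "0 \<le> \<beta> a a + \<beta> b b - \<beta> a b - \<beta> b a" if ab: "a < k" "b < k" for a b
  proof -
    \<comment> \<open>These are the signs of P_a - P_b, so that \<open>x\<close> is (P_a - P_b) v;
      for a = b they vanish, as does the expression to be bounded.\<close>
    define s :: "nat \<Rightarrow> complex" where "s c = (if c = a then 1 else 0) - (if c = b then 1 else 0)" for c
    define x where "x = vec (k * m) (\<lambda>i. s (i div m) * v $ i)"
    have x: "x \<in> carrier_vec (k * m)" by (simp add: x_def)
    have xi: "x $ (c * m + p) = s c * v $ (c * m + p)" if "c < k" "p < m" for c p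
      using that mult_add_less[OF that] by (simp add: x_def)
    have "(A *\<^sub>v x) \<bullet>c x = (\<Sum>c<k. \<Sum>e<k. \<Sum>p<m. \<Sum>q<m.
        A $$ (c * m + p, e * m + q) * (x $ (e * m + q) * cnj (x $ (c * m + p))))"
      unfolding form_sum[OF A x] sum_mult_index by (intro sum.cong refl sum.swap)
    also have "\<dots> = (\<Sum>c<k. \<Sum>e<k. s e * cnj (s c) * \<beta> c e)"
      unfolding \<beta>_def sum_distrib_left by (intro sum.cong refl) (simp add: xi)
    also have "\<dots> = (\<Sum>c<k. cnj (s c) * (\<beta> c a - \<beta> c b))"
    proof (intro sum.cong refl)
      fix c
      have "(\<Sum>e<k. s e * cnj (s c) * \<beta> c e) =
          (\<Sum>e<k. (if e = a then cnj (s c) * \<beta> c e else 0) - (if e = b then cnj (s c) * \<beta> c e else 0))"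
        by (intro sum.cong refl) (simp add: s_def)
      then show "(\<Sum>e<k. s e * cnj (s c) * \<beta> c e) = cnj (s c) * (\<beta> c a - \<beta> c b)"
        using ab by (simp add: sum_subtractf algebra_simps)
    qed
    also have "\<dots> = (\<Sum>c<k. (if c = a then \<beta> c a - \<beta> c b else 0) - (if c = b then \<beta> c a - \<beta> c b else 0))"
      by (intro sum.cong refl) (simp add: s_def)
    also have "\<dots> = \<beta> a a + \<beta> b b - \<beta> a b - \<beta> b a"
      using ab by (simp add: sum_subtractf)
    finally show ?thesis using assms x unfolding psd_def by metis
  qed
  have "0 \<le> (\<Sum>a<k. \<Sum>b<k. \<beta> a a + \<beta> b b - \<beta> a b - \<beta> b a)"
    using pos by (intro sum_nonneg) auto
  also have "\<dots> = of_nat k * (\<Sum>a<k. \<beta> a a) + of_nat k * (\<Sum>a<k. \<beta> a a) - (\<Sum>a<k. \<Sum>b<k. \<beta> a b) - (\<Sum>a<k. \<Sum>b<k. \<beta> b a)"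
    by (simp add: sum.distrib sum_subtractf sum_distrib_left)
  also have "(\<Sum>a<k. \<Sum>b<k. \<beta> b a) = (\<Sum>a<k. \<Sum>b<k. \<beta> a b)" by (rule sum.swap)
  finally have le1: "(\<Sum>a<k. \<Sum>b<k. \<beta> a b) \<le> of_nat k * (\<Sum>a<k. \<beta> a a)"
    by (simp add: less_eq_complex_def)
  define w where "w a = vec m (\<lambda>p. v $ (a * m + p))" for a
  have w: "w a \<in> carrier_vec m" for a by (simp add: w_def)
  have ki: "?K $$ (a * m + p, b * m + q) = (if a = b then of_nat k * ?R $$ (p, q) else 0)"
    if "a < k" "b < k" "p < m" "q < m" for a b p q
    using kron_one_index[OF cR that] that(3,4) carrier_matD[OF ptrace_left_carrier[of k m A]] by simp
  have "(?K *\<^sub>v v) \<bullet>c v = (\<Sum>a<k. \<Sum>p<m. \<Sum>b<k. \<Sum>q<m.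
      (if a = b then of_nat k * ?R $$ (p, q) else 0) * (v $ (b * m + q) * cnj (v $ (a * m + p))))"
    unfolding form_sum[OF K v] sum_mult_index
    by (intro sum.cong refl) (simp only: ki lessThan_iff)
  also have "\<dots> = (\<Sum>a<k. \<Sum>p<m. \<Sum>b<k. if a = b then (\<Sum>q<m.
      of_nat k * ?R $$ (p, q) * (v $ (b * m + q) * cnj (v $ (a * m + p)))) else 0)"
    by (intro sum.cong refl) auto
  also have "\<dots> = (\<Sum>a<k. of_nat k * ((?R *\<^sub>v w a) \<bullet>c w a))"
    unfolding form_sum[OF ptrace_left_carrier w] by (simp add: sum_distrib_left w_def mult.assoc)
  finally have vK: "(?K *\<^sub>v v) \<bullet>c v = of_nat k * (\<Sum>a<k. (?R *\<^sub>v w a) \<bullet>c w a)"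
    by (simp add: sum_distrib_left)
  \<comment> \<open>Each diagonal block is at most the sum of all diagonal blocks, which is the
    marginal; this replaces the block-diagonal part of A by the ampliated marginal.\<close>
  have "(\<Sum>a<k. \<beta> a a) \<le> (\<Sum>a<k. (?R *\<^sub>v w a) \<bullet>c w a)"
  proof (rule sum_mono)
    fix a assume a: "a \<in> {..<k}"
    have "\<beta> a a = (block m A a a *\<^sub>v w a) \<bullet>c w a"
      unfolding form_sum[OF block_carrier w] \<beta>_def by (simp add: w_def)
    also have "\<dots> \<le> (\<Sum>c<k. (block m A c c *\<^sub>v w a) \<bullet>c w a)"
      using a psd_block[OF assms] w by (intro member_le_sum) (auto simp: psd_def)
    finally show "\<beta> a a \<le> (?R *\<^sub>v w a) \<bullet>c w a" unfolding form_ptrace_left[OF w] .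
  qed
  then have "of_nat k * (\<Sum>a<k. \<beta> a a) \<le> (?K *\<^sub>v v) \<bullet>c v"
    unfolding vK by (intro mult_left_mono) (auto simp: less_eq_complex_def)
  then have "(A *\<^sub>v v) \<bullet>c v \<le> (?K *\<^sub>v v) \<bullet>c v" using le1 unfolding vA by (rule order_trans[rotated])
  moreover have "((?K - A) *\<^sub>v v) \<bullet>c v = (?K *\<^sub>v v) \<bullet>c v - (A *\<^sub>v v) \<bullet>c v"
    using minus_mult_distrib_mat_vec[OF K A v] minus_scalar_prod_distrib[of "?K *\<^sub>v v" "k * m" "A *\<^sub>v v" "conjugate v"]
      mult_mat_vec_carrier[OF K v] mult_mat_vec_carrier[OF A v] v by simp
  ultimately show "0 \<le> ((?K - A) *\<^sub>v v) \<bullet>c v" by (simp add: less_eq_complex_def)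
qed

text \<open>The form of the marginal at v is the sum over r < m of the form of A at v tensored with
  the basis vector e_r.\<close>

lemma psd_ptrace_right:
  assumes "psd (k * m) A"
  shows "psd k (ptrace_right k m A)"
proof (rule psdI)
  note A = psd_carrier[OF assms]
  fix v :: "complex vec" assume v: "v \<in> carrier_vec k"
  define x where "x r = vec (k * m) (\<lambda>i. if i mod m = r then v $ (i div m) else 0)" for r
  have x: "x r \<in> carrier_vec (k * m)" for r by (simp add: x_def)
  have xi: "x r $ (b * m + p) = (if p = r then v $ b else 0)" if "b < k" "p < m" for b p r
    using that mult_add_less[OF that] by (simp add: x_def)
  have xr: "(A *\<^sub>v x r) \<bullet>c x r = (\<Sum>a<k. \<Sum>b<k. A $$ (a * m + r, b * m + r) * (v $ b * cnj (v $ a)))"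
    if r: "r < m" for r
  proof -
    have "(A *\<^sub>v x r) \<bullet>c x r = (\<Sum>a<k. \<Sum>p<m. \<Sum>b<k. \<Sum>q<m.
        A $$ (a * m + p, b * m + q) * (x r $ (b * m + q) * cnj (x r $ (a * m + p))))"
      unfolding form_sum[OF A x] sum_mult_index ..
    also have "\<dots> = (\<Sum>a<k. \<Sum>p<m. if p = r then (\<Sum>b<k. \<Sum>q<m. if q = r then
        A $$ (a * m + p, b * m + q) * (v $ b * cnj (v $ a)) else 0) else 0)"
      by (intro sum.cong refl) (auto simp: xi simp del: sum.delta sum.delta' intro!: sum.cong)
    finally show ?thesis using r by simp
  qed
  have "(ptrace_right k m A *\<^sub>v v) \<bullet>c v =
      (\<Sum>a<k. \<Sum>b<k. \<Sum>r<m. A $$ (a * m + r, b * m + r) * (v $ b * cnj (v $ a)))"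
    unfolding form_sum[OF ptrace_right_carrier v]
    by (intro sum.cong refl) (simp add: ptrace_right_def sum_distrib_right)
  also have "\<dots> = (\<Sum>a<k. \<Sum>r<m. \<Sum>b<k. A $$ (a * m + r, b * m + r) * (v $ b * cnj (v $ a)))"
    by (intro sum.cong refl sum.swap)
  also have "\<dots> = (\<Sum>r<m. \<Sum>a<k. \<Sum>b<k. A $$ (a * m + r, b * m + r) * (v $ b * cnj (v $ a)))"
    by (rule sum.swap)
  also have "\<dots> = (\<Sum>r<m. (A *\<^sub>v x r) \<bullet>c x r)" by (simp add: xr)
  also have "0 \<le> \<dots>" using assms x by (intro sum_nonneg) (auto simp: psd_def)
  finally show "0 \<le> (ptrace_right k m A *\<^sub>v v) \<bullet>c v" .
qed simp

text \<open>A partial trace ampliated on the left is again a partial trace, so complete positivity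
  reduces to plain positivity in a larger dimension.\<close>

lemma id_tensor_ptrace_right:
  "id_tensor l (k * m) k (ptrace_right k m) A = ptrace_right (l * k) m A"
proof (rule eq_matI)
  fix i j assume "i < dim_row (ptrace_right (l * k) m A)" "j < dim_col (ptrace_right (l * k) m A)"
  then have ij: "i < l * k" "j < l * k" by (auto simp: ptrace_right_def)
  then have "k > 0" by (auto intro: Nat.gr0I)
  then have mods: "i mod k < k" "j mod k < k" by auto
  have e: "i div k * (k * m) + (i mod k * m + p) = i * m + p" for i p
  proof -
    have "i * m + p = (i div k * k + i mod k) * m + p" by simp
    also have "\<dots> = i div k * (k * m) + (i mod k * m + p)" by (simp only: algebra_simps)
    finally show ?thesis by simp
  qed
  have "id_tensor l (k * m) k (ptrace_right k m) A $$ (i, j) =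
      (\<Sum>p<m. block (k * m) A (i div k) (j div k) $$ (i mod k * m + p, j mod k * m + p))"
    using ij mods by (simp add: id_tensor_def ptrace_right_def)
  also have "\<dots> = (\<Sum>p<m. A $$ (i * m + p, j * m + p))"
    using mult_add_less[OF mods(1)] mult_add_less[OF mods(2)]
    by (intro sum.cong refl) (simp add: e del: add.assoc)
  finally show "id_tensor l (k * m) k (ptrace_right k m) A $$ (i, j) = ptrace_right (l * k) m A $$ (i, j)"
    using ij by (simp add: ptrace_right_def)
qed (auto simp: ptrace_right_def)

lemma cptp_ptrace_right: "cptp (k * m) k (ptrace_right k m)"
  unfolding cptp_def superoperator_def
proof (intro conjI allI ballI impI)
  fix A B :: "complex mat" and c :: complex
  assume A: "A \<in> carrier_mat (k * m) (k * m)"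
  show "ptrace_right k m A \<in> carrier_mat k k" by simp
  show "ptrace_right k m (c \<cdot>\<^sub>m A) = c \<cdot>\<^sub>m ptrace_right k m A"
    using A by (intro eq_matI) (auto simp: ptrace_right_def sum_distrib_left mult_add_less)
  show "mat_trace (ptrace_right k m A) = mat_trace A"
    using A by (simp add: mat_trace_def ptrace_right_def sum_mult_index)
  assume B: "B \<in> carrier_mat (k * m) (k * m)"
  show "ptrace_right k m (A + B) = ptrace_right k m A + ptrace_right k m B"
    using A B by (intro eq_matI) (simp_all add: ptrace_right_def sum.distrib mult_add_less)
next
  fix l A assume "psd (l * (k * m)) A"
  then show "psd (l * k) (id_tensor l (k * m) k (ptrace_right k m) A)"
    unfolding id_tensor_ptrace_right by (intro psd_ptrace_right) (simp add: mult.assoc)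
qed

text \<open>The left partial trace is the sum of the diagonal blocks, on each of which \<Phi> acts
  linearly. The induction runs over the number of blocks summed, with the number k of blocks
  fixed.\<close>

lemma ptrace_left_id_tensor:
  assumes "superoperator m m' \<Phi>"
  shows "ptrace_left k m' (id_tensor k m m' \<Phi> A) = \<Phi> (ptrace_left k m A)"
proof -
  have Suc: "ptrace_left (Suc n) l B = ptrace_left n l B + block l B n n" for n l B
    by (rule eq_matI) (auto simp: ptrace_left_def)
  have zero: "ptrace_left 0 l B = 0\<^sub>m l l" for l B
    by (rule eq_matI) (auto simp: ptrace_left_def)
  have "ptrace_left n m' (id_tensor k m m' \<Phi> A) = \<Phi> (ptrace_left n m A)" if "n \<le> k" for n
    using that
  proof (induction n)
    case 0
    then show ?case by (simp add: zero superoperator_zero[OF assms])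
  next
    case (Suc n)
    then show ?case
      using block_id_tensor[OF assms, of n k n A] superoperatorD(2)[OF assms ptrace_left_carrier block_carrier]
      by (simp add: \<open>\<And>n l B. ptrace_left (Suc n) l B = ptrace_left n l B + block l B n n\<close>)
  qed
  then show ?thesis by simp
qed

lemma id_tensor_kron_one:
  assumes "superoperator m m' \<Phi>" "B \<in> carrier_mat m m"
  shows "id_tensor k m m' \<Phi> (kron_one k B) = kron_one k (\<Phi> B)"
proof (rule kron_one_unique)
  show "\<Phi> B \<in> carrier_mat m' m'" by (rule superoperatorD(1)[OF assms])
  fix a b assume ab: "a < k" "b < k"
  show "block m' (id_tensor k m m' \<Phi> (kron_one k B)) a b = (if a = b then \<Phi> B else 0\<^sub>m m' m')"
    by (simp add: block_id_tensor[OF assms(1) ab] block_kron_one[OF assms(2) ab] superoperator_zero[OF assms(1)])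
qed simp

section \<open>Conditional entropy and its continuity\<close>

text \<open>Natural logarithms are used for all estimates; the base \<open>b\<close> returns at the
  end as a division by \<open>ln b\<close>.\<close>

definition entropy :: "complex mat \<Rightarrow> real" where
  "entropy \<rho> = - Re (mat_trace (\<rho> * mat_fun ln \<rho>))"

lemma vn_entropy_eq:
  assumes "psd n \<rho>"
  shows "vn_entropy b \<rho> = entropy \<rho> / ln b"
proof -
  obtain U l where U: "unitary_diag \<rho> U l" using psd_unitary_diag[OF assms] by blast
  note rc = psd_carrier[OF assms]
  show ?thesis
    unfolding vn_entropy_def entropy_def Re_trace_mult_mat_fun[OF rc U]
    by (simp add: log_def sum_divide_distrib)
qed

lemma unitary_diag_smult:
  assumes "A \<in> carrier_mat n n" "unitary_diag A U l"
  shows "unitary_diag (complex_of_real c \<cdot>\<^sub>m A) U (\<lambda>i. c * l i)"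
proof -
  note u = unitary_diagD[OF assms]
  let ?D = "mat_diag n (\<lambda>i. complex_of_real (l i))"
  have D: "?D \<in> carrier_mat n n" by simp
  have "mat_diag n (\<lambda>i. complex_of_real (c * l i)) = complex_of_real c \<cdot>\<^sub>m ?D"
    by (rule eq_matI) (auto simp: mat_diag_def)
  moreover have "U * (complex_of_real c \<cdot>\<^sub>m ?D) * mat_adjoint U = complex_of_real c \<cdot>\<^sub>m (U * ?D * mat_adjoint U)"
    unfolding mult_smult_distrib[OF u(1) D]
    by (rule mult_smult_assoc_mat[OF mult_carrier_mat[OF u(1) D] mat_adjoint_carrier[OF u(1)]])
  ultimately have "complex_of_real c \<cdot>\<^sub>m A = U * mat_diag n (\<lambda>i. complex_of_real (c * l i)) * mat_adjoint U"
    using u(4) by metis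
  then show ?thesis using assms(1) u(1,2) by (simp add: unitary_diag_def)
qed

lemma trace_mult_ln_smult:
  assumes "psd n B" "c > 0"
  shows "Re (mat_trace (B * mat_fun ln (complex_of_real c \<cdot>\<^sub>m B))) = ln c * Re (mat_trace B) - entropy B"
proof -
  obtain V q where V: "unitary_diag B V q" "\<forall>i<n. 0 \<le> q i" using psd_unitary_diag[OF assms(1)] by blast
  note B = psd_carrier[OF assms(1)]
  have cB: "complex_of_real c \<cdot>\<^sub>m B \<in> carrier_mat n n" using B by simp
  note f = unitary_diag_mat_fun[OF cB unitary_diag_smult[OF B V(1)], of ln]
  have "Re (mat_trace (B * mat_fun ln (complex_of_real c \<cdot>\<^sub>m B))) = (\<Sum>i<n. q i * ln (c * q i))"
    by (rule Re_trace_common_basis[OF B V(1) f])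
  also have "\<dots> = (\<Sum>i<n. ln c * q i + q i * ln (q i))"
  proof (intro sum.cong refl)
    fix i assume "i \<in> {..<n}"
    then have "q i = 0 \<or> q i > 0" using V(2) by (auto simp: less_le)
    then show "q i * ln (c * q i) = ln c * q i + q i * ln (q i)"
      using assms(2) by (auto simp: ln_mult algebra_simps)
  qed
  also have "\<dots> = ln c * Re (mat_trace B) - entropy B"
    unfolding entropy_def Re_trace_mult_mat_fun[OF B V(1)] unitary_diag_trace[OF B V(1)]
    by (simp add: sum.distrib sum_distrib_left)
  finally show ?thesis .
qed

lemma relative_entropy_scaled_one:
  assumes "psd n A"
  shows "relative_entropy A (complex_of_real c \<cdot>\<^sub>m 1\<^sub>m n) = - entropy A - ln c * Re (mat_trace A)"
proof -
  note A = psd_carrier[OF assms]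
  have "complex_of_real c \<cdot>\<^sub>m 1\<^sub>m n = 1\<^sub>m n * mat_diag n (\<lambda>i. complex_of_real c) * mat_adjoint (1\<^sub>m n)"
    by (rule eq_matI) (auto simp: mat_diag_def)
  then have U: "unitary_diag (complex_of_real c \<cdot>\<^sub>m 1\<^sub>m n) (1\<^sub>m n) (\<lambda>_. c)"
    by (simp add: unitary_diag_def)
  have c: "complex_of_real c \<cdot>\<^sub>m 1\<^sub>m n \<in> carrier_mat n n" by simp
  have "mat_fun ln (complex_of_real c \<cdot>\<^sub>m 1\<^sub>m n) = complex_of_real (ln c) \<cdot>\<^sub>m 1\<^sub>m n"
    unfolding mat_fun_unitary_diag[OF c U] by (rule eq_matI) (auto simp: mat_diag_def)
  then have "A * mat_fun ln (complex_of_real c \<cdot>\<^sub>m 1\<^sub>m n) = complex_of_real (ln c) \<cdot>\<^sub>m A"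
    using mult_smult_distrib[OF A one_carrier_mat, of "complex_of_real (ln c)"] right_mult_one_mat[OF A] by simp
  then show ?thesis
    using mat_trace_smult[OF A, of "complex_of_real (ln c)"] by (simp add: relative_entropy_def entropy_def)
qed

text \<open>Each eigenvalue of a positive matrix is at most the sum of all of them. Trace 0 is
  covered, since then A = 0.\<close>

lemma dominated_trace_one:
  assumes "psd n A"
  shows "dominated n A (complex_of_real (Re (mat_trace A)) \<cdot>\<^sub>m 1\<^sub>m n)"
proof -
  note A = psd_carrier[OF assms]
  obtain U l where U: "unitary_diag A U l" "\<forall>i<n. 0 \<le> l i" using psd_unitary_diag[OF assms] by blast
  note u = unitary_diagD[OF A U(1)]
  let ?t = "Re (mat_trace A)"
  have t: "?t = (\<Sum>i<n. l i)" unfolding unitary_diag_trace[OF A U(1)] by simp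
  let ?D = "\<lambda>f. mat_diag n (\<lambda>i. complex_of_real (f i))"
  have "psd n (?D (\<lambda>i. ?t - l i))"
    by (rule psd_diag) (use U(2) in \<open>auto simp: t intro!: member_le_sum\<close>)
  then have "psd n (U * ?D (\<lambda>i. ?t - l i) * mat_adjoint U)" using psd_sandwich[OF _ u(1)] by blast
  moreover have "U * ?D (\<lambda>i. ?t - l i) * mat_adjoint U = complex_of_real ?t \<cdot>\<^sub>m 1\<^sub>m n - A"
  proof -
    have D: "?D (\<lambda>i. ?t - l i) = complex_of_real ?t \<cdot>\<^sub>m 1\<^sub>m n - ?D l"
      by (rule eq_matI) (auto simp: mat_diag_def)
    have c: "?D l \<in> carrier_mat n n" "complex_of_real ?t \<cdot>\<^sub>m 1\<^sub>m n \<in> carrier_mat n n" by auto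
    have "U * ?D (\<lambda>i. ?t - l i) = complex_of_real ?t \<cdot>\<^sub>m U - U * ?D l"
      unfolding D mult_minus_distrib_mat[OF u(1) c(2,1)] mult_smult_distrib[OF u(1) one_carrier_mat]
      using right_mult_one_mat[OF u(1)] by simp
    moreover have "(complex_of_real ?t \<cdot>\<^sub>m U - U * ?D l) * mat_adjoint U =
        complex_of_real ?t \<cdot>\<^sub>m (U * mat_adjoint U) - U * ?D l * mat_adjoint U"
      using minus_mult_distrib_mat[OF smult_carrier_mat[OF u(1)] mult_carrier_mat[OF u(1) c(1)] mat_adjoint_carrier[OF u(1)]]
        mult_smult_assoc_mat[OF u(1) mat_adjoint_carrier[OF u(1)]] by simp
    ultimately show ?thesis using u(3,4) by simp
  qed
  ultimately have p: "psd n (complex_of_real ?t \<cdot>\<^sub>m 1\<^sub>m n - A)" by simp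
  show ?thesis
  proof (rule dominated_le[OF assms, of _ 1])
    have "psd n (1\<^sub>m n)" using psd_diag[of n "\<lambda>_. 1"] by simp
    then show "psd n (complex_of_real ?t \<cdot>\<^sub>m 1\<^sub>m n)" by (rule psd_smult) (rule Re_psd_trace[OF assms])
    have "complex_of_real 1 \<cdot>\<^sub>m (complex_of_real ?t \<cdot>\<^sub>m 1\<^sub>m n) = complex_of_real ?t \<cdot>\<^sub>m 1\<^sub>m n"
      by (rule eq_matI) auto
    then show "psd n (complex_of_real 1 \<cdot>\<^sub>m (complex_of_real ?t \<cdot>\<^sub>m 1\<^sub>m n) - A)" using p by simp
  qed
qed

text \<open>Both summands lie below the sum, so tr \<rho> ln \<rho> is at most tr \<rho> ln (\<rho>
  + \<sigma>), likewise for \<sigma>, and the two right-hand sides add up.\<close>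

lemma entropy_add_le:
  assumes "psd n \<rho>" "psd n \<sigma>"
  shows "entropy (\<rho> + \<sigma>) \<le> entropy \<rho> + entropy \<sigma>"
proof -
  note r = psd_carrier[OF assms(1)] and s = psd_carrier[OF assms(2)]
  have sum: "\<rho> + \<sigma> \<in> carrier_mat n n" using r s by simp
  have "\<rho> + \<sigma> - \<rho> = \<sigma>" "\<rho> + \<sigma> - \<sigma> = \<rho>" using r s by (auto intro!: eq_matI)
  then have "relative_entropy \<rho> (\<rho> + \<sigma>) \<le> 0" "relative_entropy \<sigma> (\<rho> + \<sigma>) \<le> 0"
    using relative_entropy_le_zero(2)[OF assms(1) _ sum] relative_entropy_le_zero(2)[OF assms(2) _ sum] assms by auto
  moreover obtain U l where "unitary_diag (\<rho> + \<sigma>) U l" using psd_unitary_diag[OF psd_add[OF assms]] by blast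
  then have L: "mat_fun ln (\<rho> + \<sigma>) \<in> carrier_mat n n" using unitary_diag_mat_fun(1)[OF sum] by blast
  have "mat_trace ((\<rho> + \<sigma>) * mat_fun ln (\<rho> + \<sigma>)) =
      mat_trace (\<rho> * mat_fun ln (\<rho> + \<sigma>)) + mat_trace (\<sigma> * mat_fun ln (\<rho> + \<sigma>))"
    unfolding add_mult_distrib_mat[OF r s L]
    by (rule mat_trace_add[OF mult_carrier_mat[OF r L] mult_carrier_mat[OF s L]])
  ultimately show ?thesis by (simp add: relative_entropy_def entropy_def)
qed

text \<open>Concavity of the entropy for unnormalised arguments, from subadditivity of the relative
  entropy with the reference operators s 1 and t 1, which add up. The correction is s + t times the
  binary entropy of s / (s + t).\<close>

lemma entropy_add_ge:
  assumes "psd n \<rho>" "psd n \<sigma>"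
  defines "s \<equiv> Re (mat_trace \<rho>)" and "t \<equiv> Re (mat_trace \<sigma>)"
  shows "entropy \<rho> + entropy \<sigma> \<le> entropy (\<rho> + \<sigma>) + ((s + t) * ln (s + t) - s * ln s - t * ln t)"
proof -
  note r = psd_carrier[OF assms(1)] and sc = psd_carrier[OF assms(2)]
  have "complex_of_real s \<cdot>\<^sub>m 1\<^sub>m n + complex_of_real t \<cdot>\<^sub>m 1\<^sub>m n = complex_of_real (s + t) \<cdot>\<^sub>m 1\<^sub>m n"
    by (rule eq_matI) auto
  then have "relative_entropy (\<rho> + \<sigma>) (complex_of_real (s + t) \<cdot>\<^sub>m 1\<^sub>m n) \<le>
      relative_entropy \<rho> (complex_of_real s \<cdot>\<^sub>m 1\<^sub>m n) + relative_entropy \<sigma> (complex_of_real t \<cdot>\<^sub>m 1\<^sub>m n)"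
    using relative_entropy_add_le[OF dominated_trace_one[OF assms(1)] dominated_trace_one[OF assms(2)]]
    by (simp add: s_def t_def)
  moreover have "Re (mat_trace (\<rho> + \<sigma>)) = s + t" by (simp add: mat_trace_add[OF r sc] s_def t_def)
  ultimately show ?thesis
    unfolding relative_entropy_scaled_one[OF assms(1)] relative_entropy_scaled_one[OF assms(2)]
      relative_entropy_scaled_one[OF psd_add[OF assms(1,2)]]
    by (simp add: s_def[symmetric] t_def[symmetric] algebra_simps)
qed

text \<open>The first factor, of dimension \<open>k\<close>, is conditioned on the second one, of
  dimension \<open>m\<close>.\<close>

definition cond_entropy :: "nat \<Rightarrow> nat \<Rightarrow> complex mat \<Rightarrow> real" where
  "cond_entropy k m \<rho> = entropy \<rho> - entropy (ptrace_left k m \<rho>)"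

lemma kron_one_smult:
  assumes "B \<in> carrier_mat m m"
  shows "kron_one k (c \<cdot>\<^sub>m B) = c \<cdot>\<^sub>m kron_one k B"
proof (rule kron_one_unique[symmetric])
  fix a b assume ab: "a < k" "b < k"
  show "block m (c \<cdot>\<^sub>m kron_one k B) a b = (if a = b then c \<cdot>\<^sub>m B else 0\<^sub>m m m)"
    unfolding block_smult[OF kron_one_carrier[OF assms] ab] block_kron_one[OF assms ab] by simp
qed (use assms in auto)

lemma dominated_kron_ptrace:
  assumes "psd (k * m) A" "c > 0"
  shows "dominated (k * m) A (kron_one k (complex_of_real c \<cdot>\<^sub>m ptrace_left k m A))"
proof (rule dominated_le[OF assms(1)])
  let ?R = "ptrace_left k m A"
  have R: "?R \<in> carrier_mat m m" by simp
  show "psd (k * m) (kron_one k (complex_of_real c \<cdot>\<^sub>m ?R))"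
    using assms by (intro psd_kron_one psd_smult psd_ptrace_left) auto
  have "complex_of_real (real k / c) \<cdot>\<^sub>m kron_one k (complex_of_real c \<cdot>\<^sub>m ?R) =
      kron_one k (complex_of_real (real k) \<cdot>\<^sub>m ?R)"
    unfolding kron_one_smult[OF R] using assms(2) kron_one_carrier[OF R, of k] by (intro eq_matI) auto
  then show "psd (k * m) (complex_of_real (real k / c) \<cdot>\<^sub>m kron_one k (complex_of_real c \<cdot>\<^sub>m ?R) - A)"
    using psd_kron_ptrace_left_diff[OF assms(1)] by simp
qed

text \<open>The logarithm of the reference operator acts on the second factor only, so A enters the
  cross term through its marginal. The scale c stays free because c = 1 / k gives the reference
  operator the trace of A, while c = k makes it dominate A; these yield the two bounds on the
  conditional entropy.\<close>

lemma relative_entropy_kron_ptrace: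
  assumes "psd (k * m) A" "c > 0"
  shows "relative_entropy A (kron_one k (complex_of_real c \<cdot>\<^sub>m ptrace_left k m A)) =
    - cond_entropy k m A - ln c * Re (mat_trace A)"
proof -
  let ?R = "ptrace_left k m A"
  have cR: "complex_of_real c \<cdot>\<^sub>m ?R \<in> carrier_mat m m" by simp
  note R = psd_ptrace_left[OF assms(1)] and A = psd_carrier[OF assms(1)]
  have "psd m (complex_of_real c \<cdot>\<^sub>m ?R)" by (rule psd_smult[OF R]) (use assms in simp)
  then obtain V q where V: "unitary_diag (complex_of_real c \<cdot>\<^sub>m ?R) V q" using psd_unitary_diag by blast
  have "mat_trace (A * mat_fun ln (kron_one k (complex_of_real c \<cdot>\<^sub>m ?R))) =
      mat_trace (?R * mat_fun ln (complex_of_real c \<cdot>\<^sub>m ?R))"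
    unfolding mat_fun_kron_one[OF cR V]
    by (rule mat_trace_mult_kron_one[OF A unitary_diag_mat_fun(1)[OF cR V]])
  then show ?thesis
    by (simp add: relative_entropy_def trace_mult_ln_smult[OF R assms(2)] cond_entropy_def entropy_def
        mat_trace_ptrace_left[OF A])
qed

lemma relative_entropy_kron_ptrace_one:
  assumes "psd (k * m) A"
  shows "dominated (k * m) A (kron_one k (ptrace_left k m A))"
    "relative_entropy A (kron_one k (ptrace_left k m A)) = - cond_entropy k m A"
proof -
  have "complex_of_real 1 \<cdot>\<^sub>m ptrace_left k m A = ptrace_left k m A" by (rule eq_matI) auto
  then show "dominated (k * m) A (kron_one k (ptrace_left k m A))"
    "relative_entropy A (kron_one k (ptrace_left k m A)) = - cond_entropy k m A"
    using dominated_kron_ptrace[OF assms, of 1] relative_entropy_kron_ptrace[OF assms, of 1] by simp_all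
qed

lemma ptrace_left_add:
  "A \<in> carrier_mat (k * m) (k * m) \<Longrightarrow> B \<in> carrier_mat (k * m) (k * m) \<Longrightarrow>
    ptrace_left k m (A + B) = ptrace_left k m A + ptrace_left k m B"
  by (rule eq_matI) (simp_all add: ptrace_left_def sum.distrib mult_add_less)

text \<open>The reference operators add up along with the states, so subadditivity of the relative
  entropy applies. For mixtures of states this is concavity, a form of strong subadditivity.\<close>

lemma cond_entropy_add_ge:
  assumes "psd (k * m) \<rho>" "psd (k * m) \<sigma>"
  shows "cond_entropy k m \<rho> + cond_entropy k m \<sigma> \<le> cond_entropy k m (\<rho> + \<sigma>)"
proof -
  have "kron_one k (ptrace_left k m (\<rho> + \<sigma>)) =
      kron_one k (ptrace_left k m \<rho>) + kron_one k (ptrace_left k m \<sigma>)"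
    unfolding ptrace_left_add[OF psd_carrier[OF assms(1)] psd_carrier[OF assms(2)]]
    by (rule kron_one_add[OF ptrace_left_carrier ptrace_left_carrier])
  then show ?thesis
    using relative_entropy_add_le[OF relative_entropy_kron_ptrace_one(1)[OF assms(1)]
        relative_entropy_kron_ptrace_one(1)[OF assms(2)]]
      relative_entropy_kron_ptrace_one(2)[OF assms(1)] relative_entropy_kron_ptrace_one(2)[OF assms(2)]
      relative_entropy_kron_ptrace_one(2)[OF psd_add[OF assms]] by simp
qed

text \<open>The joint entropies are subadditive and the marginal ones superadditive up to the
  entropy of mixing; the correction comes from the marginals alone.\<close>

lemma cond_entropy_add_le:
  assumes "psd (k * m) \<rho>" "psd (k * m) \<sigma>"
  defines "s \<equiv> Re (mat_trace \<rho>)" and "t \<equiv> Re (mat_trace \<sigma>)"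
  shows "cond_entropy k m (\<rho> + \<sigma>) \<le>
    cond_entropy k m \<rho> + cond_entropy k m \<sigma> + ((s + t) * ln (s + t) - s * ln s - t * ln t)"
proof -
  note r = psd_carrier[OF assms(1)] and sc = psd_carrier[OF assms(2)]
  show ?thesis
    using entropy_add_le[OF assms(1,2)] entropy_add_ge[OF psd_ptrace_left[OF assms(1)] psd_ptrace_left[OF assms(2)]]
    unfolding cond_entropy_def ptrace_left_add[OF r sc] mat_trace_ptrace_left[OF r] mat_trace_ptrace_left[OF sc]
    by (simp add: s_def t_def)
qed

lemma cond_entropy_bounds:
  assumes A: "psd (k * m) A" and k: "k > 0"
  shows "cond_entropy k m A \<le> ln (real k) * Re (mat_trace A)"
    "- ln (real k) * Re (mat_trace A) \<le> cond_entropy k m A"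
proof -
  let ?R = "ptrace_left k m A"
  note c = psd_carrier[OF A]
  let ?S = "kron_one k (complex_of_real (1 / real k) \<cdot>\<^sub>m ?R)"
  have "mat_trace ?S = (\<Sum>a<k. mat_trace (block m ?S a a))"
    by (rule mat_trace_blocks[OF kron_one_carrier]) simp
  also have "\<dots> = (\<Sum>a<k. mat_trace (complex_of_real (1 / real k) \<cdot>\<^sub>m ?R))"
    by (intro sum.cong refl arg_cong[of _ _ mat_trace]) (subst block_kron_one; simp)
  also have "\<dots> = mat_trace A"
    unfolding mat_trace_smult[OF ptrace_left_carrier] mat_trace_ptrace_left[OF c] using k by simp
  finally have "mat_trace ?S = mat_trace A" .
  then have "0 \<le> relative_entropy A ?S"
    using relative_entropy_ge[OF dominated_kron_ptrace[OF A, of "1 / real k"]] k by simp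
  then show "cond_entropy k m A \<le> ln (real k) * Re (mat_trace A)"
    using relative_entropy_kron_ptrace[OF A, of "1 / real k"] k by (simp add: ln_div)
  have "relative_entropy A (kron_one k (complex_of_real (real k) \<cdot>\<^sub>m ?R)) \<le> 0"
    by (rule relative_entropy_le_zero(2)[OF A psd_kron_ptrace_left_diff[OF A]]) simp
  then show "- ln (real k) * Re (mat_trace A) \<le> cond_entropy k m A"
    using relative_entropy_kron_ptrace[OF A, of "real k"] k by simp
qed

text \<open>A channel on the conditioning factor carries the reference operator of A to the
  reference operator of the image, so monotonicity of the relative entropy applies to the
  pair.\<close>

lemma cond_entropy_data_processing:
  assumes "cptp m m' \<Phi>" and A: "psd (k * m) A"
  shows "cond_entropy k m A \<le> cond_entropy k m' (id_tensor k m m' \<Phi> A)"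
proof -
  have so: "superoperator m m' \<Phi>" using assms by (simp add: cptp_def)
  note T = cptp_id_tensor[OF assms(1), of k]
  have "relative_entropy (id_tensor k m m' \<Phi> A) (id_tensor k m m' \<Phi> (kron_one k (ptrace_left k m A)))
      \<le> relative_entropy A (kron_one k (ptrace_left k m A))"
    by (rule data_processing(2)[OF T relative_entropy_kron_ptrace_one(1)[OF A]])
  then show ?thesis
    unfolding id_tensor_kron_one[OF so ptrace_left_carrier] ptrace_left_id_tensor[OF so, symmetric]
      relative_entropy_kron_ptrace_one(2)[OF A] relative_entropy_kron_ptrace_one(2)[OF cptp_psd[OF T A]] by simp
qed

text \<open>P and N are the positive and negative parts of the difference. Equal traces of the
  states give P and N equal traces, hence half the trace norm each.\<close>

lemma trace_norm_decomposition:
  assumes "psd n \<rho>" "psd n \<sigma>" "mat_trace \<rho> = mat_trace \<sigma>"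
  shows "\<exists>P N. psd n P \<and> psd n N \<and> \<rho> + N = \<sigma> + P \<and>
    Re (mat_trace P) = trace_norm (\<rho> - \<sigma>) / 2 \<and> Re (mat_trace N) = trace_norm (\<rho> - \<sigma>) / 2"
proof -
  note r = psd_carrier[OF assms(1)] and s = psd_carrier[OF assms(2)]
  define D where "D = \<rho> - \<sigma>"
  have D: "D \<in> carrier_mat n n" using s by (auto simp: D_def intro: minus_carrier_mat)
  have "mat_adjoint D = D"
    unfolding D_def mat_adjoint_minus[OF r s] psd_hermitian[OF assms(1)] psd_hermitian[OF assms(2)] ..
  then obtain U l where U: "unitary_diag D U l" using hermitian_unitary_diag[OF D] by blast
  note u = unitary_diagD[OF D U]
  let ?D = "\<lambda>f. mat_diag n (\<lambda>i. complex_of_real (f i))"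
  define M where "M f = U * ?D f * mat_adjoint U" for f :: "nat \<Rightarrow> real"
  have dims: "dim_row U = n" "dim_col U = n" using u(1) by auto
  have M: "M f \<in> carrier_mat n n" for f unfolding M_def by (intro carrier_matI; simp add: dims)
  have MU: "unitary_diag (M f) U f" for f
    using u(1,2) dims by (simp add: unitary_diag_def M_def)
  have trM: "Re (mat_trace (M f)) = (\<Sum>i<n. f i)" for f
    unfolding unitary_diag_trace[OF M MU] by simp
  have diff: "M f - M g = M (\<lambda>i. f i - g i)" for f g
  proof -
    have c: "?D f \<in> carrier_mat n n" "?D g \<in> carrier_mat n n" by auto
    have "?D (\<lambda>i. f i - g i) = ?D f - ?D g" by (rule eq_matI) (auto simp: mat_diag_def)
    then show ?thesis
      unfolding M_def
      using mult_minus_distrib_mat[OF u(1) c] minus_mult_distrib_mat[OF mult_carrier_mat[OF u(1) c(1)]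
          mult_carrier_mat[OF u(1) c(2)] mat_adjoint_carrier[OF u(1)]] by simp
  qed
  define P where "P = M (\<lambda>i. max (l i) 0)"
  define N where "N = M (\<lambda>i. max (- l i) 0)"
  have PN: "P \<in> carrier_mat n n" "N \<in> carrier_mat n n" using M by (auto simp: P_def N_def)
  have psd: "psd n P" "psd n N"
    unfolding P_def N_def by (rule unitary_diag_psd[OF M MU]; simp)+
  have "P - N = D"
  proof -
    have "max (l i) 0 - max (- l i) 0 = l i" for i by (simp add: max_def)
    then show ?thesis unfolding P_def N_def diff using u(4) by (simp add: M_def)
  qed
  then have DPN: "\<rho> - \<sigma> = P - N" by (simp add: D_def)
  have eq: "\<rho> + N = \<sigma> + P"
  proof (rule eq_matI)
    fix i j assume "i < dim_row (\<sigma> + P)" "j < dim_col (\<sigma> + P)"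
    then have ij: "i < n" "j < n" using PN by auto
    have "(\<rho> - \<sigma>) $$ (i, j) = (P - N) $$ (i, j)" using DPN by simp
    then show "(\<rho> + N) $$ (i, j) = (\<sigma> + P) $$ (i, j)"
      using ij r s PN by (simp add: algebra_simps)
  qed (use r s PN in auto)
  have sq: "mat_adjoint D * D = M (\<lambda>i. l i * l i)"
  proof -
    have "mat_adjoint D * D = U * ?D l * (mat_adjoint U * (U * ?D l * mat_adjoint U))"
      unfolding \<open>mat_adjoint D = D\<close> using u(4) dims by (subst u(4)) (simp add: mult_mat_assoc)
    also have "\<dots> = U * (?D l * ?D l) * mat_adjoint U"
      using dims by (simp add: mult_mat_assoc mult_mat_cancel_left[OF u(2)] del: mat_diag_diag)
    finally show ?thesis by (simp add: M_def)
  qed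
  have "trace_norm (\<rho> - \<sigma>) = Re (mat_trace (M (\<lambda>i. sqrt (l i * l i))))"
    unfolding trace_norm_def D_def[symmetric] sq mat_fun_unitary_diag[OF M MU] M_def[symmetric] ..
  then have tn: "trace_norm (\<rho> - \<sigma>) = (\<Sum>i<n. \<bar>l i\<bar>)" unfolding trM by simp
  have "(\<Sum>i<n. l i) = 0"
    using unitary_diag_trace[OF D U] mat_trace_minus[OF r s] assms(3)
    by (simp add: D_def of_real_sum[symmetric] del: of_real_sum)
  moreover have "(\<Sum>i<n. max (l i) 0) + (\<Sum>i<n. max (- l i) 0) = (\<Sum>i<n. \<bar>l i\<bar>)"
    "(\<Sum>i<n. max (l i) 0) - (\<Sum>i<n. max (- l i) 0) = (\<Sum>i<n. l i)"
    unfolding sum.distrib[symmetric] sum_subtractf[symmetric]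
    by (rule sum.cong[OF refl]; simp add: max_def)+
  ultimately have "Re (mat_trace P) = trace_norm (\<rho> - \<sigma>) / 2" "Re (mat_trace N) = trace_norm (\<rho> - \<sigma>) / 2"
    unfolding tn P_def N_def trM by linarith+
  then show ?thesis using psd eq by blast
qed

text \<open>The Alicki--Fannes inequality, by Winter's argument: the state proportional to
  \<open>\<rho> + N = \<sigma> + P\<close> is a mixture in two ways.\<close>

lemma cond_entropy_continuity:
  assumes "psd (k * m) \<rho>" "psd (k * m) \<sigma>" "mat_trace \<rho> = 1" "mat_trace \<sigma> = 1" and k: "k > 0"
  defines "\<delta> \<equiv> trace_norm (\<sigma> - \<rho>) / 2"
  shows "0 \<le> \<delta>"
    and "cond_entropy k m \<rho> - cond_entropy k m \<sigma> \<le> 2 * \<delta> * ln (real k) + (1 + \<delta>) * ln (1 + \<delta>) - \<delta> * ln \<delta>"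
proof -
  obtain P N where PN: "psd (k * m) P" "psd (k * m) N" "\<rho> + N = \<sigma> + P"
    "Re (mat_trace P) = \<delta>" "Re (mat_trace N) = \<delta>"
    using trace_norm_decomposition[OF assms(2,1)] assms(3,4) unfolding \<delta>_def by metis
  show "0 \<le> \<delta>" using Re_psd_trace[OF PN(1)] PN(4) by simp
  have "cond_entropy k m \<rho> + cond_entropy k m N \<le> cond_entropy k m (\<sigma> + P)"
    using cond_entropy_add_ge[OF assms(1) PN(2)] PN(3) by simp
  also have "\<dots> \<le> cond_entropy k m \<sigma> + cond_entropy k m P + ((1 + \<delta>) * ln (1 + \<delta>) - \<delta> * ln \<delta>)"
    using cond_entropy_add_le[OF assms(2) PN(1)] PN(4) assms(4) by simp
  \<comment> \<open>N and P have trace \<delta>, so their conditional entropies lie within \<delta>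
    ln k of 0; this is the origin of the factor 2.\<close>
  finally show "cond_entropy k m \<rho> - cond_entropy k m \<sigma> \<le>
      2 * \<delta> * ln (real k) + (1 + \<delta>) * ln (1 + \<delta>) - \<delta> * ln \<delta>"
    using cond_entropy_bounds(1)[OF PN(1) k] cond_entropy_bounds(2)[OF PN(2) k] PN(4,5)
    by (simp add: algebra_simps)
qed

text \<open>With x = \<epsilon> / 2 the right-hand side is the stated bound, as 8 x = 4 \<epsilon>
  and 4 x = 2 \<epsilon>. In -\<delta> ln \<delta>, \<delta> may be raised to x, and -x ln x is h /
  4 + 2 x ln 2 with h = -4 x ln (4 x). All terms linear in x are absorbed by the surplus, at least 6
  x L, since ln 2 \<le> L.\<close>

lemma continuity_bound_le:
  fixes \<delta> x L :: real
  assumes "0 \<le> \<delta>" "\<delta> \<le> x" "x \<le> 1 / 4" "ln 2 \<le> L"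
  shows "2 * \<delta> * L + (1 + \<delta>) * ln (1 + \<delta>) - \<delta> * ln \<delta> \<le>
    8 * x * L + 2 * (- (4 * x) * ln (4 * x) - (1 - 4 * x) * ln (1 - 4 * x))"
proof (cases "x = 0")
  case True
  then show ?thesis using assms by simp
next
  case False
  then have x: "0 < x" using assms by simp
  have ln2: "1 \<le> 2 * ln (2 :: real)"
  proof -
    have "exp 1 \<le> (4 :: real)" using exp_le by simp
    then have "1 \<le> ln (4 :: real)" by (subst ln_ge_iff) auto
    also have "(4 :: real) = 2 ^ 2" by simp
    finally show ?thesis by (simp only: ln_realpow)
  qed
  have ln4x: "ln (4 * x) = 2 * ln 2 + ln x"
  proof -
    have "ln (4 * x) = ln (2 * (2 * x))" by simp
    also have "\<dots> = ln 2 + (ln 2 + ln x)" using x by (simp only: ln_mult) simp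
    finally show ?thesis by simp
  qed
  have "ln (4 * x) \<le> 0" using x assms(3) by simp
  \<comment> \<open>This says that x is at most 1 / e, the range where -x ln x increases. The
    tangent bound ln y \<le> y - 1 at y = x / \<delta> then takes the place of a derivative
    argument.\<close>
  then have lnx: "ln x \<le> - 1" using ln4x ln2 by linarith
  have d: "- \<delta> * ln \<delta> \<le> - x * ln x"
  proof (cases "\<delta> = 0")
    case True
    have "x * ln x \<le> 0" by (rule mult_nonneg_nonpos) (use x lnx in linarith)+
    then show ?thesis using True by simp
  next
    case False
    then have \<delta>: "0 < \<delta>" using assms by simp
    have "ln (x / \<delta>) \<le> x / \<delta> - 1" using x \<delta> by (intro ln_le_minus_one) simp
    then have "\<delta> * ln (x / \<delta>) \<le> \<delta> * (x / \<delta> - 1)" using \<delta> by (intro mult_left_mono) auto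
    then have "\<delta> * (ln x - ln \<delta>) \<le> x - \<delta>"
      using x \<delta> by (simp add: ln_div right_diff_distrib)
    moreover have "(x - \<delta>) * 1 \<le> (x - \<delta>) * (- ln x)" using assms(2) lnx by (intro mult_left_mono) auto
    ultimately show ?thesis by (simp add: algebra_simps)
  qed
  have p: "(1 + \<delta>) * ln (1 + \<delta>) \<le> 5 / 4 * x"
  proof -
    have "ln (1 + \<delta>) \<le> \<delta>" using ln_add_one_self_le_self[OF assms(1)] .
    then have "(1 + \<delta>) * ln (1 + \<delta>) \<le> (1 + \<delta>) * \<delta>" using assms(1) by (intro mult_left_mono) auto
    also have "\<dots> \<le> 5 / 4 * x" using assms by (intro mult_mono) auto
    finally show ?thesis .
  qed
  define h where "h = - (4 * x) * ln (4 * x)"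
  have h0: "0 \<le> h"
    using mult_nonneg_nonpos[OF _ \<open>ln (4 * x) \<le> 0\<close>, of "4 * x"] x by (simp add: h_def)
  have h': "0 \<le> - (1 - 4 * x) * ln (1 - 4 * x)"
  proof (cases "1 - 4 * x = 0")
    case False
    then have "0 < 1 - 4 * x" using assms(3) by simp
    then have "ln (1 - 4 * x) \<le> 0" using x by simp
    then have "(1 - 4 * x) * ln (1 - 4 * x) \<le> 0"
      using assms(3) by (intro mult_nonneg_nonpos) auto
    then show ?thesis by linarith
  qed simp
  have xlnx: "- x * ln x = h / 4 + 2 * x * ln 2" unfolding h_def ln4x by (simp add: field_simps)
  have "x * 1 \<le> x * (2 * ln 2)" using x ln2 by (intro mult_left_mono) auto
  then have x2: "x \<le> 2 * (x * ln 2)" by (simp add: mult_ac)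
  have xL: "x * ln 2 \<le> x * L" "\<delta> * L \<le> x * L"
    using x ln2 assms by (auto intro!: mult_left_mono mult_right_mono)
  have "2 * (\<delta> * L) + (1 + \<delta>) * ln (1 + \<delta>) + - \<delta> * ln \<delta> \<le>
    8 * (x * L) + 2 * (h + - (1 - 4 * x) * ln (1 - 4 * x))"
  proof -
    \<comment> \<open>Once the products are named by variables, with X for x ln 2, Y for x L and D
      for \<delta> L, the remaining inequality is linear.\<close>
    have "2 * D + B + A \<le> 8 * Y + 2 * (h + h2)"
      if "A \<le> E" "B \<le> 5 / 4 * x" "0 \<le> h" "0 \<le> h2" "E = h / 4 + 2 * X" "x \<le> 2 * X"
        "X \<le> Y" "D \<le> Y" "0 < x" for A B D E X Y h h2 :: real
      using that unfolding distrib_left by linarith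
    from this[OF d p h0 h' xlnx[unfolded mult.assoc] x2 xL x] show ?thesis .
  qed
  then show ?thesis
    unfolding h_def by (simp only: mult.assoc minus_mult_left[symmetric] diff_conv_add_uminus)
qed

lemma cond_entropy_continuity_bound:
  assumes "psd (d * m) \<rho>" "psd (d * m) \<sigma>" "mat_trace \<rho> = 1" "mat_trace \<sigma> = 1" and d: "d > 0"
    and "trace_norm (\<sigma> - \<rho>) \<le> \<epsilon>" "\<epsilon> \<le> 1 / 2"
  shows "cond_entropy d m \<rho> - cond_entropy d m \<sigma> \<le>
    4 * \<epsilon> * ln (real d) + 2 * (- (2 * \<epsilon>) * ln (2 * \<epsilon>) - (1 - 2 * \<epsilon>) * ln (1 - 2 * \<epsilon>))"
proof -
  define \<delta> where "\<delta> = trace_norm (\<sigma> - \<rho>) / 2"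
  note c = cond_entropy_continuity[OF assms(1-4) d, folded \<delta>_def]
  have \<delta>: "0 \<le> \<delta>" "\<delta> \<le> \<epsilon> / 2" "\<epsilon> / 2 \<le> 1 / 4" using c(1) assms(6,7) by (auto simp: \<delta>_def)
  show ?thesis
  proof (cases "d = 1")
    \<comment> \<open>Here ln d = 0, so \<open>continuity_bound_le\<close> does not apply; but both
      bounds on the conditional entropy are 0, and the binary entropy is nonnegative.\<close>
    case True
    have "cond_entropy d m \<rho> - cond_entropy d m \<sigma> \<le> 0"
      using cond_entropy_bounds[OF assms(1) d] cond_entropy_bounds[OF assms(2) d] True by simp
    moreover have "0 \<le> - (2 * \<epsilon>) * ln (2 * \<epsilon>) - (1 - 2 * \<epsilon>) * ln (1 - 2 * \<epsilon>)"
    proof -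
      have "0 \<le> - (x * ln x)" if "0 \<le> x" "x \<le> 1" for x :: real
        using that by (cases "x = 0") (auto simp: mult_nonneg_nonpos)
      from this[of "2 * \<epsilon>"] this[of "1 - 2 * \<epsilon>"] show ?thesis using \<delta> by simp
    qed
    ultimately show ?thesis using True by simp
  next
    case False
    then have "ln 2 \<le> ln (real d)" using d by (subst ln_le_cancel_iff) auto
    from continuity_bound_le[OF \<delta> this] c(2) show ?thesis by simp
  qed
qed

section \<open>Markovian chains\<close>

text \<open>Entry (a, b) of the marginal is the trace of block (a, b), which a trace preserving map
  does not change. A channel acting on a discarded factor therefore leaves no mark on the
  rest.\<close>

lemma ptrace_right_id_tensor:
  assumes "cptp m m' \<Phi>"
  shows "ptrace_right k m' (id_tensor k m m' \<Phi> A) = ptrace_right k m A"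
proof (rule eq_matI)
  have so: "superoperator m m' \<Phi>" using assms by (simp add: cptp_def)
  fix a b assume "a < dim_row (ptrace_right k m A)" "b < dim_col (ptrace_right k m A)"
  then have ab: "a < k" "b < k" by (simp_all add: ptrace_right_def)
  have "ptrace_right k m' (id_tensor k m m' \<Phi> A) $$ (a, b) = mat_trace (block m' (id_tensor k m m' \<Phi> A) a b)"
    using ab by (simp add: ptrace_right_def mat_trace_def)
  also have "\<dots> = mat_trace (block m A a b)"
    using assms by (simp add: block_id_tensor[OF so ab] cptp_def)
  also have "\<dots> = ptrace_right k m A $$ (a, b)"
    using ab by (simp add: ptrace_right_def mat_trace_def)
  finally show "ptrace_right k m' (id_tensor k m m' \<Phi> A) $$ (a, b) = ptrace_right k m A $$ (a, b)" .
qed (simp_all add: ptrace_right_def)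

section \<open>Regrouping nested partial traces\<close>

lemma ptrace_right_ptrace_right:
  "ptrace_right k m (ptrace_right (k * m) m' A) = ptrace_right k (m * m') A"
proof (rule eq_matI)
  fix a b assume "a < dim_row (ptrace_right k (m * m') A)" "b < dim_col (ptrace_right k (m * m') A)"
  then have ab: "a < k" "b < k" by (simp_all add: ptrace_right_def)
  have e: "(c * m + p) * m' + q = c * (m * m') + (p * m' + q)" for c p q by (simp add: algebra_simps)
  show "ptrace_right k m (ptrace_right (k * m) m' A) $$ (a, b) = ptrace_right k (m * m') A $$ (a, b)"
    using ab by (simp add: ptrace_right_def mult_add_less sum_mult_index e)
qed (simp_all add: ptrace_right_def)

lemma ptrace_left_ptrace_left:
  "ptrace_left k m (ptrace_left l (k * m) A) = ptrace_left (l * k) m A"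
proof (rule eq_matI)
  fix p q assume "p < dim_row (ptrace_left (l * k) m A)" "q < dim_col (ptrace_left (l * k) m A)"
  then have pq: "p < m" "q < m" by (simp_all add: ptrace_left_def)
  have e: "(a * k + b) * m + r = a * (k * m) + (b * m + r)" for a b r by (simp add: algebra_simps)
  have "ptrace_left k m (ptrace_left l (k * m) A) $$ (p, q) =
      (\<Sum>b<k. \<Sum>a<l. A $$ (a * (k * m) + (b * m + p), a * (k * m) + (b * m + q)))"
    using pq by (simp add: ptrace_left_def mult_add_less)
  also have "\<dots> = (\<Sum>a<l. \<Sum>b<k. A $$ (a * (k * m) + (b * m + p), a * (k * m) + (b * m + q)))"
    by (rule sum.swap)
  also have "\<dots> = ptrace_left (l * k) m A $$ (p, q)"
    using pq by (simp add: ptrace_left_def sum_mult_index e)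
  finally show "ptrace_left k m (ptrace_left l (k * m) A) $$ (p, q) = ptrace_left (l * k) m A $$ (p, q)" .
qed (simp_all add: ptrace_left_def)

lemma ptrace_left_ptrace_right:
  "ptrace_left l k (ptrace_right (l * k) m A) = ptrace_right k m (ptrace_left l (k * m) A)"
proof (rule eq_matI)
  fix p q assume "p < dim_row (ptrace_right k m (ptrace_left l (k * m) A))"
    "q < dim_col (ptrace_right k m (ptrace_left l (k * m) A))"
  then have pq: "p < k" "q < k" by (simp_all add: ptrace_right_def)
  have e: "(a * k + b) * m + r = a * (k * m) + (b * m + r)" for a b r by (simp add: algebra_simps)
  have "ptrace_left l k (ptrace_right (l * k) m A) $$ (p, q) =
      (\<Sum>a<l. \<Sum>r<m. A $$ (a * (k * m) + (p * m + r), a * (k * m) + (q * m + r)))"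
    using pq by (simp add: ptrace_left_def ptrace_right_def mult_add_less e)
  also have "\<dots> = (\<Sum>r<m. \<Sum>a<l. A $$ (a * (k * m) + (p * m + r), a * (k * m) + (q * m + r)))"
    by (rule sum.swap)
  also have "\<dots> = ptrace_right k m (ptrace_left l (k * m) A) $$ (p, q)"
    using pq by (simp add: ptrace_left_def ptrace_right_def mult_add_less)
  finally show "ptrace_left l k (ptrace_right (l * k) m A) $$ (p, q) =
      ptrace_right k m (ptrace_left l (k * m) A) $$ (p, q)" .
qed (simp_all add: ptrace_left_def ptrace_right_def)

lemma ptrace_trivial:
  assumes "A \<in> carrier_mat n n"
  shows "ptrace_left 1 n A = A" "ptrace_right n 1 A = A"
  using assms by (auto simp: ptrace_left_def ptrace_right_def)

lemma psd_reduced: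
  assumes "psd (d ^ n) \<rho>" "1 \<le> i" "i \<le> j" "j \<le> n"
  shows "psd (d ^ (j + 1 - i)) (reduced d n i j \<rho>)"
  unfolding reduced_def
proof (intro psd_ptrace_left)
  have "d ^ j * d ^ (n - j) = d ^ n" using assms(4) by (simp add: power_add[symmetric])
  then have "psd (d ^ j) (ptrace_right (d ^ j) (d ^ (n - j)) \<rho>)"
    using assms(1) by (intro psd_ptrace_right) simp
  also have "d ^ j = d ^ (i - 1) * d ^ (j + 1 - i)" using assms(2,3) by (simp add: power_add[symmetric])
  finally show "psd (d ^ (i - 1) * d ^ (j + 1 - i)) (ptrace_right (d ^ j) (d ^ (n - j)) \<rho>)" 
    using assms(2,3) by (simp add: power_add[symmetric])
qed

section \<open>States along the chain and their tails\<close>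

lemma chain_density:
  assumes "\<And>i. 1 \<le> i \<Longrightarrow> i \<le> k \<Longrightarrow> cptp d (d * d) (\<Phi> i)" and "density d \<sigma>"
  shows "density (d ^ Suc k) (chain d \<Phi> \<sigma> k)"
  using assms(1)
proof (induction k)
  case 0
  then show ?case using assms(2) by simp
next
  case (Suc k)
  have T: "cptp (d ^ k * d) (d ^ k * (d * d)) (id_tensor (d ^ k) d (d * d) (\<Phi> (Suc k)))"
    by (rule cptp_id_tensor) (use Suc.prems in simp)
  have dims: "d ^ Suc k = d ^ k * d" "d ^ Suc (Suc k) = d ^ k * (d * d)" by (simp_all add: mult_ac)
  have "density (d ^ Suc k) (chain d \<Phi> \<sigma> k)" using Suc by simp
  then have "psd (d ^ k * d) (chain d \<Phi> \<sigma> k)" "mat_trace (chain d \<Phi> \<sigma> k) = 1"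
    unfolding density_def dims by auto
  then show ?case
    using T cptp_psd[OF T] psd_carrier[of "d ^ k * d"] unfolding density_def dims cptp_def by simp
qed

text \<open>The sites before \<open>a + 1\<close> are traced out: they are not touched by the remaining maps, so that
  \<open>tail_state d \<Phi> \<sigma> a j\<close>, the state of the sites \<open>a + 1, \<dots>, a + 2 + j\<close> just after \<open>\<Phi> (a + 1 + j)\<close>,
  satisfies the recursion of the chain.\<close>

definition tail_state ::
    "nat \<Rightarrow> (nat \<Rightarrow> complex mat \<Rightarrow> complex mat) \<Rightarrow> complex mat \<Rightarrow> nat \<Rightarrow> nat \<Rightarrow> complex mat" where
  "tail_state d \<Phi> \<sigma> a j = ptrace_left (d ^ a) (d ^ (j + 2)) (chain d \<Phi> \<sigma> (a + 1 + j))"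

lemma tail_state_0:
  assumes "superoperator d (d * d) (\<Phi> (a + 1))"
  shows "tail_state d \<Phi> \<sigma> a 0 = \<Phi> (a + 1) (chain_site d \<Phi> \<sigma> (a + 1))"
  using ptrace_left_id_tensor[OF assms, of "d ^ a" "chain d \<Phi> \<sigma> a"]
  by (simp add: tail_state_def chain_site_def power2_eq_square)

lemma tail_state_Suc:
  assumes "superoperator d (d * d) (\<Phi> (a + 2 + j))"
  shows "tail_state d \<Phi> \<sigma> a (Suc j) = id_tensor (d ^ (j + 1)) d (d * d) (\<Phi> (a + 2 + j)) (tail_state d \<Phi> \<sigma> a j)"
proof -
  have dims: "d ^ a * d ^ (j + 1) = d ^ (a + 1 + j)" "d ^ (j + 1) * d = d ^ (j + 2)"
      "d ^ (j + 1) * (d * d) = d ^ (Suc j + 2)"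
    by (simp_all add: power_add mult_ac)
  have "chain d \<Phi> \<sigma> (a + 1 + Suc j) =
      id_tensor (d ^ (a + 1 + j)) d (d * d) (\<Phi> (a + 2 + j)) (chain d \<Phi> \<sigma> (a + 1 + j))"
    by simp
  also have "\<dots> = id_tensor (d ^ a) (d ^ (j + 2)) (d ^ (Suc j + 2))
      (id_tensor (d ^ (j + 1)) d (d * d) (\<Phi> (a + 2 + j))) (chain d \<Phi> \<sigma> (a + 1 + j))"
    using id_tensor_id_tensor[OF assms, of "d ^ a" "d ^ (j + 1)" "chain d \<Phi> \<sigma> (a + 1 + j)"]
    unfolding dims by simp
  finally show ?thesis
    unfolding tail_state_def
    using ptrace_left_id_tensor[OF superoperator_id_tensor[OF assms, of "d ^ (j + 1)", unfolded dims]] by metis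
qed

lemma tail_state_density:
  assumes "\<And>i. 1 \<le> i \<Longrightarrow> i \<le> a + 1 + j \<Longrightarrow> cptp d (d * d) (\<Phi> i)" and "density d \<sigma>"
  shows "density (d ^ (j + 2)) (tail_state d \<Phi> \<sigma> a j)"
proof -
  have "density (d ^ Suc (a + 1 + j)) (chain d \<Phi> \<sigma> (a + 1 + j))"
    using assms by (rule chain_density)
  also have "d ^ Suc (a + 1 + j) = d ^ a * d ^ (j + 2)" by (simp add: power_add mult_ac)
  finally have D: "density (d ^ a * d ^ (j + 2)) (chain d \<Phi> \<sigma> (a + 1 + j))" .
  then show ?thesis
    unfolding density_def tail_state_def
    using psd_ptrace_left[of "d ^ a" "d ^ (j + 2)"] mat_trace_ptrace_left[of _ "d ^ a" "d ^ (j + 2)"] psd_carrier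
    by metis
qed

lemma tail_state_cond_entropy:
  assumes "\<And>i. 1 \<le> i \<Longrightarrow> i \<le> a + 1 + j \<Longrightarrow> cptp d (d * d) (\<Phi> i)" and "density d \<sigma>"
  shows "cond_entropy d d (tail_state d \<Phi> \<sigma> a 0) \<le> cond_entropy d (d ^ (j + 1)) (tail_state d \<Phi> \<sigma> a j)"
  using assms(1)
proof (induction j)
  case (Suc j)
  have C: "cptp d (d * d) (\<Phi> (a + 2 + j))" using Suc.prems by simp
  then have so: "superoperator d (d * d) (\<Phi> (a + 2 + j))" by (simp add: cptp_def)
  have dims: "d ^ j * d = d ^ (j + 1)" "d ^ j * (d * d) = d ^ (Suc j + 1)" "d * d ^ j = d ^ (j + 1)"
    by (simp_all add: mult_ac)
  have "psd (d * d ^ (j + 1)) (tail_state d \<Phi> \<sigma> a j)"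
  proof -
    have "density (d ^ (j + 2)) (tail_state d \<Phi> \<sigma> a j)"
      by (rule tail_state_density[OF _ assms(2)]) (use Suc.prems in simp)
    then show ?thesis by (simp add: density_def)
  qed
  then have "cond_entropy d (d ^ (j + 1)) (tail_state d \<Phi> \<sigma> a j) \<le> cond_entropy d (d ^ (Suc j + 1))
      (id_tensor d (d ^ (j + 1)) (d ^ (Suc j + 1)) (id_tensor (d ^ j) d (d * d) (\<Phi> (a + 2 + j))) (tail_state d \<Phi> \<sigma> a j))"
    by (rule cond_entropy_data_processing[OF cptp_id_tensor[OF C, of "d ^ j", unfolded dims]])
  \<comment> \<open>The j + 1 sites not acted on split into the first one and j others; this puts
    the whole new map into the conditioning factor of the first site.\<close>
  also have "id_tensor d (d ^ (j + 1)) (d ^ (Suc j + 1)) (id_tensor (d ^ j) d (d * d) (\<Phi> (a + 2 + j))) (tail_state d \<Phi> \<sigma> a j)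
      = tail_state d \<Phi> \<sigma> a (Suc j)"
    using id_tensor_id_tensor[OF so, of d "d ^ j" "tail_state d \<Phi> \<sigma> a j"]
    unfolding dims tail_state_Suc[of d \<Phi> a j \<sigma>, OF so] .
  finally show ?case using Suc by fastforce
qed simp

text \<open>\<open>\<Phi> (a + 2)\<close> is the last map that touches site a + 2. Later maps act on
  sites that are traced out, so the marginal of the first two sites stays the one that occurs in the
  \<epsilon> condition.\<close>

lemma tail_state_ptrace_right:
  assumes "\<And>i. 1 \<le> i \<Longrightarrow> i \<le> a + 2 + j \<Longrightarrow> cptp d (d * d) (\<Phi> i)"
  shows "ptrace_right (d * d) (d ^ Suc j) (tail_state d \<Phi> \<sigma> a (Suc j)) =
    ptrace_right (d * d) d (tail_state d \<Phi> \<sigma> a 1)"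
  using assms
proof (induction j)
  case (Suc j)
  have C: "cptp d (d * d) (\<Phi> (a + 2 + Suc j))" using Suc.prems by simp
  then have so: "superoperator d (d * d) (\<Phi> (a + 2 + Suc j))" by (simp add: cptp_def)
  have dims: "d ^ (Suc j + 1) = d * d * d ^ j" "d ^ Suc (Suc j) = d ^ j * (d * d)" "d ^ j * d = d ^ Suc j"
    by (simp_all add: mult_ac)
  have "ptrace_right (d * d) (d ^ Suc (Suc j)) (tail_state d \<Phi> \<sigma> a (Suc (Suc j))) =
      ptrace_right (d * d) (d ^ j) (ptrace_right (d * d * d ^ j) (d * d)
        (id_tensor (d * d * d ^ j) d (d * d) (\<Phi> (a + 2 + Suc j)) (tail_state d \<Phi> \<sigma> a (Suc j))))"
    unfolding tail_state_Suc[of d \<Phi> a "Suc j" \<sigma>, OF so] ptrace_right_ptrace_right dims(1,2) ..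
  also have "\<dots> = ptrace_right (d * d) (d ^ Suc j) (tail_state d \<Phi> \<sigma> a (Suc j))"
    unfolding ptrace_right_id_tensor[OF C] ptrace_right_ptrace_right dims(3) ..
  finally show ?case using Suc by simp
qed simp

text \<open>Here \<open>t\<close> is minus the conditional mutual information of the site \<open>i - 1\<close> and the sites
  \<open>i + 1, \<dots>, n\<close> given the site \<open>i\<close>.\<close>

lemma conditional_information_bound:
  fixes \<epsilon> :: real
  assumes cptp: "\<And>i. 1 \<le> i \<Longrightarrow> i \<le> n - 1 \<Longrightarrow> cptp d (d * d) (\<Phi> i)" and \<sigma>: "density d \<sigma>"
    and i: "2 \<le> i" "i \<le> n - 1"
    and \<omega>: "\<omega> = \<Phi> (i - 1) (chain_site d \<Phi> \<sigma> (i - 1))"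
    and close: "trace_norm (\<omega> - ptrace_right (d * d) d (id_tensor d d (d * d) (\<Phi> i) \<omega>)) \<le> \<epsilon>"
    and \<epsilon>: "\<epsilon> \<le> 1 / 2"
  defines "\<rho> \<equiv> chain d \<Phi> \<sigma> (n - 1)"
  defines "t \<equiv> entropy (reduced d n (i - 1) n \<rho>) - entropy (reduced d n i n \<rho>)
      - entropy (reduced d n (i - 1) i \<rho>) + entropy (reduced d n i i \<rho>)"
  shows "t \<le> 0"
    and "- (4 * \<epsilon> * ln (real d) + 2 * (- (2 * \<epsilon>) * ln (2 * \<epsilon>) - (1 - 2 * \<epsilon>) * ln (1 - 2 * \<epsilon>))) \<le> t"
proof -
  \<comment> \<open>Natural subtraction disappears once a counts the sites before i - 1 and j + 1
    those after i.\<close>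
  define a where "a = i - 2"
  define j where "j = n - i - 1"
  have ij: "i = a + 2" "n = a + 3 + j" using i by (simp_all add: a_def j_def)
  define \<tau> where "\<tau> = tail_state d \<Phi> \<sigma> a (Suc j)"
  have C: "cptp d (d * d) (\<Phi> l)" if "1 \<le> l" "l \<le> a + 2 + j" for l
    using cptp[of l] that ij by simp
  have so: "superoperator d (d * d) (\<Phi> l)" if "1 \<le> l" "l \<le> a + 2 + j" for l
    using C[OF that] by (simp add: cptp_def)
  have d: "d > 0"
  proof (rule ccontr)
    assume "\<not> d > 0"
    then have "mat_trace \<sigma> = 0" using \<sigma> psd_carrier by (fastforce simp: density_def mat_trace_def)
    then show False using \<sigma> by (simp add: density_def)
  qed
  have "density (d ^ Suc (n - 1)) \<rho>" unfolding \<rho>_def using cptp \<sigma> by (rule chain_density)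
  then have \<rho>: "\<rho> \<in> carrier_mat (d ^ n) (d ^ n)" 
    using psd_carrier[of "d ^ n" \<rho>] i by (simp add: density_def del: power_Suc)
  have \<omega>0: "\<omega> = tail_state d \<Phi> \<sigma> a 0"
    using tail_state_0[of d \<Phi> a \<sigma>] so[of "a + 1"] by (simp add: \<omega> ij)
  have \<omega>1: "tail_state d \<Phi> \<sigma> a 1 = id_tensor d d (d * d) (\<Phi> i) \<omega>"
    using tail_state_Suc[of d \<Phi> a 0 \<sigma>] so[of "a + 2"] by (simp add: \<omega>0 ij)
  have idx: "n + 1 - (i - 1) = j + 3" "i - 1 - 1 = a" "n + 1 - i = j + 2" "i - 1 = a + 1"
      "n - i = Suc j" "i + 1 - (i - 1) = 2" "i + 1 - i = 1" "n - n = 0" "n - 1 = a + 1 + Suc j"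
    by (simp_all add: ij)
  have \<tau>\<rho>: "\<tau> = ptrace_left (d ^ a) (d ^ (j + 3)) \<rho>"
    unfolding \<tau>_def tail_state_def \<rho>_def idx by (simp add: numeral_3_eq_3)
  have \<rho>n: "ptrace_right (d ^ n) (d ^ 0) \<rho> = \<rho>" using ptrace_trivial(2)[OF \<rho>] by simp
  have R1: "reduced d n (i - 1) n \<rho> = \<tau>"
    unfolding reduced_def idx(1,2,8) \<tau>\<rho> \<rho>n ..
  have pow: "d * d ^ (j + 2) = d ^ (j + 3)" "d ^ a * d = d ^ (a + 1)" "d * d * d ^ Suc j = d ^ (j + 3)"
      "d ^ a * (d * d) = d ^ i" "d * d = d\<^sup>2" "d ^ 1 = d"
    by (simp_all add: ij power_add power2_eq_square power3_eq_cube mult_ac)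
  have R2: "reduced d n i n \<rho> = ptrace_left d (d ^ (j + 2)) \<tau>"
    unfolding reduced_def \<rho>n idx(3,4,8) \<tau>\<rho>
    using ptrace_left_ptrace_left[of d "d ^ (j + 2)" "d ^ a" \<rho>] unfolding pow(1,2) by simp
  have R3: "reduced d n (i - 1) i \<rho> = ptrace_right (d * d) (d ^ Suc j) \<tau>"
    unfolding reduced_def idx(2,5,6) \<tau>\<rho>
    using ptrace_left_ptrace_right[of "d ^ a" "d * d" "d ^ Suc j" \<rho>] unfolding pow(3,4) unfolding pow(5) .
  have "i - a = 2" by (simp add: ij)
  have R4: "reduced d n i i \<rho> = ptrace_left d d (reduced d n (i - 1) i \<rho>)"
    unfolding reduced_def idx(2,4,7)
    using ptrace_left_ptrace_left[of d d "d ^ a" "ptrace_right (d ^ i) (d ^ (n - i)) \<rho>"]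
    unfolding pow(2) unfolding pow(5,6) by (simp add: \<open>i - a = 2\<close>)
  have t: "t = cond_entropy d (d ^ (j + 2)) \<tau> - cond_entropy d d (ptrace_right (d * d) (d ^ Suc j) \<tau>)"
    unfolding t_def R4 R1 R2 R3 cond_entropy_def by simp
  have \<tau>: "psd (d * d ^ (j + 2)) \<tau>" "mat_trace \<tau> = 1"
    using tail_state_density[of a "Suc j" d \<Phi> \<sigma>] C \<sigma> by (simp_all add: density_def \<tau>_def)
  have dims: "d * d ^ Suc j = d ^ (j + 2)" by simp
  \<comment> \<open>Discarding the sites after i is a channel on the factor i, ..., n on which site
    i - 1 is conditioned.\<close>
  have "cond_entropy d (d * d ^ Suc j) \<tau> \<le> cond_entropy d d (id_tensor d (d * d ^ Suc j) d (ptrace_right d (d ^ Suc j)) \<tau>)"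
    by (rule cond_entropy_data_processing[OF cptp_ptrace_right]) (use \<tau> dims in simp)
  then show "t \<le> 0" unfolding id_tensor_ptrace_right unfolding t dims by simp
  have \<omega>d: "psd (d * d) \<omega>" "mat_trace \<omega> = 1"
    using tail_state_density[of a 0 d \<Phi> \<sigma>] C \<sigma> by (simp_all add: density_def \<omega>0 power2_eq_square)
  define \<rho>2 where "\<rho>2 = ptrace_right (d * d) (d ^ Suc j) \<tau>"
  have p: "cptp (d * d * d ^ Suc j) (d * d) (ptrace_right (d * d) (d ^ Suc j))" by (rule cptp_ptrace_right)
  have \<tau>': "psd (d * d * d ^ Suc j) \<tau>" using \<tau>(1) by (simp add: mult_ac)
  have \<rho>2: "psd (d * d) \<rho>2" "mat_trace \<rho>2 = 1"
    using cptp_psd[OF p \<tau>'] p \<tau>(2) psd_carrier[OF \<tau>'] by (simp_all add: \<rho>2_def cptp_def)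
  \<comment> \<open>The two-site marginal of the final state is the second matrix in
    \<open>close\<close>, so the hypothesis compares it with \<omega> directly.\<close>
  have "\<rho>2 = ptrace_right (d * d) d (id_tensor d d (d * d) (\<Phi> i) \<omega>)"
    unfolding \<rho>2_def \<tau>_def \<omega>1[symmetric] by (rule tail_state_ptrace_right) (rule C)
  then have "trace_norm (\<omega> - \<rho>2) \<le> \<epsilon>" using close by simp
  from cond_entropy_continuity_bound[OF \<rho>2(1) \<omega>d(1) \<rho>2(2) \<omega>d(2) d this \<epsilon>]
  have "cond_entropy d d \<rho>2 - cond_entropy d d \<omega> \<le>
    4 * \<epsilon> * ln (real d) + 2 * (- (2 * \<epsilon>) * ln (2 * \<epsilon>) - (1 - 2 * \<epsilon>) * ln (1 - 2 * \<epsilon>))" .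
  moreover have "cond_entropy d d \<omega> \<le> cond_entropy d (d ^ (j + 2)) \<tau>"
    using tail_state_cond_entropy[of a "Suc j" d \<Phi> \<sigma>] C \<sigma> by (simp add: \<omega>0 \<tau>_def)
  ultimately show "- (4 * \<epsilon> * ln (real d) + 2 * (- (2 * \<epsilon>) * ln (2 * \<epsilon>) - (1 - 2 * \<epsilon>) * ln (1 - 2 * \<epsilon>))) \<le> t"
    unfolding t \<rho>2_def[symmetric] by linarith
qed

theorem theorem1:
  fixes b \<epsilon> :: real and n d :: nat and \<rho> :: "complex mat"
  assumes "b > 1"
    and "0 \<le> \<epsilon>" and "\<epsilon> \<le> 1 / 2"
    and "n \<ge> 3"
    and "approx_markov_mpdo \<epsilon> n d \<rho>"
  shows "\<bar>vn_entropy b \<rho>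
      - (\<Sum>i = 2..n. vn_entropy b (reduced d n (i - 1) i \<rho>))
      + (\<Sum>i = 2..n - 1. vn_entropy b (reduced d n i i \<rho>))\<bar>
    \<le> real (n - 2) * (4 * \<epsilon> * log b (real d) + 2 * binary_entropy b (2 * \<epsilon>))"
proof -
  obtain \<Phi> \<sigma> where cptp: "\<forall>i \<in> {1..n - 1}. cptp d (d * d) (\<Phi> i)" and \<sigma>: "density d \<sigma>"
    and \<rho>: "\<rho> = chain d \<Phi> \<sigma> (n - 1)" and dens: "density (d ^ n) \<rho>"
    and close: "\<forall>i \<in> {2..n - 1}. let \<omega> = \<Phi> (i - 1) (chain_site d \<Phi> \<sigma> (i - 1))
      in trace_norm (\<omega> - ptrace_right (d * d) d (id_tensor d d (d * d) (\<Phi> i) \<omega>)) \<le> \<epsilon>"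
    using assms(5) unfolding approx_markov_mpdo_def by blast
  have psd: "psd (d ^ n) \<rho>" using dens by (simp add: density_def)
  define B where "B = 4 * \<epsilon> * ln (real d) + 2 * (- (2 * \<epsilon>) * ln (2 * \<epsilon>) - (1 - 2 * \<epsilon>) * ln (1 - 2 * \<epsilon>))"
  define t where "t i = entropy (reduced d n (i - 1) n \<rho>) - entropy (reduced d n i n \<rho>)
      - entropy (reduced d n (i - 1) i \<rho>) + entropy (reduced d n i i \<rho>)" for i
  have t: "- B \<le> t i" "t i \<le> 0" if "i \<in> {2..n - 1}" for i
    using conditional_information_bound[of n d \<Phi> \<sigma> i, OF _ \<sigma> _ _ refl _ assms(3)] cptp close that
    by (simp_all add: t_def B_def \<rho> Let_def)
  \<comment> \<open>The entropy of the sites i, ..., n, whose differences telescope from the entropy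
    of the full state down to that of the last two sites.\<close>
  define e where "e i = entropy (reduced d n i n \<rho>)" for i
  have "(\<Sum>i = 2..m. e (i - 1) - e i) = e 1 - e m" if "m \<ge> 1" for m
    using that
  proof (induction m rule: dec_induct)
    case (step m)
    then show ?case by (cases "m = 1") (simp_all add: numeral_2_eq_2)
  qed simp
  then have "(\<Sum>i = 2..n - 1. e (i - 1) - e i) = e 1 - e (n - 1)" using assms(4) by simp
  moreover have "e 1 = entropy \<rho>"
    using ptrace_trivial[OF psd_carrier[OF psd]] by (simp add: e_def reduced_def)
  \<comment> \<open>The pair i = n belongs to no term \<open>t i\<close>: its entropy is
    \<open>e (n - 1)\<close>, the end of the telescoping sum.\<close>
  moreover have "(\<Sum>i = 2..n. entropy (reduced d n (i - 1) i \<rho>)) =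
      (\<Sum>i = 2..n - 1. entropy (reduced d n (i - 1) i \<rho>)) + e (n - 1)"
    using assms(4) sum.nat_ivl_Suc'[of 2 "n - 1" "\<lambda>i. entropy (reduced d n (i - 1) i \<rho>)"]
    by (simp add: e_def)
  ultimately have sum: "entropy \<rho> - (\<Sum>i = 2..n. entropy (reduced d n (i - 1) i \<rho>))
      + (\<Sum>i = 2..n - 1. entropy (reduced d n i i \<rho>)) = (\<Sum>i = 2..n - 1. t i)"
    unfolding t_def e_def[symmetric] by (simp add: sum.distrib sum_subtractf)
  have "real (card {2..n - 1}) * (- B) \<le> (\<Sum>i = 2..n - 1. t i)"
    by (rule sum_bounded_below) (rule t)
  moreover have "(\<Sum>i = 2..n - 1. t i) \<le> 0" by (rule sum_nonpos) (rule t)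
  moreover have "card {2..n - 1} = n - 2" using assms(4) by simp
  ultimately have main: "\<bar>\<Sum>i = 2..n - 1. t i\<bar> \<le> real (n - 2) * B" by simp
  have lnb: "ln b > 0" using assms(1) by simp
  have v1: "(\<Sum>i = 2..n. vn_entropy b (reduced d n (i - 1) i \<rho>)) =
      (\<Sum>i = 2..n. entropy (reduced d n (i - 1) i \<rho>)) / ln b"
    unfolding sum_divide_distrib
  proof (intro sum.cong refl)
    fix i assume "i \<in> {2..n}"
    then have "psd (d ^ (i + 1 - (i - 1))) (reduced d n (i - 1) i \<rho>)" by (intro psd_reduced[OF psd]) auto
    then show "vn_entropy b (reduced d n (i - 1) i \<rho>) = entropy (reduced d n (i - 1) i \<rho>) / ln b"
      by (rule vn_entropy_eq)
  qed
  have v2: "(\<Sum>i = 2..n - 1. vn_entropy b (reduced d n i i \<rho>)) =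
      (\<Sum>i = 2..n - 1. entropy (reduced d n i i \<rho>)) / ln b"
    unfolding sum_divide_distrib
  proof (intro sum.cong refl)
    fix i assume "i \<in> {2..n - 1}"
    then have "psd (d ^ (i + 1 - i)) (reduced d n i i \<rho>)" by (intro psd_reduced[OF psd]) auto
    then show "vn_entropy b (reduced d n i i \<rho>) = entropy (reduced d n i i \<rho>) / ln b"
      by (rule vn_entropy_eq)
  qed
  have "vn_entropy b \<rho> - (\<Sum>i = 2..n. vn_entropy b (reduced d n (i - 1) i \<rho>))
      + (\<Sum>i = 2..n - 1. vn_entropy b (reduced d n i i \<rho>)) = (\<Sum>i = 2..n - 1. t i) / ln b"
    unfolding v1 v2 vn_entropy_eq[OF psd] sum[symmetric] by (simp add: add_divide_distrib diff_divide_distrib)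
  moreover have "4 * \<epsilon> * log b (real d) + 2 * binary_entropy b (2 * \<epsilon>) = B / ln b"
    by (simp add: B_def log_def binary_entropy_def add_divide_distrib diff_divide_distrib)
  moreover have "\<bar>(\<Sum>i = 2..n - 1. t i) / ln b\<bar> \<le> real (n - 2) * (B / ln b)"
    using divide_right_mono[OF main, of "ln b"] lnb by simp
  ultimately show ?thesis by simp
qed

end
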